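(* Assume the setting and notation described in the context (in particular, the zero-energy problem (R) has exactly $m\ge 0$ linearly independent solutions and $H$ is the limit operator defined there). Then $H_\varepsilon\to H$ in the norm-resolvent sense as $\varepsilon\to0$; more precisely, for every fixed $\zeta\in\mathbb{C}\setminus\mathbb{R}$ there is a constant $C$ (independent of $\varepsilon$) such that \[ \|(H_\varepsilon-\zeta)^{-1}-(H-\zeta)^{-1}\|_{\mathcal{B}(L^2(\Gamma))}\le C\sqrt{\varepsilon},\qquad \varepsilon\in(0,1]. \]
   Context: Let $\Gamma$ be the star graph consisting of $n$ semi-infinite edges $\gamma_1,\dots,\gamma_n$, each identified with $[0,\infty)$, joined at a common vertex $a$ (corresponding to $s=0$ on each edge). A function $\phi$ on $\Gamma$ is a tuple $(\phi_{\gamma_1},\dots,\phi_{\gamma_n})$ of functions on $[0,\infty)$; $L^2(\Gamma)=\bigoplus_i L^2(0,\infty)$, $H^2(\Gamma)=\bigoplus_i H^2(0,\infty)$ (no matching imposed at $a$), $\phi_{\gamma_i}(a):=\phi_{\gamma_i}(0)$ and $\frac{\mathrm d\phi}{\mathrm d\gamma_i}(a):=\phi_{\gamma_i}'(0)$ (derivative in the direction away from the vertex). $K(\Gamma)$ is the set of functions satisfying the Kirchhoff conditions at $a$: $\phi_{\gamma_1}(a)=\dots=\phi_{\gamma_n}(a)$ and $\sum_{i=1}^n\frac{\mathrm d\phi}{\mathrm d\gamma_i}(a)=0$. Fix $a_1,\dots,a_n>0$ and let $\Omega\subset\Gamma$ be the compact star graph with edges $\omega_i=[0,a_i]\subset\gamma_i$;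 $a_i$ also denotes the endpoint vertex of $\omega_i$, and for a function $\psi$ on $\Omega$, $\psi(a_j)$ is the value of $\psi_{\omega_j}$ at $a_j$ and $\frac{\mathrm d\psi}{\mathrm d\omega_j}(a_j)=\psi_{\omega_j}'(a_j)$. $K(\Omega)$ denotes the Kirchhoff conditions at $a$ together with the Neumann conditions $\psi_{\omega_j}'(a_j)=0$, $j=1,\dots,n$. Let $Q\in L^\infty(\Gamma)$ be real-valued with support contained in $\Omega$. Let $\lambda(\cdot)$ be holomorphic in a neighbourhood of $0$, real-valued for real arguments, with $\lambda(\varepsilon)=1+\varepsilon\lambda+O(\varepsilon^2)$ as $\varepsilon\to0$, where $\lambda\in\mathbb R$. For $\varepsilon\in(0,1]$ let $H_\varepsilon$ be the operator in $L^2(\Gamma)$ acting on each edge as $\phi\mapsto-\phi''+\lambda(\varepsilon)\varepsilon^{-2}Q(x/\varepsilon)\phi$, with domain $H^2(\Gamma)\cap K(\Gamma)$. Problem (R): $-\psi''+Q\psi=0$ on each edge of $\Omega$, $\psi\in H^2(\Omega)\cap K(\Omega)$. Assume (R) has exactly $m\ge0$ linearly independent solutions. After renumbering the edges, one can choose a basis of real-valued solutions $\psi_1,\dots,\psi_m$ with $\psi_i(a_j)=\delta_{ij}$ for $i,j\in\{1,\dots,m\}$. Put $\mathfrak m=\{1,\dots,m\}$ (empty if $m=0$), $\mathfrak n=\{1,\dots,n\}$, $\theta_{ij}:=\psi_i(a_j)$ for $i\in\mathfrak m$, $j\in\mathfrak n\setminus\mathfrak m$, and $q_{ij}:=\int_\Omega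 Q\psi_i\psi_j$ for $i,j\in\mathfrak m$. The limit operator $H$ acts as $H\phi=-\phi''$ on all $\phi\in H^2(\Gamma)$ satisfying \[ \phi_{\gamma_j}(a)-\sum_{i\in\mathfrak m}\theta_{ij}\phi_{\gamma_i}(a)=0,\quad j\in\mathfrak n\setminus\mathfrak m,\qquad \frac{\mathrm d\phi}{\mathrm d\gamma_i}(a)+\sum_{j\in\mathfrak n\setminus\mathfrak m}\theta_{ij}\frac{\mathrm d\phi}{\mathrm d\gamma_j}(a)-\lambda\sum_{j\in\mathfrak m}q_{ij}\phi_{\gamma_j}(a)=0,\quad i\in\mathfrak m. \] *)

theory Defs
  imports "HOL-Analysis.Analysis" "HOL-Library.Landau_Symbols"
begin

text \<open>Functions on the star graph: an edge index (edges 1..n) and a position s >= 0 on the edge.\<close>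

definition L2_on :: "real set \<Rightarrow> (real \<Rightarrow> 'a::{banach,second_countable_topology}) \<Rightarrow> bool" where
  "L2_on S f \<longleftrightarrow> f \<in> borel_measurable (lebesgue_on S) \<and>
     integrable (lebesgue_on S) (\<lambda>x. (norm (f x))^2)"

definition L2_graph :: "nat \<Rightarrow> (nat \<Rightarrow> real \<Rightarrow> complex) \<Rightarrow> bool" where
  "L2_graph n f \<longleftrightarrow> (\<forall>k\<in>{1..n}. L2_on {0..} (f k))"

definition L2norm_graph :: "nat \<Rightarrow> (nat \<Rightarrow> real \<Rightarrow> complex) \<Rightarrow> real" where
  "L2norm_graph n f = sqrt (\<Sum>k\<in>{1..n}. integral\<^sup>L (lebesgue_on {0..}) (\<lambda>x. (norm (f k x))^2))"

text \<open>H^2 on the interval S = [0,b] (or [0,oo)): f, its derivative f' and second derivative f''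
  (f' and f' absolutely continuous, given by integrals), all square integrable on S.\<close>
definition H2_on :: "real set \<Rightarrow> (real \<Rightarrow> 'a::euclidean_space) \<Rightarrow> (real \<Rightarrow> 'a) \<Rightarrow> (real \<Rightarrow> 'a) \<Rightarrow> bool" where
  "H2_on S f f' f'' \<longleftrightarrow>
     (\<forall>x\<in>S. f x = f 0 + integral {0..x} f') \<and>
     (\<forall>x\<in>S. f' x = f' 0 + integral {0..x} f'') \<and>
     L2_on S f \<and> L2_on S f' \<and> L2_on S f''"

definition solves_R :: "nat \<Rightarrow> (nat \<Rightarrow> real) \<Rightarrow> (nat \<Rightarrow> real \<Rightarrow> real) \<Rightarrow> (nat \<Rightarrow> real \<Rightarrow> real) \<Rightarrow> bool" where
  "solves_R n a Q \<psi> \<longleftrightarrow> (\<exists>\<psi>' \<psi>''.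
     (\<forall>k\<in>{1..n}. H2_on {0..a k} (\<psi> k) (\<psi>' k) (\<psi>'' k)) \<and>
     (\<forall>k\<in>{1..n}. AE x in lebesgue_on {0..a k}. - \<psi>'' k x + Q k x * \<psi> k x = 0) \<and>
     (\<forall>k\<in>{1..n}. \<psi> k 0 = \<psi> 1 0) \<and> (\<Sum>k\<in>{1..n}. \<psi>' k 0) = 0 \<and>
     (\<forall>k\<in>{1..n}. \<psi>' k (a k) = 0))"

definition solves_Heps :: "nat \<Rightarrow> (nat \<Rightarrow> real \<Rightarrow> real) \<Rightarrow> (real \<Rightarrow> real) \<Rightarrow> real \<Rightarrow> complex
     \<Rightarrow> (nat \<Rightarrow> real \<Rightarrow> complex) \<Rightarrow> (nat \<Rightarrow> real \<Rightarrow> complex) \<Rightarrow> bool" where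
  "solves_Heps n Q lamf \<epsilon> \<zeta> f u \<longleftrightarrow> (\<exists>u' u''.
     (\<forall>k\<in>{1..n}. H2_on {0..} (u k) (u' k) (u'' k)) \<and>
     (\<forall>k\<in>{1..n}. u k 0 = u 1 0) \<and> (\<Sum>k\<in>{1..n}. u' k 0) = 0 \<and>
     (\<forall>k\<in>{1..n}. AE x in lebesgue_on {0..}.
        - u'' k x + complex_of_real (lamf \<epsilon> / \<epsilon>^2 * Q k (x / \<epsilon>)) * u k x - \<zeta> * u k x = f k x))"

definition solves_H :: "nat \<Rightarrow> nat \<Rightarrow> (nat \<Rightarrow> real) \<Rightarrow> (nat \<Rightarrow> real \<Rightarrow> real) \<Rightarrow> (nat \<Rightarrow> nat \<Rightarrow> real \<Rightarrow> real)
     \<Rightarrow> real \<Rightarrow> complex \<Rightarrow> (nat \<Rightarrow> real \<Rightarrow> complex) \<Rightarrow> (nat \<Rightarrow> real \<Rightarrow> complex) \<Rightarrow> bool" where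
  "solves_H n m a Q \<psi> lam \<zeta> f u \<longleftrightarrow>
     (let \<theta> = (\<lambda>i j. \<psi> i j (a j));
          q = (\<lambda>i j. \<Sum>k\<in>{1..n}. integral {0..a k} (\<lambda>x. Q k x * \<psi> i k x * \<psi> j k x))
      in (\<exists>u' u''.
     (\<forall>k\<in>{1..n}. H2_on {0..} (u k) (u' k) (u'' k)) \<and>
     (\<forall>j\<in>{m+1..n}. u j 0 - (\<Sum>i\<in>{1..m}. complex_of_real (\<theta> i j) * u i 0) = 0) \<and>
     (\<forall>i\<in>{1..m}. u' i 0 + (\<Sum>j\<in>{m+1..n}. complex_of_real (\<theta> i j) * u' j 0)
                   - complex_of_real lam * (\<Sum>j\<in>{1..m}. complex_of_real (q i j) * u j 0) = 0) \<and>
     (\<forall>k\<in>{1..n}. AE x in lebesgue_on {0..}. - u'' k x - \<zeta> * u k x = f k x)))"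

end

theory Submission
  imports Defs
begin

text \<open>Choose \<open>\<kappa>\<close> with \<open>\<kappa>\<^sup>2 = - \<zeta>\<close> and \<open>Re \<kappa> > 0\<close>. Beyond the support of the potential a square integrable solution
  satisfies \<open>u' + \<kappa> u = g\<close>, where \<open>g\<close> depends only on \<open>f\<close>, so \<open>u\<close> is determined by its values
  \<open>X\<^sub>k = u\<^sub>k(\<epsilon> a\<^sub>k)\<close>. In the variable \<open>x / \<epsilon>\<close> the equation on the small star is an \<open>O(\<epsilon>)\<close> perturbation of
  the zero-energy Neumann problem. Hence \<open>u\<close> is \<open>O(\<epsilon>)\<close>-close to the zero mode \<open>\<Sum>\<^sub>i X\<^sub>i \<psi>\<^sub>i\<close>, and testing with
  \<open>\<psi>\<^sub>i\<close> shows that \<open>X\<^sub>k\<close> and \<open>u\<^sub>k'(\<epsilon> a\<^sub>k) = g\<^sub>k - \<kappa> X\<^sub>k\<close> satisfy the limit vertex conditions up to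
  \<open>O(\<surd>\<epsilon>)\<close>; the square root comes from \<open>\<integral>|f| \<le> \<surd>(\<epsilon> a) \<parallel>f\<parallel>\<close> on intervals of length \<open>\<epsilon> a\<close>. These conditions form
  a linear system for \<open>X\<close> whose quadratic form is \<open>\<kappa> |X|\<^sup>2\<close> plus a real number, and \<open>Im \<kappa> \<noteq> 0\<close>, so \<open>X\<close> is
  \<open>O(\<surd>\<epsilon>)\<close>-close to the corresponding values of the limit solution. The difference of the two solutions decays
  exponentially outside the small star, and inside both are bounded. For \<open>\<epsilon>\<close> away from \<open>0\<close> the self-adjoint
  bound \<open>1 / |Im \<zeta>|\<close> suffices. Existence follows from uniqueness by linear algebra on the Cauchy data at
  the vertex.\<close>

section \<open>Finite linear systems\<close>

text \<open>Nothing bounds the end point values \<open>X\<close> by \<open>f\<close> beforehand, so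
  each estimate on the small star carries two sizes: \<open>N\<close> for the datum and
  \<open>S\<close> for the sum of the |X_k|. Stability of the Neumann problem bounds the rescaled
  solution by \<open>N + S\<close> plus a small multiple of its own maximum, which is absorbed for
  small \<epsilon>. After rescaling the end point derivatives are \<open>\<epsilon> * p k\<close>,
  so the tested identity contains the vertex condition at order \<epsilon> and must be known beyond
  that order. The correction l - 1 = \<epsilon> lam + O(\<epsilon>^2) of the coupling, acting on the
  zero mode, has exactly this order and produces the matrix \<open>q\<close>; the datum
  \<open>f\<close> contributes \<epsilon>^(3/2). Coercivity, applied to \<open>X\<close> minus the
  limit values, has \<open>S\<close> on its right side only with the factor \<epsilon>, and so
  finally bounds \<open>S\<close> by \<open>N\<close>. The constants must be independent of
  \<epsilon> and \<open>f\<close>. Hence the Fredholm alternative is needed as an inequality, and it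
  is extracted from an explicit left inverse of a finite matrix.\<close>

lemma injective_system_left_inverse:
  fixes A :: "'r \<Rightarrow> 'c \<Rightarrow> 'f::field"
  assumes "finite C" "finite R"
    and "\<And>z. (\<forall>r\<in>R. (\<Sum>c\<in>C. A r c * z c) = 0) \<Longrightarrow> \<forall>c\<in>C. z c = 0"
  shows "\<exists>B. \<forall>z. \<forall>c\<in>C. z c = (\<Sum>r\<in>R. B c r * (\<Sum>d\<in>C. A r d * z d))"
  using assms(1,3)
proof (induction C rule: finite_induct)
  case empty
  then show ?case by auto
next
  case (insert c0 C)
  have inj: "\<forall>c\<in>C. z c = 0" if z: "\<forall>r\<in>R. (\<Sum>c\<in>C. A r c * z c) = 0" for z
  proof -
    have "(\<Sum>c\<in>insert c0 C. A r c * (z(c0 := 0)) c) = (\<Sum>c\<in>C. A r c * z c)" for r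
      using insert.hyps by (auto intro!: sum.cong)
    with z have "\<forall>c\<in>insert c0 C. (z(c0 := 0)) c = 0"
      by (intro insert.prems) auto
    then show ?thesis using insert.hyps(2) by (auto split: if_splits)
  qed
  have "\<exists>B. \<forall>z. \<forall>c\<in>C. z c = (\<Sum>r\<in>R. B c r * (\<Sum>d\<in>C. A r d * z d))"
    by (rule insert.IH) (rule inj)
  then obtain B where B0: "\<forall>z. \<forall>c\<in>C. z c = (\<Sum>r\<in>R. B c r * (\<Sum>d\<in>C. A r d * z d))" ..
  have B: "z c = (\<Sum>r\<in>R. B c r * (\<Sum>d\<in>C. A r d * z d))" if "c \<in> C" for z c
    by (rule B0[THEN spec, of z, THEN bspec, OF that])
  \<comment> \<open>\<open>w\<close> is the candidate for the coordinates of column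
    \<open>c0\<close> in the old columns, read off by the old left inverse; \<open>\<rho>\<close> is
    the part of column \<open>c0\<close> outside their span. If \<open>\<rho>\<close> vanished,
    \<open>(1, - w)\<close> would be a kernel vector.\<close>
  define w where "w d = (\<Sum>r\<in>R. B d r * A r c0)" for d
  define \<rho> where "\<rho> r = A r c0 - (\<Sum>d\<in>C. A r d * w d)" for r
  have "\<exists>r0\<in>R. \<rho> r0 \<noteq> 0"
  proof (rule ccontr)
    assume "\<not> ?thesis"
    then have 0: "\<rho> r = 0" if "r \<in> R" for r using that by auto
    let ?z = "\<lambda>c. if c = c0 then 1 else - w c"
    have "(\<Sum>c\<in>insert c0 C. A r c * ?z c) = \<rho> r" for r
    proof -
      have "(\<Sum>c\<in>C. A r c * ?z c) = (\<Sum>c\<in>C. - (A r c * w c))"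
        using insert.hyps by (intro sum.cong) auto
      then show ?thesis using insert.hyps by (simp add: \<rho>_def sum_negf)
    qed
    with 0 have "\<forall>c\<in>insert c0 C. ?z c = 0" by (intro insert.prems) auto
    then show False by auto
  qed
  then obtain r0 where r0: "r0 \<in> R" "\<rho> r0 \<noteq> 0" by blast
  \<comment> \<open>This row functional annihilates every old column and takes the value 1 on column
    \<open>c0\<close>. It serves as the new row of the left inverse, and the old rows are corrected
    by multiples of it.\<close>
  define \<phi> where "\<phi> r = ((if r = r0 then 1 else 0) - (\<Sum>d\<in>C. A r0 d * B d r)) / \<rho> r0" for r
  define B' where "B' c r = (if c = c0 then \<phi> r else B c r - w c * \<phi> r)" for c r
  show ?case
  proof (intro exI allI ballI)
    fix z :: "'c \<Rightarrow> 'f" and c assume c: "c \<in> insert c0 C"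
    define S where "S r = (\<Sum>d\<in>C. A r d * z d)" for r
    have full: "(\<Sum>d\<in>insert c0 C. A r d * z d) = A r c0 * z c0 + S r" for r
      using insert.hyps by (simp add: S_def)
    have BA: "(\<Sum>r\<in>R. B d r * (A r c0 * z c0 + S r)) = w d * z c0 + z d" if "d \<in> C" for d
    proof -
      have "(\<Sum>r\<in>R. B d r * S r) = z d" unfolding S_def by (rule B[OF that, symmetric])
      then show ?thesis
        by (simp add: w_def distrib_left sum.distrib sum_distrib_right mult.assoc)
    qed
    have "(\<Sum>r\<in>R. (\<Sum>d\<in>C. A r0 d * B d r) * (A r c0 * z c0 + S r))
        = (\<Sum>d\<in>C. A r0 d * (\<Sum>r\<in>R. B d r * (A r c0 * z c0 + S r)))"
      by (simp add: sum_distrib_right sum_distrib_left mult.assoc) (rule sum.swap)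
    also have "\<dots> = (\<Sum>d\<in>C. A r0 d * w d * z c0 + A r0 d * z d)"
      using BA by (intro sum.cong) (auto simp: algebra_simps)
    also have "\<dots> = (\<Sum>d\<in>C. A r0 d * w d) * z c0 + S r0"
      by (simp add: sum.distrib S_def sum_distrib_right)
    finally have e: "(\<Sum>r\<in>R. (\<Sum>d\<in>C. A r0 d * B d r) * (A r c0 * z c0 + S r))
       = (\<Sum>d\<in>C. A r0 d * w d) * z c0 + S r0" .
    have d: "(\<Sum>r\<in>R. (if r = r0 then 1 else 0) * (A r c0 * z c0 + S r)) = A r0 c0 * z c0 + S r0"
      using r0 assms(2) by (simp add: if_distrib[where f="\<lambda>x. x * _"] sum.delta cong: if_cong)
    have "(\<Sum>r\<in>R. \<phi> r * (A r c0 * z c0 + S r)) =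
       ((\<Sum>r\<in>R. (if r = r0 then 1 else 0) * (A r c0 * z c0 + S r))
        - (\<Sum>r\<in>R. (\<Sum>d\<in>C. A r0 d * B d r) * (A r c0 * z c0 + S r))) / \<rho> r0"
      unfolding \<phi>_def
      by (subst sum_subtractf[symmetric], subst sum_divide_distrib) (simp add: left_diff_distrib)
    also have "\<dots> = \<rho> r0 * z c0 / \<rho> r0"
      unfolding d e \<rho>_def by (simp add: algebra_simps)
    finally have phi: "(\<Sum>r\<in>R. \<phi> r * (A r c0 * z c0 + S r)) = z c0" using r0 by simp
    show "z c = (\<Sum>r\<in>R. B' c r * (\<Sum>d\<in>insert c0 C. A r d * z d))"
    proof (cases "c = c0")
      case True
      then show ?thesis unfolding full B'_def using phi by simp
    next
      case False
      with c have "c \<in> C" by simp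
      have "(\<Sum>r\<in>R. (B c r - w c * \<phi> r) * (A r c0 * z c0 + S r)) =
        (\<Sum>r\<in>R. B c r * (A r c0 * z c0 + S r)) - w c * (\<Sum>r\<in>R. \<phi> r * (A r c0 * z c0 + S r))"
        by (simp add: sum_distrib_left sum_subtractf left_diff_distrib mult.assoc)
      then show ?thesis unfolding full B'_def using phi BA[OF \<open>c \<in> C\<close>] False by simp
    qed
  qed
qed

text \<open>Gaussian elimination: a pivot \<open>A r0 c0\<close> removes one row and one column, and
  the Schur complement \<open>A'\<close> inherits injectivity. This is the device that turns
  uniqueness for the resolvent equations into existence.\<close>

lemma injective_square_system_solvable:
  fixes A :: "'r \<Rightarrow> 'c \<Rightarrow> 'f::field"
  assumes "finite C" "finite R" "card R = card C"
    and "\<And>z. (\<forall>r\<in>R. (\<Sum>c\<in>C. A r c * z c) = 0) \<Longrightarrow> \<forall>c\<in>C. z c = 0"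
  shows "\<exists>z. \<forall>r\<in>R. (\<Sum>c\<in>C. A r c * z c) = b r"
  using assms
proof (induction C arbitrary: R A b rule: finite_induct)
  case empty
  then show ?case by auto
next
  case (insert c0 C)
  have "\<exists>r0\<in>R. A r0 c0 \<noteq> 0"
  proof (rule ccontr)
    assume "\<not> ?thesis"
    then have 0: "A r c0 = 0" if "r \<in> R" for r using that by auto
    have "(\<Sum>c\<in>insert c0 C. A r c * (if c = c0 then 1 else 0)) = A r c0" for r
      using insert.hyps by (simp add: if_distrib[where f="\<lambda>x. _ * x"] sum.delta cong: if_cong)
    then have "\<forall>c\<in>insert c0 C. (if c = c0 then 1 else 0 :: 'f) = 0"
      using 0 by (intro insert.prems) auto
    then show False by auto
  qed
  then obtain r0 where r0: "r0 \<in> R" "A r0 c0 \<noteq> 0" by blast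
  define A' where "A' r c = A r c - A r c0 * A r0 c / A r0 c0" for r c
  \<comment> \<open>Back substitution: the entry at \<open>c0\<close> is chosen so that row
    \<open>r0\<close> takes the value \<open>\<beta>\<close>, and the other rows then see only the
    reduced matrix \<open>A'\<close> and a known shift.\<close>
  have extend: "(\<Sum>c\<in>insert c0 C. A r c * (z(c0 := (\<beta> - (\<Sum>c\<in>C. A r0 c * z c)) / A r0 c0)) c)
      = (\<Sum>c\<in>C. A' r c * z c) + A r c0 * \<beta> / A r0 c0" for z \<beta> r
  proof -
    have "(\<Sum>c\<in>C. A r c * (z(c0 := (\<beta> - (\<Sum>c\<in>C. A r0 c * z c)) / A r0 c0)) c) = (\<Sum>c\<in>C. A r c * z c)"
      using insert.hyps by (intro sum.cong) auto
    moreover have "(\<Sum>c\<in>C. A' r c * z c) = (\<Sum>c\<in>C. A r c * z c) - A r c0 / A r0 c0 * (\<Sum>c\<in>C. A r0 c * z c)"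
      unfolding A'_def by (simp add: left_diff_distrib sum_subtractf sum_distrib_left mult.assoc)
    moreover have "A r c0 * ((\<beta> - T) / A r0 c0) = A r c0 * \<beta> / A r0 c0 - A r c0 / A r0 c0 * T" for T
      by (simp add: right_diff_distrib diff_divide_distrib)
    ultimately show ?thesis using insert.hyps by simp
  qed
  have row0: "(\<Sum>c\<in>C. A' r0 c * z c) = 0" for z
    using r0 by (simp add: A'_def)
  have cardR: "card (R - {r0}) = card C"
    using insert r0 by (simp add: card_Diff_singleton)
  have inj: "\<forall>c\<in>C. z c = 0" if z: "\<forall>r\<in>R - {r0}. (\<Sum>c\<in>C. A' r c * z c) = 0" for z
  proof -
    let ?z = "z(c0 := (0 - (\<Sum>c\<in>C. A r0 c * z c)) / A r0 c0)"
    have "(\<Sum>c\<in>insert c0 C. A r c * ?z c) = 0" if "r \<in> R" for r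
    proof (cases "r = r0")
      case True
      then show ?thesis unfolding extend using row0 by simp
    next
      case False
      then show ?thesis unfolding extend using bspec[OF z, of r] that by simp
    qed
    then have "\<forall>c\<in>insert c0 C. ?z c = 0" by (intro insert.prems) auto
    then show ?thesis using insert.hyps(2) by (auto split: if_splits)
  qed
  have fin: "finite (R - {r0})" using insert.prems(1) by simp
  have "\<exists>z. \<forall>r\<in>R - {r0}. (\<Sum>c\<in>C. A' r c * z c) = b r - A r c0 * b r0 / A r0 c0"
    by (rule insert.IH[OF fin cardR]) (rule inj)
  then obtain z where z: "\<forall>r\<in>R - {r0}. (\<Sum>c\<in>C. A' r c * z c) = b r - A r c0 * b r0 / A r0 c0" ..
  show ?case
  proof (intro exI ballI)
    fix r assume "r \<in> R"
    then show "(\<Sum>c\<in>insert c0 C. A r c * (z(c0 := (b r0 - (\<Sum>c\<in>C. A r0 c * z c)) / A r0 c0)) c) = b r"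
    proof (cases "r = r0")
      case True
      then show ?thesis unfolding extend using row0 r0(2) by simp
    next
      case False
      then show ?thesis unfolding extend using bspec[OF z, of r] \<open>r \<in> R\<close> by simp
    qed
  qed
qed

section \<open>Absolutely continuous functions on an interval\<close>

text \<open>Absolute continuity of \<open>F\<close> on \<open>{0..b}\<close> with density
  \<open>f\<close>, stated through integrals because derivatives exist only almost everywhere. For
  negative \<open>b\<close> the condition is vacuous, so quantifying over all real \<open>b\<close>
  expresses the same property on the half-line.\<close>

definition primitive :: "real \<Rightarrow> (real \<Rightarrow> 'a::euclidean_space) \<Rightarrow> (real \<Rightarrow> 'a) \<Rightarrow> bool" where
  "primitive b F f \<longleftrightarrow> f absolutely_integrable_on {0..b} \<and> (\<forall>x\<in>{0..b}. F x = F 0 + integral {0..x} f)"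

lemma primitive_integrable: "primitive b F f \<Longrightarrow> f absolutely_integrable_on {0..b}"
  by (simp add: primitive_def)

lemma primitive_eq: "primitive b F f \<Longrightarrow> x \<in> {0..b} \<Longrightarrow> F x = F 0 + integral {0..x} f"
  unfolding primitive_def by blast

lemma absolutely_integrable_on_Icc_imp_integrable:
  fixes f :: "real \<Rightarrow> 'a::euclidean_space"
  shows "f absolutely_integrable_on {a..b} \<Longrightarrow> f integrable_on {a..b}"
  by (simp add: absolutely_integrable_on_def)

lemma absolutely_integrable_norm_comp:
  fixes f :: "'b::euclidean_space \<Rightarrow> 'a::euclidean_space"
  shows "f absolutely_integrable_on S \<Longrightarrow> (\<lambda>x. norm (f x)) absolutely_integrable_on S"
  by (drule absolutely_integrable_norm) (simp add: o_def)

lemma primitive_increment: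
  assumes "primitive b F f" "0 \<le> x" "x \<le> y" "y \<le> b"
  shows "F y = F x + integral {x..y} f"
proof -
  have "f integrable_on {0..y}"
    using assms by (intro absolutely_integrable_on_Icc_imp_integrable absolutely_integrable_on_subinterval[OF primitive_integrable]) auto
  then have "integral {0..x} f + integral {x..y} f = integral {0..y} f"
    using assms by (intro Henstock_Kurzweil_Integration.integral_combine) auto
  then show ?thesis using primitive_eq[OF assms(1), of x] primitive_eq[OF assms(1), of y] assms(2-4) by auto
qed

lemma primitive_continuous:
  assumes "primitive b F f"
  shows "continuous_on {0..b} F"
proof -
  have "continuous_on {0..b} (\<lambda>x. F 0 + integral {0..x} f)"
    using assms by (intro continuous_intros indefinite_integral_continuous_1)
      (metis primitive_integrable absolutely_integrable_on_Icc_imp_integrable)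
  then show ?thesis
    by (rule continuous_on_eq) (rule primitive_eq[OF assms, symmetric])
qed


lemma primitive_cong:
  assumes "primitive b F f" "negligible N" "0 \<le> b"
    and "\<And>x. x \<in> {0..b} \<Longrightarrow> F x = G x" "\<And>x. x \<in> {0..b} - N \<Longrightarrow> g x = f x"
  shows "primitive b G g"
  unfolding primitive_def
proof (intro conjI ballI)
  show "g absolutely_integrable_on {0..b}"
    using absolutely_integrable_spike[OF primitive_integrable[OF assms(1)] assms(2,5)] .
  fix x assume x: "x \<in> {0..b}"
  have "integral {0..x} g = integral {0..x} f"
    using x assms(5) by (intro integral_spike[OF assms(2)]) (metis (no_types, lifting) Diff_iff atLeastAtMost_iff order_trans)
  then show "G x = G 0 + integral {0..x} g"
    using x assms(3) assms(4)[of 0] assms(4)[of x] primitive_eq[OF assms(1) x] by simp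
qed

lemma primitive_const: "primitive b (\<lambda>_. c) (\<lambda>_. 0)"
  by (simp add: primitive_def)

lemma primitive_add:
  assumes "primitive b F f" "primitive b G g"
  shows "primitive b (\<lambda>x. F x + G x) (\<lambda>x. f x + g x)"
  unfolding primitive_def
proof (intro conjI ballI)
  show "(\<lambda>x. f x + g x) absolutely_integrable_on {0..b}"
    using assms by (intro set_integral_add primitive_integrable)
  fix x assume x: "x \<in> {0..b}"
  have "integral {0..x} (\<lambda>x. f x + g x) = integral {0..x} f + integral {0..x} g"
    using assms x by (intro Henstock_Kurzweil_Integration.integral_add
      absolutely_integrable_on_Icc_imp_integrable absolutely_integrable_on_subinterval[OF primitive_integrable]) auto
  then show "F x + G x = F 0 + G 0 + integral {0..x} (\<lambda>x. f x + g x)"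
    using primitive_eq[OF assms(1) x] primitive_eq[OF assms(2) x] by simp
qed

lemma primitive_linear:
  assumes "primitive b F f" "bounded_linear L"
  shows "primitive b (\<lambda>x. L (F x)) (\<lambda>x. L (f x))"
  unfolding primitive_def
proof (intro conjI ballI)
  show "(\<lambda>x. L (f x)) absolutely_integrable_on {0..b}"
    using absolutely_integrable_linear[OF primitive_integrable[OF assms(1)] assms(2)] by (simp add: o_def)
  fix x assume x: "x \<in> {0..b}"
  have "f integrable_on {0..x}" using assms x by (intro 
      absolutely_integrable_on_Icc_imp_integrable absolutely_integrable_on_subinterval[OF primitive_integrable]) auto
  then have "integral {0..x} (\<lambda>x. L (f x)) = L (integral {0..x} f)"
    using integral_linear[OF _ assms(2)] by (simp add: o_def)
  then show "L (F x) = L (F 0) + integral {0..x} (\<lambda>x. L (f x))"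
    by (simp add: primitive_eq[OF assms(1) x] linear_add[OF bounded_linear.linear[OF assms(2)]])
qed

lemma primitive_uminus:
  "primitive b F f \<Longrightarrow> primitive b (\<lambda>x. - F x) (\<lambda>x. - f x)"
  using bounded_linear_minus[OF bounded_linear_ident] by (rule primitive_linear[rotated])

lemma primitive_diff:
  "primitive b F f \<Longrightarrow> primitive b G g \<Longrightarrow> primitive b (\<lambda>x. F x - G x) (\<lambda>x. f x - g x)"
  using primitive_add[OF _ primitive_uminus, of b F f G g] by simp

lemma primitive_cmult:
  fixes F :: "real \<Rightarrow> 'a::{euclidean_space, real_normed_field}"
  shows "primitive b F f \<Longrightarrow> primitive b (\<lambda>x. c * F x) (\<lambda>x. c * f x)"
  using bounded_linear_mult_right by (rule primitive_linear[rotated])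

lemma primitive_of_real:
  assumes "primitive b F f"
  shows "primitive b (\<lambda>x. complex_of_real (F x)) (\<lambda>x. complex_of_real (f x))"
  using bounded_linear_of_real by (rule primitive_linear[OF assms])

lemma primitive_cmult_right:
  fixes F :: "real \<Rightarrow> 'a::{euclidean_space, real_normed_field}"
  shows "primitive b F f \<Longrightarrow> primitive b (\<lambda>x. F x * c) (\<lambda>x. f x * c)"
  using primitive_cmult[of b F f c] by (simp add: mult.commute)

lemma primitive_sum:
  assumes "finite I" "\<And>i. i \<in> I \<Longrightarrow> primitive b (F i) (f i)"
  shows "primitive b (\<lambda>x. \<Sum>i\<in>I. F i x) (\<lambda>x. \<Sum>i\<in>I. f i x)"
  using assms by (induction I rule: finite_induct) (auto intro: primitive_const primitive_add)

lemma primitive_cong_deriv: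
  assumes "primitive b F f" "\<And>x. f x = g x"
  shows "primitive b F g"
  using assms by (metis ext)

lemma primitive_scaled_argument:
  assumes "primitive (e * b) F f" "0 < e"
  shows "primitive b (\<lambda>x. F (e * x)) (\<lambda>x. e *\<^sub>R f (e * x))"
proof -
  have img: "(\<lambda>x. x / e) ` {0..e * y} = {0..y}" for y
  proof -
    have "x \<in> (\<lambda>x. x / e) ` {0..e * y}" if "x \<in> {0..y}" for x
      using that assms(2) by (intro image_eqI[of _ _ "e * x"]) auto
    then show ?thesis using assms(2) by (auto simp: field_simps)
  qed
  have int: "h integrable_on {0..e * y} \<Longrightarrow> (\<lambda>x. h (e * x)) integrable_on {0..y}" for h :: "real \<Rightarrow> 'c::euclidean_space" and y
    using integrable_stretch_real_iff[of e h 0 "e * y"] assms(2) img by simp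
  have stretch: "integral {0..y} (\<lambda>x. h (e * x)) = (1 / e) *\<^sub>R integral {0..e * y} h" for h :: "real \<Rightarrow> 'a" and y
    using integral_stretch_real[of e 0 "e * y" h] assms(2) img by simp
  have "(\<lambda>x. f (e * x)) absolutely_integrable_on {0..b}"
    using primitive_integrable[OF assms(1)] int[of f b] int[of "\<lambda>x. norm (f x)" b]
    by (simp add: absolutely_integrable_on_def)
  then have 1: "(\<lambda>x. e *\<^sub>R f (e * x)) absolutely_integrable_on {0..b}"
    by (rule absolutely_integrable_scaleR_left)
  have "F (e * x) = F 0 + integral {0..x} (\<lambda>x. e *\<^sub>R f (e * x))" if "x \<in> {0..b}" for x
  proof -
    have "e * x \<in> {0..e * b}" using that assms(2) by auto
    from primitive_eq[OF assms(1) this] show ?thesis using stretch[of x f] assms(2) by simp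
  qed
  with 1 show ?thesis by (simp add: primitive_def)
qed

lemma primitive_C1:
  fixes F :: "real \<Rightarrow> 'a::euclidean_space"
  assumes "\<And>x. x \<in> {0..b} \<Longrightarrow> (F has_vector_derivative f x) (at x within {0..b})" "continuous_on {0..b} f"
  shows "primitive b F f"
  unfolding primitive_def
proof (intro conjI ballI)
  show "f absolutely_integrable_on {0..b}"
    using assms(2) by (rule absolutely_integrable_continuous_real)
  fix x assume x: "x \<in> {0..b}"
  have "(f has_integral F x - F 0) {0..x}"
    using x by (intro fundamental_theorem_of_calculus) (auto intro!: has_vector_derivative_within_subset[OF assms(1)])
  then show "F x = F 0 + integral {0..x} f" by (simp add: integral_unique)
qed

text \<open>Telescoping over a partition into equal steps shorter than \<open>\<delta>\<close>. It
  lets the product rule below use the modulus of continuity on short intervals only.\<close>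

lemma increments_dominated_locally_imp_globally:
  fixes \<Phi> :: "real \<Rightarrow> 'a::real_normed_vector" and N :: "real \<Rightarrow> real"
  assumes "0 \<le> b" "0 < \<delta>"
    and loc: "\<And>x y. \<lbrakk>0 \<le> x; x \<le> y; y \<le> b; y - x < \<delta>\<rbrakk> \<Longrightarrow> norm (\<Phi> y - \<Phi> x) \<le> N y - N x"
  shows "norm (\<Phi> b - \<Phi> 0) \<le> N b - N 0"
proof -
  obtain n :: nat where n: "b / \<delta> < real n" using reals_Archimedean2 by blast
  then have n0: "n > 0" using assms(1,2) by (metis divide_nonneg_pos gr0I not_less of_nat_0)
  have step: "b / n < \<delta>" using n n0 assms(2) by (simp add: field_simps)
  define p where "p k = real k * b / n" for k
  have "norm (\<Phi> (p k) - \<Phi> 0) \<le> N (p k) - N 0" if "k \<le> n" for k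
    using that
  proof (induction k)
    case 0 then show ?case by (simp add: p_def)
  next
    case (Suc k)
    have d: "p (Suc k) - p k = b / n" by (simp add: p_def diff_divide_distrib[symmetric] algebra_simps)
    have "real (Suc k) / n \<le> 1" using Suc.prems n0 by simp
    then have "p (Suc k) \<le> b" using mult_right_mono[of "real (Suc k) / n" 1 b] assms(1) by (simp add: p_def)
    moreover have "0 \<le> b / n" "0 \<le> p k" using assms(1) by (auto simp: p_def)
    ultimately have "norm (\<Phi> (p (Suc k)) - \<Phi> (p k)) \<le> N (p (Suc k)) - N (p k)"
      using d step by (intro loc) auto
    moreover have "\<Phi> (p (Suc k)) - \<Phi> 0 = (\<Phi> (p (Suc k)) - \<Phi> (p k)) + (\<Phi> (p k) - \<Phi> 0)" by simp
    ultimately show ?case using Suc norm_triangle_ineq[of "\<Phi> (p (Suc k)) - \<Phi> (p k)" "\<Phi> (p k) - \<Phi> 0"] by simp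
  qed
  from this[of n] n0 show ?thesis by (simp add: p_def)
qed

lemma absolutely_integrable_mult_bounded:
  fixes f g :: "real \<Rightarrow> 'a::{euclidean_space, real_normed_field}"
  assumes "f absolutely_integrable_on S" "g \<in> borel_measurable (lebesgue_on S)" "S \<in> sets lebesgue"
    and "\<And>x. x \<in> S \<Longrightarrow> norm (g x) \<le> K"
  shows "(\<lambda>x. g x * f x) absolutely_integrable_on S"
proof -
  have "bilinear ((*) :: 'a \<Rightarrow> 'a \<Rightarrow> 'a)"
    by (simp add: bilinear_conv_bounded_bilinear bounded_bilinear_mult)
  moreover have "bounded (g ` S)" using assms(4) by (auto intro!: boundedI)
  ultimately show ?thesis
    using assms(1-3) by (rule_tac absolutely_integrable_bounded_measurable_product[where h = "(*)"])
qed

lemma absolutely_integrable_mult_continuous: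
  fixes f g :: "real \<Rightarrow> 'a::{euclidean_space, real_normed_field}"
  assumes "f absolutely_integrable_on {a..b}" "continuous_on {a..b} g"
  shows "(\<lambda>x. g x * f x) absolutely_integrable_on {a..b}"
proof -
  have "compact (g ` {a..b})" using assms(2) by (intro compact_continuous_image) auto
  from compact_imp_bounded[OF this, unfolded bounded_iff]
  obtain K where K: "\<forall>y\<in>g ` {a..b}. norm y \<le> K" ..
  show ?thesis
  proof (rule absolutely_integrable_mult_bounded[where K = K])
    show "g \<in> borel_measurable (lebesgue_on {a..b})"
      using assms(2) by (intro continuous_imp_measurable_on_sets_lebesgue) auto
    show "norm (g x) \<le> K" if "x \<in> {a..b}" for x using K that by blast
  qed (use assms in auto)
qed

text \<open>Both factors are only differentiable almost everywhere, so the product rule is obtained from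
  increments: on short intervals \<open>FG - \<integral>(fG + Fg)\<close> moves by at most the oscillation of the factors
  times \<open>\<integral>(|f| + |g|)\<close>, hence it is constant.\<close>

lemma primitive_mult:
  fixes F G :: "real \<Rightarrow> 'a::{euclidean_space, real_normed_field}"
  assumes F: "primitive b F f" and G: "primitive b G g"
  shows "primitive b (\<lambda>x. F x * G x) (\<lambda>x. f x * G x + F x * g x)"
proof -
  let ?h = "\<lambda>x. f x * G x + F x * g x"
  note cF = primitive_continuous[OF F] and cG = primitive_continuous[OF G]
  note iF = primitive_integrable[OF F] and iG = primitive_integrable[OF G]
  have i1: "(\<lambda>x. G x * f x) absolutely_integrable_on {0..b}"
    by (rule absolutely_integrable_mult_continuous[OF iF cG])
  have i2: "(\<lambda>x. F x * g x) absolutely_integrable_on {0..b}"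
    by (rule absolutely_integrable_mult_continuous[OF iG cF])
  have h: "?h absolutely_integrable_on {0..b}"
    using set_integral_add(1)[OF i1 i2] by (simp add: mult.commute)
  define M where "M x = norm (f x) + norm (g x)" for x
  have M: "M absolutely_integrable_on {0..b}"
    unfolding M_def using iF iG by (intro set_integral_add absolutely_integrable_norm_comp)
  define \<Phi> where "\<Phi> x = F x * G x - integral {0..x} ?h" for x
  note sub = absolutely_integrable_on_subinterval
  have main: "\<Phi> c = \<Phi> 0" if c: "c \<in> {0..b}" for c
  proof -
    have "norm (\<Phi> c - \<Phi> 0) \<le> \<eta> * integral {0..c} M" if \<eta>: "\<eta> > 0" for \<eta>
    proof -
      obtain d1 where d1: "d1 > 0" "\<And>x y. x \<in> {0..b} \<Longrightarrow> y \<in> {0..b} \<Longrightarrow> dist y x < d1 \<Longrightarrow> dist (F y) (F x) < \<eta>"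
        using compact_uniformly_continuous[OF cF] \<eta> unfolding uniformly_continuous_on_def by (metis compact_Icc)
      obtain d2 where d2: "d2 > 0" "\<And>x y. x \<in> {0..b} \<Longrightarrow> y \<in> {0..b} \<Longrightarrow> dist y x < d2 \<Longrightarrow> dist (G y) (G x) < \<eta>"
        using compact_uniformly_continuous[OF cG] \<eta> unfolding uniformly_continuous_on_def by (metis compact_Icc)
      have "norm (\<Phi> c - \<Phi> 0) \<le> \<eta> * integral {0..c} M - \<eta> * integral {0..0} M"
      proof (rule increments_dominated_locally_imp_globally[where \<delta> = "min d1 d2"])
        fix x y assume xy: "0 \<le> x" "x \<le> y" "y \<le> c" "y - x < min d1 d2"
        have s: "{x..y} \<subseteq> {0..b}" "{0..y} \<subseteq> {0..b}" using xy c by auto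
        note ix = absolutely_integrable_on_Icc_imp_integrable[OF sub[OF _ s(1)]]
        note iy = absolutely_integrable_on_Icc_imp_integrable[OF sub[OF _ s(2)]]
        have hxy: "integral {0..y} ?h - integral {0..x} ?h = integral {x..y} ?h"
          using Henstock_Kurzweil_Integration.integral_combine[of 0 x y ?h] xy iy[OF h] by (simp add: algebra_simps)
        have Mxy: "integral {0..y} M - integral {0..x} M = integral {x..y} M"
          using Henstock_Kurzweil_Integration.integral_combine[of 0 x y M] xy iy[OF M] by (simp add: algebra_simps)
        have Fy: "F y = F x + integral {x..y} f" and Gy: "G y = G x + integral {x..y} g"
          using primitive_increment[OF F, of x y] primitive_increment[OF G, of x y] xy c by auto
        \<comment> \<open>With \<open>G\<close> frozen at the right end and \<open>F\<close> at the
          left end the increment of the product is linear in the increments of the factors; no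
          quadratic term appears.\<close>
        have "F y * G y - F x * G x = integral {x..y} f * G y + F x * integral {x..y} g"
          using Fy Gy by (simp add: algebra_simps)
        also have "\<dots> = integral {x..y} (\<lambda>t. f t * G y + F x * g t)"
        proof -
          have 1: "(\<lambda>t. f t * G y) integrable_on {x..y}"
            using ix[OF iF] by (rule integrable_on_mult_left)
          have 2: "(\<lambda>t. F x * g t) integrable_on {x..y}"
            using ix[OF iG] by (rule integrable_on_mult_right)
          show ?thesis using Henstock_Kurzweil_Integration.integral_add[OF 1 2] by simp
        qed
        finally have "\<Phi> y - \<Phi> x = integral {x..y} (\<lambda>t. f t * G y + F x * g t) - integral {x..y} ?h"
          unfolding \<Phi>_def using hxy by (simp add: algebra_simps)
        also have "\<dots> = integral {x..y} (\<lambda>t. (f t * G y + F x * g t) - ?h t)"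
          by (rule Henstock_Kurzweil_Integration.integral_diff[symmetric])
            (intro integrable_add integrable_on_mult_left integrable_on_mult_right ix iF iG, rule ix[OF h])
        also have "norm \<dots> \<le> integral {x..y} (\<lambda>t. \<eta> * M t)"
        proof (rule Henstock_Kurzweil_Integration.integral_norm_bound_integral)
          show "(\<lambda>t. f t * G y + F x * g t - ?h t) integrable_on {x..y}"
            by (rule integrable_diff)
              (intro integrable_add integrable_on_mult_left integrable_on_mult_right ix iF iG, rule ix[OF h])
          show "(\<lambda>t. \<eta> * M t) integrable_on {x..y}" using ix[OF M] by (rule integrable_on_mult_right)
          fix t assume t: "t \<in> {x..y}"
          have "norm (G y - G t) \<le> \<eta>" using d2(2)[of t y] t xy c by (auto simp: dist_norm intro: less_imp_le)
          moreover have "norm (F x - F t) \<le> \<eta>" using d1(2)[of t x] t xy c by (auto simp: dist_norm intro: less_imp_le)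
          moreover have "f t * G y + F x * g t - ?h t = f t * (G y - G t) + (F x - F t) * g t"
            by (simp add: algebra_simps)
          ultimately have "norm (f t * G y + F x * g t - ?h t) \<le> norm (f t) * \<eta> + \<eta> * norm (g t)"
            by (smt (verit) mult_left_mono mult_right_mono norm_ge_zero norm_mult norm_triangle_ineq)
          then show "norm (f t * G y + F x * g t - ?h t) \<le> \<eta> * M t"
            by (simp add: M_def algebra_simps)
        qed
        also have "\<dots> = \<eta> * integral {0..y} M - \<eta> * integral {0..x} M"
          using Mxy by (simp add: right_diff_distrib[symmetric])
        finally show "norm (\<Phi> y - \<Phi> x) \<le> \<eta> * integral {0..y} M - \<eta> * integral {0..x} M" .
      qed (use c d1 d2 in auto)
      then show ?thesis by simp
    qed
    note bound = this
    define I where "I = integral {0..c} M"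
    show ?thesis
    proof (rule ccontr)
      assume ne: "\<Phi> c \<noteq> \<Phi> 0"
      \<comment> \<open>This choice of \<eta> makes the right side at most half of the left side.
        The summand 1 keeps the denominator positive when the integral vanishes.\<close>
      have "norm (\<Phi> c - \<Phi> 0) \<le> norm (\<Phi> c - \<Phi> 0) / (2 * (\<bar>I\<bar> + 1)) * I"
        using ne unfolding I_def by (intro bound) (auto intro!: divide_pos_pos)
      also have "\<dots> \<le> norm (\<Phi> c - \<Phi> 0) / (2 * (\<bar>I\<bar> + 1)) * (\<bar>I\<bar> + 1)"
        by (intro mult_left_mono) auto
      also have "\<dots> = norm (\<Phi> c - \<Phi> 0) / 2" by (simp add: field_simps)
      finally show False using ne by simp
    qed
  qed
  show ?thesis
    unfolding primitive_def
  proof (intro conjI ballI h)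
    fix x assume "x \<in> {0..b}"
    from main[OF this] show "F x * G x = F 0 * G 0 + integral {0..x} ?h"
      by (simp add: \<Phi>_def algebra_simps)
  qed
qed

section \<open>Gronwall's inequality\<close>

text \<open>The integrating factor \<open>exp (- K * x)\<close> makes \<open>E\<close>
  nonincreasing: its derivative is a nonnegative multiple of
  \<open>h t - (A + K * integral {0..t} h)\<close>, which is nonpositive by hypothesis.\<close>

lemma gronwall:
  fixes h :: "real \<Rightarrow> real"
  assumes h: "continuous_on {0..b} h" and K: "0 \<le> K"
    and le: "\<And>x. x \<in> {0..b} \<Longrightarrow> h x \<le> A + K * integral {0..x} h"
    and x: "x \<in> {0..b}"
  shows "h x \<le> A * exp (K * x)"
proof -
  define E where "E x = exp (- K * x) * (A + K * integral {0..x} h)" for x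
  have dE: "(E has_real_derivative exp (- K * t) * K * (h t - (A + K * integral {0..t} h))) (at t within {0..b})"
    if "t \<in> {0..b}" for t
    unfolding E_def using integral_has_real_derivative[OF h that]
    by (auto intro!: derivative_eq_intros simp: algebra_simps)
  have "E x \<le> E 0"
  proof (rule DERIV_nonpos_imp_decreasing_open[of 0 x E])
    show "0 \<le> x" using x by auto
    show "continuous_on {0..x} E"
      using dE x by (intro DERIV_continuous_on[of _ _ "\<lambda>t. exp (- K * t) * K * (h t - (A + K * integral {0..t} h))"])
        (rule DERIV_subset[OF dE], auto)
    fix t assume t: "0 < t" "t < x"
    have "t \<in> {0..b}" using t x by auto
    from dE[OF this] have "(E has_real_derivative exp (- K * t) * K * (h t - (A + K * integral {0..t} h))) (at t)"
      using t x by (simp add: at_within_Icc_at)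
    moreover have "exp (- K * t) * K * (h t - (A + K * integral {0..t} h)) \<le> 0"
      using le[of t] t x K by (intro mult_nonneg_nonpos) auto
    ultimately show "\<exists>y. (E has_real_derivative y) (at t) \<and> y \<le> 0" by blast
  qed
  then have "A + K * integral {0..x} h \<le> A * exp (K * x)"
    by (simp add: E_def exp_minus field_simps)
  with le[OF x] show ?thesis by linarith
qed

text \<open>Gronwall for the pair \<open>(U, U')\<close>. The condition \<open>1 \<le> K\<close>
  lets the term |U'| coming from the equation for \<open>U\<close> share the constant of the term
  |U|. The forcing enters through its integral only, and this is the quantity that stays controlled
  after rescaling.\<close>

lemma second_order_gronwall:
  fixes U U' U'' :: "real \<Rightarrow> 'a::euclidean_space"
  assumes U: "primitive b U U'" and U': "primitive b U' U''"
    and R: "R integrable_on {0..b}" and Rnn: "\<And>t. t \<in> {0..b} \<Longrightarrow> 0 \<le> R t"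
    and K: "1 \<le> K"
    and bd: "\<And>t. t \<in> {0..b} - N \<Longrightarrow> norm (U'' t) \<le> K * norm (U t) + R t" and N: "negligible N"
    and x: "x \<in> {0..b}"
  shows "norm (U x) + norm (U' x) \<le> (norm (U 0) + norm (U' 0) + integral {0..b} R) * exp (K * x)"
proof (rule gronwall[of b "\<lambda>x. norm (U x) + norm (U' x)"])
  note cU = primitive_continuous[OF U] and cU' = primitive_continuous[OF U']
  show "continuous_on {0..b} (\<lambda>x. norm (U x) + norm (U' x))"
    using cU cU' by (intro continuous_intros)
  fix y assume y: "y \<in> {0..b}"
  let ?S = "{0..y}"
  have s: "?S \<subseteq> {0..b}" using y by auto
  note sub = absolutely_integrable_on_Icc_imp_integrable[OF absolutely_integrable_on_subinterval[OF _ s]]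
  have ci: "(\<lambda>t. norm (U t)) integrable_on ?S" "(\<lambda>t. norm (U' t)) integrable_on ?S"
    using continuous_on_subset[OF cU s] continuous_on_subset[OF cU' s]
    by (auto intro!: integrable_continuous_real continuous_intros)
  have Ri: "R integrable_on ?S" by (rule integrable_on_subinterval[OF R s])
  have 1: "norm (U y) \<le> norm (U 0) + integral ?S (\<lambda>t. norm (U' t))"
  proof -
    have "norm (integral ?S U') \<le> integral ?S (\<lambda>t. norm (U' t))"
      using sub[OF primitive_integrable[OF U]] ci by (intro Henstock_Kurzweil_Integration.integral_norm_bound_integral) auto
    moreover have "U y = U 0 + integral ?S U'" by (rule primitive_eq[OF U y])
    ultimately show ?thesis using norm_triangle_ineq[of "U 0" "integral ?S U'"] by simp
  qed
  have 2: "norm (U' y) \<le> norm (U' 0) + (K * integral ?S (\<lambda>t. norm (U t)) + integral ?S R)"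
  proof -
    \<comment> \<open>The bound on \<open>U''\<close> is known off the null set \<open>N\<close>
      only; setting \<open>U''\<close> to 0 there changes no integral and makes the bound valid
      everywhere.\<close>
    have eq: "integral ?S U'' = integral ?S (\<lambda>t. if t \<in> N then 0 else U'' t)"
      by (rule integral_spike[OF N]) auto
    have "(\<lambda>t. if t \<in> N then 0 else U'' t) integrable_on ?S"
      by (rule integrable_spike[OF sub[OF primitive_integrable[OF U']] N]) auto
    then have "norm (integral ?S (\<lambda>t. if t \<in> N then 0 else U'' t)) \<le> integral ?S (\<lambda>t. K * norm (U t) + R t)"
    proof (rule Henstock_Kurzweil_Integration.integral_norm_bound_integral)
      show "(\<lambda>t. K * norm (U t) + R t) integrable_on ?S"
        using ci Ri by (intro integrable_add integrable_on_mult_right)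
      fix t assume t: "t \<in> ?S"
      show "norm (if t \<in> N then 0 else U'' t) \<le> K * norm (U t) + R t"
        using bd[of t] Rnn[of t] K t s by auto
    qed
    also have "\<dots> = K * integral ?S (\<lambda>t. norm (U t)) + integral ?S R"
      using ci Ri by (simp add: Henstock_Kurzweil_Integration.integral_add integrable_on_mult_right)
    finally have "norm (integral ?S U'') \<le> K * integral ?S (\<lambda>t. norm (U t)) + integral ?S R"
      unfolding eq .
    moreover have "U' y = U' 0 + integral ?S U''" by (rule primitive_eq[OF U' y])
    ultimately show ?thesis using norm_triangle_ineq[of "U' 0" "integral ?S U''"] by simp
  qed
  have 3: "integral ?S R \<le> integral {0..b} R"
    using s Ri R Rnn by (intro integral_subset_le) auto
  have 4: "integral ?S (\<lambda>t. norm (U' t)) \<le> K * integral ?S (\<lambda>t. norm (U' t))"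
    using K Henstock_Kurzweil_Integration.integral_nonneg[OF ci(2)] mult_right_mono[of 1 K "integral ?S (\<lambda>t. norm (U' t))"] by simp
  have "integral ?S (\<lambda>t. norm (U t) + norm (U' t)) = integral ?S (\<lambda>t. norm (U t)) + integral ?S (\<lambda>t. norm (U' t))"
    using ci by (rule Henstock_Kurzweil_Integration.integral_add)
  then show "norm (U y) + norm (U' y) \<le> norm (U 0) + norm (U' 0) + integral {0..b} R
      + K * integral ?S (\<lambda>t. norm (U t) + norm (U' t))"
    using 1 2 3 4 by (simp add: distrib_left)
qed (use K x in auto)

section \<open>Square integrable functions\<close>

lemma L2_on_measurable: "L2_on S f \<Longrightarrow> f \<in> borel_measurable (lebesgue_on S)"
  by (simp add: L2_on_def)

lemma L2_on_square_integrable: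
  fixes f :: "real \<Rightarrow> 'a::euclidean_space"
  shows "L2_on S f \<Longrightarrow> S \<in> sets lebesgue \<Longrightarrow> (\<lambda>x. (norm (f x))\<^sup>2) integrable_on S"
  by (simp add: L2_on_def integrable_on_lebesgue_on)

lemma L2_on_integral:
  fixes f :: "real \<Rightarrow> 'a::euclidean_space"
  shows "L2_on S f \<Longrightarrow> S \<in> sets lebesgue \<Longrightarrow>
    integral\<^sup>L (lebesgue_on S) (\<lambda>x. (norm (f x))\<^sup>2) = integral S (\<lambda>x. (norm (f x))\<^sup>2)"
  by (simp add: L2_on_def lebesgue_integral_eq_integral)

lemma L2_onI:
  fixes f :: "real \<Rightarrow> 'a::euclidean_space"
  assumes "f \<in> borel_measurable (lebesgue_on S)" "S \<in> sets lebesgue"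
    and "g integrable_on S" "\<And>x. x \<in> S \<Longrightarrow> (norm (f x))\<^sup>2 \<le> g x"
  shows "L2_on S f"
proof -
  have "(\<lambda>x. (norm (f x))\<^sup>2) absolutely_integrable_on S"
    using assms by (intro measurable_bounded_by_integrable_imp_absolutely_integrable[where g = g]) auto
  then have "integrable (lebesgue_on S) (\<lambda>x. (norm (f x))\<^sup>2)"
    using assms(2) by (intro absolutely_integrable_imp_integrable)
  then show ?thesis using assms(1) by (simp add: L2_on_def)
qed

lemma L2_on_subset:
  fixes f :: "real \<Rightarrow> 'a::euclidean_space"
  assumes "L2_on S f" "T \<subseteq> S" "S \<in> sets lebesgue" "T \<in> sets lebesgue"
  shows "L2_on T f"
proof -
  have "(\<lambda>x. (norm (f x))\<^sup>2) absolutely_integrable_on S"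
    using L2_on_square_integrable[OF assms(1,3)] by (intro nonnegative_absolutely_integrable_1) auto
  then have "(\<lambda>x. (norm (f x))\<^sup>2) absolutely_integrable_on T"
    by (rule set_integrable_subset) (use assms in auto)
  then show ?thesis
    using assms measurable_restrict_mono[OF L2_on_measurable[OF assms(1)] assms(2)]
      absolutely_integrable_imp_integrable by (auto simp: L2_on_def)
qed

lemma L2_on_add:
  fixes f g :: "real \<Rightarrow> 'a::euclidean_space"
  assumes "L2_on S f" "L2_on S g" "S \<in> sets lebesgue"
  shows "L2_on S (\<lambda>x. f x + g x)"
proof (rule L2_onI)
  show "(\<lambda>x. f x + g x) \<in> borel_measurable (lebesgue_on S)"
    using assms(1,2) by (intro borel_measurable_add L2_on_measurable)
  show "(\<lambda>x. 2 * (norm (f x))\<^sup>2 + 2 * (norm (g x))\<^sup>2) integrable_on S"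
    using assms by (intro integrable_add integrable_on_mult_right L2_on_square_integrable)
  fix x
  have "(norm (f x + g x))\<^sup>2 \<le> (norm (f x) + norm (g x))\<^sup>2"
    by (intro power_mono norm_triangle_ineq) auto
  also have "\<dots> \<le> 2 * (norm (f x))\<^sup>2 + 2 * (norm (g x))\<^sup>2"
    using zero_le_power2[of "norm (f x) - norm (g x)"] by (simp add: power2_eq_square algebra_simps)
  finally show "(norm (f x + g x))\<^sup>2 \<le> 2 * (norm (f x))\<^sup>2 + 2 * (norm (g x))\<^sup>2" .
qed fact

lemma L2_on_mult_bounded:
  fixes f g :: "real \<Rightarrow> 'a::{euclidean_space, real_normed_field}"
  assumes "L2_on S f" "g \<in> borel_measurable (lebesgue_on S)" "S \<in> sets lebesgue"
    and "\<And>x. x \<in> S \<Longrightarrow> norm (g x) \<le> K"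
  shows "L2_on S (\<lambda>x. g x * f x)"
proof (rule L2_onI)
  show "(\<lambda>x. g x * f x) \<in> borel_measurable (lebesgue_on S)"
    using assms(2) L2_on_measurable[OF assms(1)] by (rule borel_measurable_times)
  show "(\<lambda>x. K\<^sup>2 * (norm (f x))\<^sup>2) integrable_on S"
    using assms by (intro integrable_on_mult_right L2_on_square_integrable)
  fix x assume x: "x \<in> S"
  then show "(norm (g x * f x))\<^sup>2 \<le> K\<^sup>2 * (norm (f x))\<^sup>2"
    unfolding norm_mult power_mult_distrib
    using assms(4)[OF x] by (intro mult_right_mono power_mono) auto
qed fact

lemma L2_on_cmult:
  fixes f :: "real \<Rightarrow> 'a::{euclidean_space, real_normed_field}"
  shows "L2_on S f \<Longrightarrow> S \<in> sets lebesgue \<Longrightarrow> L2_on S (\<lambda>x. c * f x)"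
  using L2_on_mult_bounded[of S f "\<lambda>_. c" "norm c"] by simp

lemma L2_on_uminus:
  fixes f :: "real \<Rightarrow> 'a::{euclidean_space, real_normed_field}"
  shows "L2_on S f \<Longrightarrow> S \<in> sets lebesgue \<Longrightarrow> L2_on S (\<lambda>x. - f x)"
  using L2_on_cmult[of S f "-1"] by simp

lemma L2_on_diff:
  fixes f g :: "real \<Rightarrow> 'a::{euclidean_space, real_normed_field}"
  shows "L2_on S f \<Longrightarrow> L2_on S g \<Longrightarrow> S \<in> sets lebesgue \<Longrightarrow> L2_on S (\<lambda>x. f x - g x)"
  using L2_on_add[of S f "\<lambda>x. - g x"] L2_on_uminus[of S g] by simp

lemma L2_on_continuous:
  fixes f :: "real \<Rightarrow> 'a::euclidean_space"
  assumes "continuous_on {a..b} f"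
  shows "L2_on {a..b} f"
proof (rule L2_onI)
  show "f \<in> borel_measurable (lebesgue_on {a..b})"
    using assms by (intro continuous_imp_measurable_on_sets_lebesgue) auto
  show "(\<lambda>x. (norm (f x))\<^sup>2) integrable_on {a..b}"
    using assms by (intro integrable_continuous_real continuous_intros)
qed auto

text \<open>From |f| \<le> 1 + |f|^2. The resulting linear growth in the length of the interval is
  harmless where it is used, because it is compared with an exponential.\<close>

lemma L2_on_locally_integrable:
  fixes f :: "real \<Rightarrow> 'a::euclidean_space"
  assumes "L2_on S f" "{a..b} \<subseteq> S" "S \<in> sets lebesgue"
  shows "f absolutely_integrable_on {a..b}"
    and "integral {a..b} (\<lambda>x. norm (f x)) \<le> measure lborel {a..b} + integral {a..b} (\<lambda>x. (norm (f x))\<^sup>2)"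
proof -
  have L: "L2_on {a..b} f" using L2_on_subset[OF assms(1,2,3)] by simp
  then have sq: "(\<lambda>x. (norm (f x))\<^sup>2) integrable_on {a..b}" by (rule L2_on_square_integrable) simp
  have i: "(\<lambda>x. 1 + (norm (f x))\<^sup>2) integrable_on {a..b}" using sq by (intro integrable_add) auto
  have le: "norm (f x) \<le> 1 + (norm (f x))\<^sup>2" for x
    using zero_le_power2[of "norm (f x) - 1"] by (simp add: power2_eq_square algebra_simps)
      (smt (verit) mult_nonneg_nonneg norm_ge_zero)
  show f: "f absolutely_integrable_on {a..b}"
    using L2_on_measurable[OF L] i le
    by (intro measurable_bounded_by_integrable_imp_absolutely_integrable[where g = "\<lambda>x. 1 + (norm (f x))\<^sup>2"]) auto
  have "integral {a..b} (\<lambda>x. norm (f x)) \<le> integral {a..b} (\<lambda>x. 1 + (norm (f x))\<^sup>2)"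
    using i le absolutely_integrable_on_Icc_imp_integrable[OF absolutely_integrable_norm_comp[OF f]]
    by (intro integral_le) auto
  also have "\<dots> = measure lborel {a..b} + integral {a..b} (\<lambda>x. (norm (f x))\<^sup>2)"
    using sq by (subst Henstock_Kurzweil_Integration.integral_add) auto
  finally show "integral {a..b} (\<lambda>x. norm (f x)) \<le> measure lborel {a..b} + integral {a..b} (\<lambda>x. (norm (f x))\<^sup>2)" .
qed

text \<open>The integral of the square of |f| - t |g| is a nonnegative quadratic polynomial in
  \<open>t\<close>; evaluating it at its minimum gives the inequality.\<close>

lemma L2_on_cauchy_schwarz:
  fixes f g :: "real \<Rightarrow> 'a::euclidean_space"
  assumes f: "L2_on S f" and g: "L2_on S g" and S: "S \<in> sets lebesgue"
  shows "(\<lambda>x. norm (f x) * norm (g x)) integrable_on S"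
    and "(integral S (\<lambda>x. norm (f x) * norm (g x)))\<^sup>2
       \<le> integral S (\<lambda>x. (norm (f x))\<^sup>2) * integral S (\<lambda>x. (norm (g x))\<^sup>2)"
proof -
  note fi = L2_on_square_integrable[OF f S] and gi = L2_on_square_integrable[OF g S]
  have "(\<lambda>x. norm (f x) * norm (g x)) absolutely_integrable_on S"
  proof (rule measurable_bounded_by_integrable_imp_absolutely_integrable[OF _ S])
    show "(\<lambda>x. norm (f x) * norm (g x)) \<in> borel_measurable (lebesgue_on S)"
      using L2_on_measurable[OF f] L2_on_measurable[OF g] by measurable
    show "(\<lambda>x. (norm (f x))\<^sup>2 + (norm (g x))\<^sup>2) integrable_on S" using fi gi by (rule integrable_add)
    show "norm (norm (f x) * norm (g x)) \<le> (norm (f x))\<^sup>2 + (norm (g x))\<^sup>2" for x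
      using zero_le_power2[of "norm (f x) - norm (g x)"] mult_nonneg_nonneg[OF norm_ge_zero norm_ge_zero, of "f x" "g x"]
      unfolding power2_diff real_norm_def abs_mult abs_norm_cancel by linarith
  qed
  then show pi: "(\<lambda>x. norm (f x) * norm (g x)) integrable_on S"
    by (simp add: absolutely_integrable_on_def)
  define A B P where "A = integral S (\<lambda>x. (norm (f x))\<^sup>2)" "B = integral S (\<lambda>x. (norm (g x))\<^sup>2)"
    "P = integral S (\<lambda>x. norm (f x) * norm (g x))"
  have B: "0 \<le> B" unfolding A_B_P_def using gi by (intro Henstock_Kurzweil_Integration.integral_nonneg) auto
  have quad: "0 \<le> A - 2 * t * P + t\<^sup>2 * B" for t
  proof -
    have "((\<lambda>x. (norm (f x))\<^sup>2 - 2 * t * (norm (f x) * norm (g x)) + t\<^sup>2 * (norm (g x))\<^sup>2)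
        has_integral A - 2 * t * P + t\<^sup>2 * B) S"
      unfolding A_B_P_def using fi gi pi
      by (intro has_integral_add has_integral_diff has_integral_mult_right integrable_integral)
    then show ?thesis
    proof (rule has_integral_nonneg)
      show "0 \<le> (norm (f x))\<^sup>2 - 2 * t * (norm (f x) * norm (g x)) + t\<^sup>2 * (norm (g x))\<^sup>2" for x
        using zero_le_power2[of "norm (f x) - t * norm (g x)"] by (simp add: power2_eq_square algebra_simps)
    qed
  qed
  show "P\<^sup>2 \<le> A * B"
  proof (cases "B = 0")
    case True
    have "P = 0"
    proof (rule ccontr)
      assume "P \<noteq> 0"
      \<comment> \<open>With \<open>B = 0\<close> the polynomial is affine in \<open>t\<close>, and
        this value of \<open>t\<close> makes it equal to -1.\<close>
      then show False using quad[of "(A + 1) / (2 * P)"] True by simp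
    qed
    then show ?thesis using True by simp
  next
    case False
    with B have "B > 0" by simp
    then show ?thesis using quad[of "P / B"] by (simp add: power2_eq_square field_simps)
  qed
qed

text \<open>Monotone convergence along the truncations to \<open>{0..real k}\<close>. All energy
  estimates below are proved up to a finite cut-off and passed to the half-line in this way.\<close>

lemma integrable_on_half_line:
  fixes f :: "real \<Rightarrow> real"
  assumes f: "\<And>x. 0 \<le> f x" and int: "\<And>b. f integrable_on {0..b}" and bd: "\<And>b. integral {0..b} f \<le> C"
  shows "f integrable_on {0..}" and "integral {0..} f \<le> C"
proof -
  let ?f = "\<lambda>k x. if x \<in> {0..real k} then f x else 0"
  have fi: "?f k integrable_on {0..}" for k
  proof -
    have "{0..real k} \<inter> {0..} = {0..real k}" by auto
    then show ?thesis using integrable_restrict_Int[of "{0..real k}" f "{0..}"] int by simp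
  qed
  have fI: "integral {0..} (?f k) = integral {0..real k} f" for k
  proof -
    have "{0..real k} \<inter> {0..} = {0..real k}" by auto
    then show ?thesis using integral_restrict_Int[of "{0..}" "{0..real k}" f] by (simp add: Int_commute)
  qed
  have lim: "(\<lambda>k. ?f k x) \<longlonglongrightarrow> f x" if "x \<in> {0..}" for x
  proof -
    obtain N :: nat where "x \<le> real N" using real_arch_simple by blast
    then have "?f k x = f x" if "k \<ge> N" for k using that \<open>x \<in> {0..}\<close> by auto
    then show ?thesis by (intro tendsto_eventually eventually_sequentiallyI[of N])
  qed
  have "0 \<le> integral {0..} (?f k)" for k
    using fi f by (intro Henstock_Kurzweil_Integration.integral_nonneg) auto
  then have "bounded (range (\<lambda>k. integral {0..} (?f k)))"
    unfolding fI using bd by (intro boundedI[of _ C]) auto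
  then have mc: "f integrable_on {0..} \<and> (\<lambda>k. integral {0..} (?f k)) \<longlonglongrightarrow> integral {0..} f"
    using fi lim f by (intro monotone_convergence_increasing) auto
  then show "f integrable_on {0..}" by simp
  show "integral {0..} f \<le> C"
    using mc fI bd by (intro LIMSEQ_le_const2[of "\<lambda>k. integral {0..} (?f k)"]) simp_all
qed

lemma continuous_on_half_line:
  fixes f :: "real \<Rightarrow> 'a::topological_space"
  assumes "\<And>b. continuous_on {0..b} f"
  shows "continuous_on {0..} f"
  unfolding continuous_on_eq_continuous_within
proof
  fix x :: real assume x: "x \<in> {0..}"
  have "continuous (at x within {0..x + 1}) f"
    using assms[of "x + 1"] x by (auto simp: continuous_on_eq_continuous_within)
  moreover have "at x within {0..x + 1} = at x within {0..}"
    using x by (intro at_within_nhd[of _ "{x - 1<..<x + 1}"]) auto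
  ultimately show "continuous (at x within {0..}) f"
    by (simp add: continuous_within)
qed

lemma L2_on_half_line:
  fixes f :: "real \<Rightarrow> 'a::euclidean_space"
  assumes f: "continuous_on {0..} f" and bd: "\<And>b. 0 \<le> b \<Longrightarrow> integral {0..b} (\<lambda>x. (norm (f x))\<^sup>2) \<le> C"
  shows "L2_on {0..} f" and "integral {0..} (\<lambda>x. (norm (f x))\<^sup>2) \<le> C"
proof -
  have b: "integral {0..b} (\<lambda>x. (norm (f x))\<^sup>2) \<le> C" for b
    using bd[of b] bd[of 0] by (cases "0 \<le> b") auto
  have i: "(\<lambda>x. (norm (f x))\<^sup>2) integrable_on {0..b}" for b
    using continuous_on_subset[OF f, of "{0..b}"]
    by (intro integrable_continuous_real continuous_intros) auto
  note * = integrable_on_half_line[of "\<lambda>x. (norm (f x))\<^sup>2" C, OF _ i b]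
  show "L2_on {0..} f"
    by (rule L2_onI[OF _ _ *(1)]) (auto intro: continuous_imp_measurable_on_sets_lebesgue f)
  show "integral {0..} (\<lambda>x. (norm (f x))\<^sup>2) \<le> C" by (rule *(2)) simp
qed

section \<open>Linear Volterra and second-order equations\<close>

text \<open>The weight \<open>exp (- L y)\<close> turns the Volterra operator into a contraction with constant
  \<open>K / L\<close> on the bounded continuous functions, so no continuation argument is needed.\<close>

lemma volterra_exists:
  fixes F :: "real \<Rightarrow> 'a::euclidean_space \<Rightarrow> 'a" and h :: "real \<Rightarrow> 'a"
  assumes h: "continuous_on {0..} h" and hb: "\<And>y. 0 \<le> y \<Longrightarrow> norm (h y) \<le> M * exp (L * y)"
    and K: "0 \<le> K" "K < L"
    and lip: "\<And>t z w. 0 \<le> t \<Longrightarrow> norm (F t z - F t w) \<le> K * norm (z - w)" and F0: "\<And>t. F t 0 = 0"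
    and int: "\<And>Z b. continuous_on {0..b} Z \<Longrightarrow> (\<lambda>t. F t (Z t)) integrable_on {0..b}"
  shows "\<exists>Z. continuous_on {0..} Z \<and> (\<forall>y\<ge>0. Z y = h y + integral {0..y} (\<lambda>t. F t (Z t)))"
proof -
  have L: "L > 0" using K by simp
  define I where "I X y = integral {0..y} (\<lambda>t. F t (exp (L * t) *\<^sub>R X t))" for X y
  \<comment> \<open>The unknown is the weighted function
    \<open>X y = exp (- L * y) *\<^sub>R Z y\<close>. Freezing the argument at
    \<open>max 0 y\<close> extends the operator to functions on the whole line, so that it acts on
    the complete space of bounded continuous functions.\<close>
  define S where "S X y = exp (- L * max 0 y) *\<^sub>R (h (max 0 y) + I X (max 0 y))" for X y
  have inti: "(\<lambda>t. F t (exp (L * t) *\<^sub>R X t)) integrable_on {0..b}" if "continuous_on UNIV X" for X b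
    using that by (intro int continuous_intros continuous_on_subset[OF that]) auto
  have expi: "((\<lambda>t. K * (exp (L * t) * B)) has_integral (K / L) * B * (exp (L * y) - 1)) {0..y}" if "y \<ge> 0" for y B
  proof -
    have "((\<lambda>t. K * (exp (L * t) * B)) has_integral (K / L) * B * exp (L * y) - (K / L) * B * exp (L * 0)) {0..y}"
      using that L by (intro fundamental_theorem_of_calculus)
        (auto intro!: derivative_eq_intros simp: has_real_derivative_iff_has_vector_derivative[symmetric])
    then show ?thesis by (simp add: algebra_simps)
  qed
  have Idiff: "norm (I X y - I Y y) \<le> (K / L) * B * exp (L * y)"
    if "continuous_on UNIV X" "continuous_on UNIV Y" "y \<ge> 0" "\<And>t. norm (X t - Y t) \<le> B" for X Y y B
  proof -
    have B: "0 \<le> B" using that(4)[of 0] norm_ge_zero order_trans by blast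
    have "I X y - I Y y = integral {0..y} (\<lambda>t. F t (exp (L * t) *\<^sub>R X t) - F t (exp (L * t) *\<^sub>R Y t))"
      unfolding I_def using inti that by (intro Henstock_Kurzweil_Integration.integral_diff[symmetric])
    also have "norm \<dots> \<le> integral {0..y} (\<lambda>t. K * (exp (L * t) * B))"
    proof (rule Henstock_Kurzweil_Integration.integral_norm_bound_integral)
      show "(\<lambda>t. F t (exp (L * t) *\<^sub>R X t) - F t (exp (L * t) *\<^sub>R Y t)) integrable_on {0..y}"
        using inti that by (intro integrable_diff)
      show "(\<lambda>t. K * (exp (L * t) * B)) integrable_on {0..y}" using expi[OF that(3)] by blast
      fix t assume t: "t \<in> {0..y}"
      have "norm (F t (exp (L * t) *\<^sub>R X t) - F t (exp (L * t) *\<^sub>R Y t))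
          \<le> K * norm (exp (L * t) *\<^sub>R X t - exp (L * t) *\<^sub>R Y t)"
        using t by (intro lip) auto
      also have "\<dots> = K * (exp (L * t) * norm (X t - Y t))"
        by (simp add: scaleR_diff_right[symmetric])
      also have "\<dots> \<le> K * (exp (L * t) * B)"
        using K(1) that(4) by (intro mult_left_mono) auto
      finally show "norm (F t (exp (L * t) *\<^sub>R X t) - F t (exp (L * t) *\<^sub>R Y t)) \<le> K * (exp (L * t) * B)" .
    qed
    also have "\<dots> = (K / L) * B * (exp (L * y) - 1)"
      using expi[OF that(3)] by (rule integral_unique)
    also have "\<dots> \<le> (K / L) * B * exp (L * y)"
      using K L B by (intro mult_left_mono) auto
    finally show ?thesis .
  qed
  have Scont: "continuous_on UNIV (S X)" if X: "continuous_on UNIV X" for X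
  proof -
    have "continuous_on {0..} (I X)"
      unfolding I_def by (intro continuous_on_half_line indefinite_integral_continuous_1 inti X)
    then have "continuous_on {0..} (\<lambda>y. h y + I X y)" using h by (intro continuous_intros)
    then have "continuous_on UNIV (\<lambda>y. (\<lambda>y. h y + I X y) (max 0 y))"
      by (rule continuous_on_compose2) (auto intro!: continuous_intros)
    then show ?thesis unfolding S_def by (rule continuous_on_scaleR[rotated]) (intro continuous_intros)
  qed
  have Sdiff: "norm (S X y - S Y y) \<le> (K / L) * B"
    if "continuous_on UNIV X" "continuous_on UNIV Y" "\<And>t. norm (X t - Y t) \<le> B" for X Y y B
  proof -
    let ?p = "max 0 y"
    have "norm (S X y - S Y y) = exp (- L * ?p) * norm (I X ?p - I Y ?p)"
      unfolding S_def by (simp add: scaleR_diff_right[symmetric])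
    also have "\<dots> \<le> exp (- L * ?p) * ((K / L) * B * exp (L * ?p))"
      using that by (intro mult_left_mono Idiff) auto
    also have "\<dots> = (K / L) * B" by (simp add: exp_minus field_simps)
    finally show ?thesis .
  qed
  have Sb: "S X \<in> bcontfun" if X: "X \<in> bcontfun" for X
  proof -
    from X have cX: "continuous_on UNIV X" and "bounded (range X)" by (auto simp: bcontfun_def)
    then obtain B where B: "\<And>t. norm (X t) \<le> B" by (auto simp: bounded_iff)
    have "norm (S X y) \<le> M + (K / L) * B" for y
    proof -
      let ?p = "max 0 y"
      have "I (\<lambda>_. 0) ?p = 0" by (simp add: I_def F0)
      then have "S (\<lambda>_. 0) y = exp (- L * ?p) *\<^sub>R h ?p" by (simp add: S_def)
      then have "norm (S (\<lambda>_. 0) y) = exp (- L * ?p) * norm (h ?p)" by simp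
      also have "\<dots> \<le> exp (- L * ?p) * (M * exp (L * ?p))" by (intro mult_left_mono hb) auto
      also have "\<dots> = M" by (simp add: exp_minus field_simps)
      finally have "norm (S (\<lambda>_. 0) y) \<le> M" .
      moreover have "norm (S X y - S (\<lambda>_. 0) y) \<le> (K / L) * B"
        using B cX by (intro Sdiff) auto
      ultimately show ?thesis using norm_triangle_ineq2[of "S X y" "S (\<lambda>_. 0) y"] by linarith
    qed
    then show ?thesis using Scont[OF cX] by (intro bcontfun_normI)
  qed
  define T where "T X = Bcontfun (S (apply_bcontfun X))" for X
  have T: "apply_bcontfun (T X) = S (apply_bcontfun X)" for X
    unfolding T_def using Sb[OF apply_bcontfun[of X]] by (rule Bcontfun_inverse)
  have contr: "dist (T X) (T Y) \<le> (K / L) * dist X Y" for X Y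
  proof (rule dist_bound)
    fix y
    show "dist (apply_bcontfun (T X) y) (apply_bcontfun (T Y) y) \<le> (K / L) * dist X Y"
      unfolding T dist_norm[of "S _ _"]
      by (rule Sdiff) (auto simp: dist_norm[symmetric] intro: dist_bounded)
  qed
  have "\<exists>!X. T X = X"
    using K L contr by (intro banach_fix_type[of "K / L"]) auto
  then obtain X where X: "T X = X" by auto
  define Z where "Z y = exp (L * y) *\<^sub>R apply_bcontfun X y" for y
  have "continuous_on {0..} Z" unfolding Z_def by (intro continuous_on_scaleR continuous_on_apply_bcontfun continuous_intros)
  moreover have "Z y = h y + integral {0..y} (\<lambda>t. F t (Z t))" if "y \<ge> 0" for y
  proof -
    have "apply_bcontfun X y = S (apply_bcontfun X) y" using T[of X] X by simp
    also have "\<dots> = exp (- L * y) *\<^sub>R (h y + integral {0..y} (\<lambda>t. F t (Z t)))"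
      using that by (simp add: S_def I_def Z_def)
    finally show ?thesis by (simp add: Z_def[of y] exp_minus)
  qed
  ultimately show ?thesis by blast
qed

lemma has_integral_Pair:
  fixes f :: "'n::euclidean_space \<Rightarrow> 'a::euclidean_space" and g :: "'n \<Rightarrow> 'b::euclidean_space"
  assumes "(f has_integral a) S" "(g has_integral b) S"
  shows "((\<lambda>x. (f x, g x)) has_integral (a, b)) S"
proof -
  have "((\<lambda>x. (f x, 0) + (0, g x)) has_integral (a, 0) + (0, b)) S"
    using has_integral_linear[OF assms(1), of "\<lambda>x. (x, 0 :: 'b)"]
      has_integral_linear[OF assms(2), of "\<lambda>x. (0 :: 'a, x)"]
    by (intro has_integral_add) (simp_all add: o_def bounded_linear_Pair)
  then show ?thesis by simp
qed

text \<open>The equation is a Volterra equation for the pair \<open>(U, U')\<close>: the potential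
  gives a linear map with Lipschitz constant \<open>1 + K\<close>, and the initial data together
  with the primitive of \<open>f\<close> form the inhomogeneity. That primitive grows at most
  linearly, hence below the exponential weight.\<close>

lemma second_order_equation_exists:
  fixes W f :: "real \<Rightarrow> 'a::{euclidean_space, real_normed_field}"
  assumes W: "W \<in> borel_measurable (lebesgue_on {0..})" and WK: "\<And>t. 0 \<le> t \<Longrightarrow> norm (W t) \<le> K"
    and f: "L2_on {0..} f"
  shows "\<exists>U U'. U 0 = u0 \<and> U' 0 = u1 \<and>
    (\<forall>b. primitive b U U' \<and> primitive b U' (\<lambda>x. W x * U x - f x))"
proof -
  have K: "0 \<le> K" using WK[of 0] norm_ge_zero order_trans by blast
  have fi: "f absolutely_integrable_on {0..b}" for b
    by (rule L2_on_locally_integrable[OF f]) auto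
  have Wm: "W \<in> borel_measurable (lebesgue_on {0..b})" for b
    by (rule measurable_restrict_mono[OF W]) auto
  have Wi: "(\<lambda>t. W t * z t) absolutely_integrable_on {0..b}" if "continuous_on {0..b} z" for z b
    using absolutely_integrable_continuous_real[OF that] Wm WK
    by (intro absolutely_integrable_mult_bounded[where K = K]) auto
  define F where "F t z = (snd z, W t * fst z)" for t and z :: "'a \<times> 'a"
  define h where "h y = (u0, u1 - integral {0..y} f)" for y
  \<comment> \<open>The summand 1 ensures \<open>1 \<le> M\<close>, so that the linear growth
    \<open>y\<close> is absorbed in \<open>M * y\<close>.\<close>
  define M where "M = norm u0 + norm u1 + integral {0..} (\<lambda>x. (norm (f x))\<^sup>2) + 1"
  have "\<exists>Z. continuous_on {0..} Z \<and> (\<forall>y\<ge>0. Z y = h y + integral {0..y} (\<lambda>t. F t (Z t)))"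
  proof (rule volterra_exists[where K = "1 + K" and L = "2 + K" and M = M])
    show "continuous_on {0..} h"
      unfolding h_def by (intro continuous_intros continuous_on_half_line indefinite_integral_continuous_1
        absolutely_integrable_on_Icc_imp_integrable fi)
    show "norm (h y) \<le> M * exp ((2 + K) * y)" if y: "0 \<le> y" for y
    proof -
      have "norm (integral {0..y} f) \<le> integral {0..y} (\<lambda>x. norm (f x))"
        using fi absolutely_integrable_norm_comp[OF fi]
        by (intro Henstock_Kurzweil_Integration.integral_norm_bound_integral absolutely_integrable_on_Icc_imp_integrable) auto
      also have "\<dots> \<le> y + integral {0..y} (\<lambda>x. (norm (f x))\<^sup>2)"
        using L2_on_locally_integrable(2)[OF f, of 0 y] y by auto
      also have "integral {0..y} (\<lambda>x. (norm (f x))\<^sup>2) \<le> integral {0..} (\<lambda>x. (norm (f x))\<^sup>2)"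
        using L2_on_square_integrable[OF f] L2_on_square_integrable[OF L2_on_subset[OF f, of "{0..y}"]]
        by (intro integral_subset_le) auto
      finally have 1: "norm (integral {0..y} f) \<le> y + integral {0..} (\<lambda>x. (norm (f x))\<^sup>2)" by simp
      have J: "0 \<le> integral {0..} (\<lambda>x. (norm (f x))\<^sup>2)"
        using L2_on_square_integrable[OF f] by (intro Henstock_Kurzweil_Integration.integral_nonneg) auto
      have "norm (h y) \<le> norm u0 + norm (u1 - integral {0..y} f)"
        unfolding h_def by (rule norm_Pair_le)
      also have "\<dots> \<le> M * 1 + 1 * y"
        using 1 norm_triangle_ineq4[of u1 "integral {0..y} f"] by (simp add: M_def)
      also have "\<dots> \<le> M * 1 + M * y"
        using J y by (intro add_left_mono mult_right_mono) (auto simp: M_def)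
      also have "\<dots> = M * (1 + y)" by (simp add: algebra_simps)
      also have "\<dots> \<le> M * exp ((2 + K) * y)"
      proof (rule mult_left_mono)
        have "1 + y \<le> 1 + (2 + K) * y" using K y mult_nonneg_nonneg[OF K y] by (simp add: algebra_simps)
        also have "\<dots> \<le> exp ((2 + K) * y)" by (rule exp_ge_add_one_self)
        finally show "1 + y \<le> exp ((2 + K) * y)" .
        show "0 \<le> M" using J by (simp add: M_def)
      qed
      finally show ?thesis .
    qed
    show "norm (F t z - F t w) \<le> (1 + K) * norm (z - w)" if "0 \<le> t" for t z w
    proof -
      have "F t z - F t w = (snd (z - w), W t * fst (z - w))" by (simp add: F_def algebra_simps)
      also have "norm \<dots> \<le> norm (snd (z - w)) + norm (W t) * norm (fst (z - w))"
        using norm_Pair_le[of "snd (z - w)" "W t * fst (z - w)"] by (simp add: norm_mult)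
      also have "\<dots> \<le> norm (z - w) + K * norm (z - w)"
        using WK[OF that] K norm_fst_le[of "fst (z - w)" "snd (z - w)"] norm_snd_le[of "snd (z - w)" "fst (z - w)"]
        by (intro add_mono mult_mono) (simp_all only: prod.collapse norm_ge_zero)
      finally show ?thesis by (simp add: algebra_simps)
    qed
    show "F t 0 = 0" for t by (simp add: F_def zero_prod_def)
    show "(\<lambda>t. F t (Z t)) integrable_on {0..b}" if Z: "continuous_on {0..b} Z" for Z b
    proof -
      have 1: "(\<lambda>t. snd (Z t)) integrable_on {0..b}"
        using Z by (intro integrable_continuous_real continuous_intros)
      have 2: "(\<lambda>t. W t * fst (Z t)) integrable_on {0..b}"
        using Z by (intro absolutely_integrable_on_Icc_imp_integrable Wi continuous_intros)
      show ?thesis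
        unfolding F_def using has_integral_Pair[OF integrable_integral[OF 1] integrable_integral[OF 2]] by blast
    qed
  qed (use K in auto)
  then obtain Z where Zc: "continuous_on {0..} Z"
    and Z: "\<And>y. 0 \<le> y \<Longrightarrow> Z y = h y + integral {0..y} (\<lambda>t. F t (Z t))" by auto
  define U where "U y = fst (Z y)" for y
  define U' where "U' y = snd (Z y)" for y
  have Zb: "continuous_on {0..b} Z" for b by (rule continuous_on_subset[OF Zc]) auto
  have Ub: "continuous_on {0..b} U" "continuous_on {0..b} U'" for b
    unfolding U_def U'_def using Zb by (auto intro!: continuous_intros)
  have eqs: "U y = u0 + integral {0..y} U'" "U' y = u1 + integral {0..y} (\<lambda>x. W x * U x - f x)" if y: "0 \<le> y" for y
  proof -
    have 1: "U' integrable_on {0..y}" using Ub by (intro integrable_continuous_real)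
    have 2: "(\<lambda>t. W t * U t) integrable_on {0..y}"
      using Ub by (intro absolutely_integrable_on_Icc_imp_integrable Wi)
    have 3: "f integrable_on {0..y}" by (rule absolutely_integrable_on_Icc_imp_integrable[OF fi])
    have "integral {0..y} (\<lambda>t. F t (Z t)) = (integral {0..y} U', integral {0..y} (\<lambda>t. W t * U t))"
      unfolding F_def U_def[symmetric] U'_def[symmetric]
      using has_integral_Pair[OF integrable_integral[OF 1] integrable_integral[OF 2]] by (rule integral_unique)
    with Z[OF y] have "Z y = (u0 + integral {0..y} U', u1 - integral {0..y} f + integral {0..y} (\<lambda>t. W t * U t))"
      by (simp add: h_def)
    then show "U y = u0 + integral {0..y} U'" "U' y = u1 + integral {0..y} (\<lambda>x. W x * U x - f x)"
      using 2 3 by (simp_all add: U_def[of y] U'_def[of y] Henstock_Kurzweil_Integration.integral_diff)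
  qed
  have 0: "U 0 = u0" "U' 0 = u1" using eqs[of 0] by simp_all
  moreover have "primitive b U U'" for b
    unfolding primitive_def 0 using eqs Ub by (auto intro: absolutely_integrable_continuous_real)
  moreover have "primitive b U' (\<lambda>x. W x * U x - f x)" for b
    unfolding primitive_def 0 using eqs(2) set_integral_diff(1)[OF Wi[OF Ub(1)] fi] by auto
  ultimately show ?thesis by blast
qed

section \<open>Square integrable solutions on a half-line\<close>

lemma AE_lebesgue_on_iff_negligible:
  fixes S :: "'a::euclidean_space set"
  assumes "S \<in> sets lebesgue"
  shows "(AE x in lebesgue_on S. P x) \<longleftrightarrow> (\<exists>N. negligible N \<and> (\<forall>x\<in>S - N. P x))"
proof -
  have "(AE x in lebesgue_on S. P x) \<longleftrightarrow> (AE x in lebesgue. x \<in> S \<longrightarrow> P x)"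
    using assms by (intro AE_restrict_space_iff) auto
  also have "\<dots> \<longleftrightarrow> (\<exists>N\<in>null_sets lebesgue. {x. \<not> (x \<in> S \<longrightarrow> P x)} \<subseteq> N)"
    by (simp add: eventually_ae_filter)
  also have "\<dots> \<longleftrightarrow> (\<exists>N. negligible N \<and> (\<forall>x\<in>S - N. P x))"
    unfolding negligible_iff_null_sets by blast
  finally show ?thesis .
qed

text \<open>With \<open>V\<close> equal to the potential minus the spectral parameter this is
  \<open>- u'' + V u = f\<close>. The second derivative is eliminated from the data, which makes the
  linear algebra on Cauchy data direct; \<open>edge_sol_iff\<close> recovers its square
  integrability from the boundedness of \<open>V\<close>.\<close>

definition edge_sol :: "(real \<Rightarrow> complex) \<Rightarrow> (real \<Rightarrow> complex) \<Rightarrow> (real \<Rightarrow> complex) \<Rightarrow> (real \<Rightarrow> complex) \<Rightarrow> bool" where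
  "edge_sol V f u u' \<longleftrightarrow>
     (\<forall>b. primitive b u u' \<and> primitive b u' (\<lambda>x. V x * u x - f x)) \<and> L2_on {0..} u \<and> L2_on {0..} u'"

lemma H2_on_primitive:
  fixes u u' u'' :: "real \<Rightarrow> 'a::euclidean_space"
  assumes "H2_on S u u' u''" "{0..b} \<subseteq> S" "S \<in> sets lebesgue"
  shows "primitive b u u'" "primitive b u' u''"
proof -
  have eq: "u x = u 0 + integral {0..x} u'" "u' x = u' 0 + integral {0..x} u''" if "x \<in> {0..b}" for x
    using assms(1,2) that unfolding H2_on_def by blast+
  have "L2_on S u'" "L2_on S u''" using assms(1) unfolding H2_on_def by blast+
  then have ai: "u' absolutely_integrable_on {0..b}" "u'' absolutely_integrable_on {0..b}"
    using L2_on_locally_integrable(1)[OF _ assms(2,3)] by blast+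
  show "primitive b u u'" unfolding primitive_def by (intro conjI ballI ai eq)
  show "primitive b u' u''" unfolding primitive_def by (intro conjI ballI ai eq)
qed

lemma edge_sol_iff:
  assumes V: "V \<in> borel_measurable (lebesgue_on {0..})" "\<And>x. 0 \<le> x \<Longrightarrow> norm (V x) \<le> K"
    and f: "L2_on {0..} f"
  shows "edge_sol V f u u' \<longleftrightarrow>
    (\<exists>u''. H2_on {0..} u u' u'' \<and> (AE x in lebesgue_on {0..}. u'' x = V x * u x - f x))"
proof
  assume e: "edge_sol V f u u'"
  have "L2_on {0..} (\<lambda>x. V x * u x - f x)"
    using e f V by (intro L2_on_diff L2_on_mult_bounded) (auto simp: edge_sol_def)
  moreover have "u x = u 0 + integral {0..x} u'" "u' x = u' 0 + integral {0..x} (\<lambda>x. V x * u x - f x)" if "x \<in> {0..}" for x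
    using e that primitive_eq[of x u u' x] primitive_eq[of x u' _ x] by (auto simp: edge_sol_def)
  ultimately have "H2_on {0..} u u' (\<lambda>x. V x * u x - f x)"
    using e unfolding H2_on_def edge_sol_def by blast
  then show "\<exists>u''. H2_on {0..} u u' u'' \<and> (AE x in lebesgue_on {0..}. u'' x = V x * u x - f x)"
    by (intro exI conjI) auto
next
  assume "\<exists>u''. H2_on {0..} u u' u'' \<and> (AE x in lebesgue_on {0..}. u'' x = V x * u x - f x)"
  then obtain u'' where H: "H2_on {0..} u u' u''" and ae: "AE x in lebesgue_on {0..}. u'' x = V x * u x - f x"
    by blast
  from ae obtain N where N: "negligible N" "\<And>x. x \<in> {0..} - N \<Longrightarrow> u'' x = V x * u x - f x"
    by (subst (asm) AE_lebesgue_on_iff_negligible) auto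
  have "primitive b u u'" "primitive b u' (\<lambda>x. V x * u x - f x)" for b
  proof -
    show "primitive b u u'" by (rule H2_on_primitive[OF H]) auto
    show "primitive b u' (\<lambda>x. V x * u x - f x)"
    proof (cases "0 \<le> b")
      case True
      have "primitive b u' u''" by (rule H2_on_primitive[OF H]) auto
      then show ?thesis
      proof (rule primitive_cong[OF _ N(1) True])
        fix x assume "x \<in> {0..b} - N"
        then have "x \<in> {0..} - N" by auto
        then show "V x * u x - f x = u'' x" by (rule N(2)[symmetric])
      qed simp
    qed (auto simp: primitive_def absolutely_integrable_on_def)
  qed
  with H show "edge_sol V f u u'" by (auto simp: edge_sol_def H2_on_def)
qed

lemma primitive_all_continuous:
  assumes "\<And>b. primitive b F f"
  shows "continuous_on {0..} F"
  by (rule continuous_on_half_line, rule primitive_continuous, rule assms)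

text \<open>An integrable function need not tend to zero, but it cannot stay above \<eta> on a
  half-line. This is enough to discard boundary terms at infinity along suitable cut-offs.\<close>

lemma integrable_function_small_somewhere:
  fixes p :: "real \<Rightarrow> real"
  assumes p: "\<And>x. 0 \<le> p x" and int: "p integrable_on {0..}" and \<eta>: "0 < \<eta>"
  shows "\<exists>b\<ge>B. p b < \<eta>"
proof (rule ccontr)
  assume "\<not> ?thesis"
  then have big: "\<eta> \<le> p b" if "b \<ge> B" for b using that by (auto simp: not_less)
  define B' where "B' = max 0 B"
  \<comment> \<open>The length is chosen so that a rectangle of height \<eta> over
    \<open>{B'..b}\<close> has area exactly one more than the whole integral.\<close>
  define b where "b = B' + (integral {0..} p + 1) / \<eta>"
  have I: "0 \<le> integral {0..} p" using int p by (intro Henstock_Kurzweil_Integration.integral_nonneg) auto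
  then have b: "B' \<le> b" using \<eta> by (simp add: b_def)
  have s: "{B'..b} \<subseteq> {0..}" by (auto simp: B'_def)
  have pi: "p integrable_on {B'..b}" by (rule integrable_on_subinterval[OF int s])
  have "(b - B') * \<eta> = integral {B'..b} (\<lambda>_. \<eta>)" using b by simp
  also have "\<dots> \<le> integral {B'..b} p"
    using pi big by (intro integral_le) (auto simp: B'_def)
  also have "\<dots> \<le> integral {0..} p" using s pi int p by (intro integral_subset_le) auto
  finally show False using \<eta> by (simp add: b_def)
qed

lemma primitive_exp: "primitive b (\<lambda>x. exp (c * complex_of_real x)) (\<lambda>x. c * exp (c * complex_of_real x))"
proof (rule primitive_C1)
  fix x assume "x \<in> {0..b}"
  have "((\<lambda>z. exp (c * z)) has_field_derivative c * exp (c * complex_of_real x)) (at (complex_of_real x))"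
    by (auto intro!: derivative_eq_intros)
  then show "((\<lambda>x. exp (c * complex_of_real x)) has_vector_derivative c * exp (c * complex_of_real x)) (at x within {0..b})"
    by (rule has_vector_derivative_real_field)
qed (intro continuous_intros)

lemma norm_exp_of_real: "norm (exp (c * complex_of_real x)) = exp (Re c * x)"
  by (simp add: norm_exp_eq_Re)

lemma primitive_norm_square:
  fixes u :: "real \<Rightarrow> complex"
  assumes "primitive b u u'"
  shows "primitive b (\<lambda>x. (norm (u x))\<^sup>2) (\<lambda>x. 2 * Re (u' x * cnj (u x)))"
proof -
  have "primitive b (\<lambda>x. u x * cnj (u x)) (\<lambda>x. u' x * cnj (u x) + u x * cnj (u' x))"
    by (intro primitive_mult assms primitive_linear[OF assms bounded_linear_cnj])
  from primitive_linear[OF this bounded_linear_Re] show ?thesis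
    by (simp add: complex_mult_cnj cmod_power2 mult.commute)
qed

lemma Re_mult_norm_square: "Re (c * z * cnj z) = Re c * (norm z)\<^sup>2"
  unfolding cmod_power2 by (simp add: power2_eq_square algebra_simps)

lemma young_inequality_Re:
  fixes z w :: complex
  assumes "0 < r"
  shows "2 * \<bar>Re (z * cnj w)\<bar> \<le> (norm z)\<^sup>2 / r + r * (norm w)\<^sup>2"
proof -
  have "\<bar>Re (z * cnj w)\<bar> \<le> norm z * norm w"
    using abs_Re_le_cmod[of "z * cnj w"] by (simp add: norm_mult)
  moreover have "0 \<le> (norm z - r * norm w)\<^sup>2 / r" using assms by simp
  then have "2 * (norm z * norm w) \<le> (norm z)\<^sup>2 / r + r * (norm w)\<^sup>2"
    using assms by (simp add: power2_eq_square field_simps)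
  ultimately show ?thesis by linarith
qed

text \<open>For \<open>Re \<kappa> > 0\<close> this is the unique square integrable solution of \<open>g' = \<kappa> g - f\<close>, that is, of the
  left factor in \<open>- u'' + \<kappa>\<^sup>2 u = (- d/dx + \<kappa>) (d/dx + \<kappa>) u\<close>.\<close>

definition tail_transform :: "complex \<Rightarrow> (real \<Rightarrow> complex) \<Rightarrow> real \<Rightarrow> complex" where
  "tail_transform \<kappa> f x = exp (\<kappa> * x) * integral {x..} (\<lambda>t. exp (- \<kappa> * t) * f t)"

context
  fixes \<kappa> :: complex and f :: "real \<Rightarrow> complex"
  assumes \<kappa>: "0 < Re \<kappa>" and f: "L2_on {0..} f"
begin

lemma exp_decay_L2: "L2_on {x..} (\<lambda>t. exp (- \<kappa> * complex_of_real t))"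
  "integral {x..} (\<lambda>t. (norm (exp (- \<kappa> * complex_of_real t)))\<^sup>2) = exp (- 2 * Re \<kappa> * x) / (2 * Re \<kappa>)"
proof -
  have sq: "(norm (exp (- \<kappa> * complex_of_real t)))\<^sup>2 = exp (- (2 * Re \<kappa>) * t)" for t
    unfolding norm_exp_of_real by (simp add: power2_eq_square exp_add[symmetric])
  have hi: "((\<lambda>t. exp (- (2 * Re \<kappa>) * t)) has_integral exp (- (2 * Re \<kappa>) * x) / (2 * Re \<kappa>)) {x..}"
    using \<kappa> by (intro has_integral_exp_minus_to_infinity) auto
  show "integral {x..} (\<lambda>t. (norm (exp (- \<kappa> * complex_of_real t)))\<^sup>2) = exp (- 2 * Re \<kappa> * x) / (2 * Re \<kappa>)"
    unfolding sq using hi by (simp add: integral_unique)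
  show "L2_on {x..} (\<lambda>t. exp (- \<kappa> * complex_of_real t))"
  proof (rule L2_onI)
    show "(\<lambda>t. exp (- \<kappa> * complex_of_real t)) \<in> borel_measurable (lebesgue_on {x..})"
      by (intro continuous_imp_measurable_on_sets_lebesgue continuous_intros) auto
    show "(\<lambda>t. exp (- (2 * Re \<kappa>) * t)) integrable_on {x..}" using hi by blast
    show "(norm (exp (- \<kappa> * complex_of_real t)))\<^sup>2 \<le> exp (- (2 * Re \<kappa>) * t)" for t
      unfolding sq by simp
  qed auto
qed

lemma exp_decay_mult_integrable:
  assumes "0 \<le> x"
  shows "(\<lambda>t. exp (- \<kappa> * complex_of_real t) * f t) absolutely_integrable_on {x..}"
    and "norm (integral {x..} (\<lambda>t. exp (- \<kappa> * complex_of_real t) * f t))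
      \<le> sqrt (exp (- 2 * Re \<kappa> * x) / (2 * Re \<kappa>) * integral {0..} (\<lambda>t. (norm (f t))\<^sup>2))"
proof -
  have fx: "L2_on {x..} f" by (rule L2_on_subset[OF f]) (use assms in auto)
  note cs = L2_on_cauchy_schwarz[OF exp_decay_L2(1) fx]
  show ai: "(\<lambda>t. exp (- \<kappa> * complex_of_real t) * f t) absolutely_integrable_on {x..}"
  proof (rule measurable_bounded_by_integrable_imp_absolutely_integrable)
    show "(\<lambda>t. exp (- \<kappa> * complex_of_real t) * f t) \<in> borel_measurable (lebesgue_on {x..})"
      by (rule borel_measurable_times[OF L2_on_measurable[OF exp_decay_L2(1)] L2_on_measurable[OF fx]])
    show "(\<lambda>t. norm (exp (- \<kappa> * complex_of_real t)) * norm (f t)) integrable_on {x..}"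
      by (rule cs(1)) simp
  qed (auto simp: norm_mult)
  have "norm (integral {x..} (\<lambda>t. exp (- \<kappa> * complex_of_real t) * f t))
      \<le> integral {x..} (\<lambda>t. norm (exp (- \<kappa> * complex_of_real t)) * norm (f t))"
    using ai cs(1) by (intro Henstock_Kurzweil_Integration.integral_norm_bound_integral)
      (auto simp: norm_mult absolutely_integrable_on_def)
  also have "\<dots> \<le> sqrt (integral {x..} (\<lambda>t. (norm (exp (- \<kappa> * complex_of_real t)))\<^sup>2) * integral {x..} (\<lambda>t. (norm (f t))\<^sup>2))"
    by (rule real_le_rsqrt) (rule cs(2), simp)
  also have "\<dots> \<le> sqrt (exp (- 2 * Re \<kappa> * x) / (2 * Re \<kappa>) * integral {0..} (\<lambda>t. (norm (f t))\<^sup>2))"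
    unfolding exp_decay_L2(2) using \<kappa> assms
    by (intro real_sqrt_le_mono mult_left_mono integral_subset_le
        L2_on_square_integrable[OF fx] L2_on_square_integrable[OF f]) auto
  finally show "norm (integral {x..} (\<lambda>t. exp (- \<kappa> * complex_of_real t) * f t))
      \<le> sqrt (exp (- 2 * Re \<kappa> * x) / (2 * Re \<kappa>) * integral {0..} (\<lambda>t. (norm (f t))\<^sup>2))" .
qed

text \<open>By Cauchy-Schwarz on \<open>{x..}\<close>: the norm of the exponential there is
  \<open>exp (- Re \<kappa> * x)\<close> divided by the root of \<open>2 * Re \<kappa>\<close>, and
  it cancels the growing prefactor. The bound is therefore uniform in \<open>x\<close>.\<close>

lemma tail_transform_bound:
  assumes "0 \<le> x"
  shows "norm (tail_transform \<kappa> f x) \<le> sqrt (integral {0..} (\<lambda>t. (norm (f t))\<^sup>2) / (2 * Re \<kappa>))"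
proof -
  have "norm (tail_transform \<kappa> f x)
      \<le> exp (Re \<kappa> * x) * sqrt (exp (- 2 * Re \<kappa> * x) / (2 * Re \<kappa>) * integral {0..} (\<lambda>t. (norm (f t))\<^sup>2))"
    unfolding tail_transform_def norm_mult norm_exp_of_real
    using exp_decay_mult_integrable(2)[OF assms] by (intro mult_left_mono) auto
  also have "\<dots> = sqrt ((exp (Re \<kappa> * x))\<^sup>2 * (exp (- 2 * Re \<kappa> * x) / (2 * Re \<kappa>) * integral {0..} (\<lambda>t. (norm (f t))\<^sup>2)))"
    unfolding real_sqrt_mult[of "(exp (Re \<kappa> * x))\<^sup>2"] by simp
  also have "(exp (Re \<kappa> * x))\<^sup>2 * (exp (- 2 * Re \<kappa> * x) / (2 * Re \<kappa>) * integral {0..} (\<lambda>t. (norm (f t))\<^sup>2))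
      = integral {0..} (\<lambda>t. (norm (f t))\<^sup>2) / (2 * Re \<kappa>)"
    by (simp add: power2_eq_square exp_add[symmetric])
  finally show ?thesis .
qed

lemma tail_transform_primitive: "primitive b (tail_transform \<kappa> f) (\<lambda>x. \<kappa> * tail_transform \<kappa> f x - f x)"
proof (cases "0 \<le> b")
  case True
  let ?h = "\<lambda>t. exp (- \<kappa> * complex_of_real t) * f t"
  have h: "?h absolutely_integrable_on {0..}" by (rule exp_decay_mult_integrable) simp
  have hb: "?h absolutely_integrable_on {0..b}" by (rule absolutely_integrable_on_subinterval[OF h]) auto
  have H: "primitive b (\<lambda>x. integral {x..} ?h) (\<lambda>x. - ?h x)"
    unfolding primitive_def
  proof (intro conjI ballI)
    show "(\<lambda>x. - ?h x) absolutely_integrable_on {0..b}"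
      using absolutely_integrable_linear[OF hb bounded_linear_minus[OF bounded_linear_ident]] by (simp add: o_def)
    fix x assume x: "x \<in> {0..b}"
    have "(?h has_integral integral {0..x} ?h + integral {x..} ?h) ({0..x} \<union> {x..})"
    proof (rule has_integral_Un)
      show "(?h has_integral integral {0..x} ?h) {0..x}"
        using absolutely_integrable_on_subinterval[OF h, of 0 x]
        by (intro integrable_integral absolutely_integrable_on_Icc_imp_integrable) auto
      show "(?h has_integral integral {x..} ?h) {x..}"
        using exp_decay_mult_integrable(1)[of x] x by (intro integrable_integral) (auto simp: absolutely_integrable_on_def)
      have "{0..x} \<inter> {x..} = {x}" using x by auto
      then show "negligible ({0..x} \<inter> {x..})" by simp
    qed
    moreover have "{0..x} \<union> {x..} = {0..}" using x by auto
    ultimately have "integral {0..} ?h = integral {0..x} ?h + integral {x..} ?h" by (simp add: integral_unique)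
    then show "integral {x..} ?h = integral {0..} ?h + integral {0..x} (\<lambda>x. - ?h x)" by simp
  qed
  show ?thesis
  proof (rule primitive_cong[OF primitive_mult[OF primitive_exp[of b \<kappa>] H] negligible_empty True])
    fix x show "\<kappa> * tail_transform \<kappa> f x - f x = \<kappa> * exp (\<kappa> * complex_of_real x) * integral {x..} ?h + exp (\<kappa> * complex_of_real x) * - ?h x"
      by (simp add: tail_transform_def mult.assoc[symmetric] exp_add[symmetric])
  qed (simp add: tail_transform_def)
qed (auto simp: primitive_def absolutely_integrable_on_def)

text \<open>Energy estimate for \<open>g' = \<kappa> g - f\<close>: by Young's inequality the
  derivative of |g|^2 is at least \<open>r\<close> |g|^2 - |f|^2 / \<open>r\<close> with
  \<open>r = Re \<kappa>\<close>. The boundary term |g(b)|^2 has the unfavourable sign, and the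
  uniform pointwise bound controls it.\<close>

lemma tail_transform_L2:
  "L2_on {0..} (tail_transform \<kappa> f)"
  "integral {0..} (\<lambda>x. (norm (tail_transform \<kappa> f x))\<^sup>2) \<le> 2 * integral {0..} (\<lambda>t. (norm (f t))\<^sup>2) / (Re \<kappa>)\<^sup>2"
proof -
  define g where "g = tail_transform \<kappa> f"
  define r where "r = Re \<kappa>"
  define I where "I = integral {0..} (\<lambda>t. (norm (f t))\<^sup>2)"
  have r: "0 < r" using \<kappa> by (simp add: r_def)
  have I: "0 \<le> I" unfolding I_def by (intro Henstock_Kurzweil_Integration.integral_nonneg L2_on_square_integrable f) auto
  have pg: "primitive b g (\<lambda>x. \<kappa> * g x - f x)" for b
    unfolding g_def by (rule tail_transform_primitive)
  have "integral {0..b} (\<lambda>x. (norm (g x))\<^sup>2) \<le> 2 * I / r\<^sup>2" if b: "0 \<le> b" for b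
  proof -
    have cg: "continuous_on {0..b} g" using pg by (rule primitive_continuous)
    have gi: "(\<lambda>x. (norm (g x))\<^sup>2) integrable_on {0..b}"
      using cg by (intro integrable_continuous_real continuous_intros)
    have fi: "(\<lambda>x. (norm (f x))\<^sup>2) integrable_on {0..b}"
      using L2_on_subset[OF f, of "{0..b}"] by (intro L2_on_square_integrable) auto
    have fI: "integral {0..b} (\<lambda>x. (norm (f x))\<^sup>2) \<le> I"
      unfolding I_def using fi L2_on_square_integrable[OF f] by (intro integral_subset_le) auto
    note P = primitive_norm_square[OF pg, of b]
    have "r * integral {0..b} (\<lambda>x. (norm (g x))\<^sup>2) - integral {0..b} (\<lambda>x. (norm (f x))\<^sup>2) / r
        = integral {0..b} (\<lambda>x. r * (norm (g x))\<^sup>2 - (norm (f x))\<^sup>2 / r)"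
      using gi fi by (simp add: Henstock_Kurzweil_Integration.integral_diff integrable_on_mult_right integrable_on_divide)
    also have "\<dots> \<le> integral {0..b} (\<lambda>x. 2 * Re ((\<kappa> * g x - f x) * cnj (g x)))"
    proof (rule integral_le)
      show "(\<lambda>x. r * (norm (g x))\<^sup>2 - (norm (f x))\<^sup>2 / r) integrable_on {0..b}"
        using gi fi by (intro integrable_diff integrable_on_mult_right integrable_on_divide)
      show "(\<lambda>x. 2 * Re ((\<kappa> * g x - f x) * cnj (g x))) integrable_on {0..b}"
        using primitive_integrable[OF P] by (rule absolutely_integrable_on_Icc_imp_integrable)
      fix x
      have "2 * Re ((\<kappa> * g x - f x) * cnj (g x)) = 2 * r * (norm (g x))\<^sup>2 - 2 * Re (f x * cnj (g x))"
        unfolding left_diff_distrib minus_complex.simps Re_mult_norm_square r_def by simp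
      then show "r * (norm (g x))\<^sup>2 - (norm (f x))\<^sup>2 / r \<le> 2 * Re ((\<kappa> * g x - f x) * cnj (g x))"
        using young_inequality_Re[OF r, of "f x" "g x"] by linarith
    qed
    also have "\<dots> = (norm (g b))\<^sup>2 - (norm (g 0))\<^sup>2" using primitive_eq[OF P, of b] b by simp
    also have "\<dots> \<le> (norm (g b))\<^sup>2" by simp
    also have "\<dots> \<le> I / (2 * r)"
    proof -
      have "(norm (g b))\<^sup>2 \<le> (sqrt (I / (2 * r)))\<^sup>2"
        using tail_transform_bound[OF b] unfolding g_def r_def I_def by (intro power_mono) auto
      then show ?thesis using I r by simp
    qed
    finally have "r * integral {0..b} (\<lambda>x. (norm (g x))\<^sup>2) \<le> I / (2 * r) + I / r"
      using fI r divide_right_mono[OF fI, of r] by linarith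
    also have "\<dots> \<le> r * (2 * I / r\<^sup>2)" using I r by (simp add: power2_eq_square field_simps)
    finally show ?thesis using r by (simp only: mult_le_cancel_left_pos)
  qed
  note L2_on_half_line[OF primitive_all_continuous[OF pg] this]
  then show "L2_on {0..} (tail_transform \<kappa> f)"
    "integral {0..} (\<lambda>x. (norm (tail_transform \<kappa> f x))\<^sup>2) \<le> 2 * integral {0..} (\<lambda>t. (norm (f t))\<^sup>2) / (Re \<kappa>)\<^sup>2"
    unfolding g_def r_def I_def by auto
qed

text \<open>Beyond \<open>b\<close> the defect \<open>D = u' + \<kappa> u - g\<close> solves
  \<open>D' = \<kappa> D\<close>, so |D| cannot decrease. Being square integrable it must vanish.
  Thus a second-order equation becomes a first-order one whose right side depends on
  \<open>f\<close> alone.\<close>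

lemma edge_sol_outer:
  assumes e: "edge_sol V f u u'" and V: "\<And>x. b < x \<Longrightarrow> V x = \<kappa>\<^sup>2" and b: "0 \<le> b" and x: "b \<le> x"
  shows "u' x + \<kappa> * u x = tail_transform \<kappa> f x"
proof -
  define g where "g = tail_transform \<kappa> f"
  define D where "D y = u' y + \<kappa> * u y - g y" for y
  let ?d = "\<lambda>y. V y * u y - f y + \<kappa> * u' y - (\<kappa> * g y - f y)"
  have pD: "primitive c D ?d" for c
  proof -
    have "primitive c (\<lambda>y. - g y) (\<lambda>y. - (\<kappa> * g y - f y))"
      unfolding g_def by (rule primitive_uminus[OF tail_transform_primitive])
    moreover have "primitive c (\<lambda>y. \<kappa> * u y) (\<lambda>y. \<kappa> * u' y)"
      using e by (intro primitive_cmult) (auto simp: edge_sol_def)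
    ultimately have "primitive c (\<lambda>y. u' y + \<kappa> * u y + - g y) (\<lambda>y. V y * u y - f y + \<kappa> * u' y + - (\<kappa> * g y - f y))"
      using e by (intro primitive_add) (auto simp: edge_sol_def)
    then show ?thesis by (simp add: D_def[abs_def])
  qed
  define E where "E y = exp (- \<kappa> * complex_of_real y) * D y" for y
  have pE: "primitive c E (\<lambda>y. - \<kappa> * exp (- \<kappa> * complex_of_real y) * D y + exp (- \<kappa> * complex_of_real y) * ?d y)" for c
    unfolding E_def by (rule primitive_mult[OF primitive_exp pD])
  have E: "E y = E b" if "b \<le> y" for y
  proof -
    have "integral {b..y} (\<lambda>y. - \<kappa> * exp (- \<kappa> * complex_of_real y) * D y + exp (- \<kappa> * complex_of_real y) * ?d y)
        = integral {b..y} (\<lambda>_. 0)"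
    proof (rule integral_spike[of "{b}"])
      fix z assume "z \<in> {b..y} - {b}"
      then have "?d z = \<kappa> * D z" by (simp add: D_def V power2_eq_square algebra_simps)
      then show "0 = - \<kappa> * exp (- \<kappa> * complex_of_real z) * D z + exp (- \<kappa> * complex_of_real z) * ?d z" by simp
    qed simp
    then show ?thesis using primitive_increment[OF pE b that order_refl] by simp
  qed
  have grow: "norm (D b) \<le> norm (D y)" if "b \<le> y" for y
  proof -
    have D: "D z = exp (\<kappa> * complex_of_real z) * E z" for z
      by (simp add: E_def mult.assoc[symmetric] exp_add[symmetric])
    have "norm (D b) = exp (Re \<kappa> * b) * norm (E b)" by (simp add: D norm_mult norm_exp_of_real)
    also have "\<dots> \<le> exp (Re \<kappa> * y) * norm (E b)" using \<kappa> that by (intro mult_right_mono) auto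
    also have "\<dots> = norm (D y)" using E[OF that] by (simp add: D norm_mult norm_exp_of_real)
    finally show ?thesis .
  qed
  have "L2_on {0..} D"
    unfolding D_def g_def using e tail_transform_L2 by (intro L2_on_diff L2_on_add L2_on_cmult) (auto simp: edge_sol_def)
  then have Di: "(\<lambda>x. (norm (D x))\<^sup>2) integrable_on {0..}" by (rule L2_on_square_integrable) simp
  have "D b = 0"
  proof (rule ccontr)
    assume "D b \<noteq> 0"
    then obtain y where "b \<le> y" "(norm (D y))\<^sup>2 < (norm (D b))\<^sup>2"
      using integrable_function_small_somewhere[of "\<lambda>x. (norm (D x))\<^sup>2" "(norm (D b))\<^sup>2" b] Di by auto
    then show False using power_mono[OF grow[OF \<open>b \<le> y\<close>] norm_ge_zero, of 2] by linarith
  qed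
  then have "E x = 0" using E[OF x] by (simp add: E_def)
  then show ?thesis by (simp add: E_def D_def g_def)
qed

end

text \<open>The same energy argument for \<open>u' + \<kappa> u = G\<close>. Here the term |u(b)|^2
  at the cut-off has the favourable sign, and only |u(0)|^2 is left.\<close>

lemma damped_first_order_L2:
  fixes u u' :: "real \<Rightarrow> complex"
  assumes \<kappa>: "0 < Re \<kappa>" and u: "\<And>b. primitive b u u'" and u': "continuous_on {0..} u'"
    and G: "L2_on {0..} (\<lambda>x. u' x + \<kappa> * u x)"
  shows "L2_on {0..} u"
proof -
  define r where "r = Re \<kappa>"
  have r: "0 < r" using \<kappa> by (simp add: r_def)
  define G where "G x = u' x + \<kappa> * u x" for x
  note G' = G[folded G_def]
  define I where "I = integral {0..} (\<lambda>t. (norm (G t))\<^sup>2)"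
  have "integral {0..b} (\<lambda>x. (norm (u x))\<^sup>2) \<le> ((norm (u 0))\<^sup>2 + I / r) / r" if b: "0 \<le> b" for b
  proof -
    have ui: "(\<lambda>x. (norm (u x))\<^sup>2) integrable_on {0..b}"
      using primitive_continuous[OF u] by (intro integrable_continuous_real continuous_intros)
    have Gi: "(\<lambda>x. (norm (G x))\<^sup>2) integrable_on {0..b}"
      using L2_on_subset[OF G', of "{0..b}"] by (intro L2_on_square_integrable) auto
    have GI: "integral {0..b} (\<lambda>x. (norm (G x))\<^sup>2) \<le> I"
      unfolding I_def using Gi L2_on_square_integrable[OF G'] by (intro integral_subset_le) auto
    note P = primitive_norm_square[OF u, of b]
    have "(norm (u b))\<^sup>2 - (norm (u 0))\<^sup>2 = integral {0..b} (\<lambda>x. 2 * Re (u' x * cnj (u x)))"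
      using primitive_eq[OF P, of b] b by simp
    also have "\<dots> \<le> integral {0..b} (\<lambda>x. (norm (G x))\<^sup>2 / r - r * (norm (u x))\<^sup>2)"
    proof (rule integral_le)
      show "(\<lambda>x. (norm (G x))\<^sup>2 / r - r * (norm (u x))\<^sup>2) integrable_on {0..b}"
        using ui Gi by (intro integrable_diff integrable_on_mult_right integrable_on_divide)
      show "(\<lambda>x. 2 * Re (u' x * cnj (u x))) integrable_on {0..b}"
        using primitive_integrable[OF P] by (rule absolutely_integrable_on_Icc_imp_integrable)
      fix x
      have "u' x * cnj (u x) = G x * cnj (u x) - \<kappa> * u x * cnj (u x)" by (simp add: G_def algebra_simps)
      then have "2 * Re (u' x * cnj (u x)) = 2 * Re (G x * cnj (u x)) - 2 * r * (norm (u x))\<^sup>2"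
        unfolding r_def by (simp only: minus_complex.simps Re_mult_norm_square) simp
      then show "2 * Re (u' x * cnj (u x)) \<le> (norm (G x))\<^sup>2 / r - r * (norm (u x))\<^sup>2"
        using young_inequality_Re[OF r, of "G x" "u x"] by linarith
    qed
    also have "\<dots> = integral {0..b} (\<lambda>x. (norm (G x))\<^sup>2) / r - r * integral {0..b} (\<lambda>x. (norm (u x))\<^sup>2)"
      using ui Gi by (simp add: Henstock_Kurzweil_Integration.integral_diff integrable_on_mult_right integrable_on_divide)
    finally have "r * integral {0..b} (\<lambda>x. (norm (u x))\<^sup>2) \<le> (norm (u 0))\<^sup>2 + I / r"
      using divide_right_mono[OF GI, of r] r zero_le_power2[of "norm (u b)"] by linarith
    then show ?thesis using r by (simp add: field_simps)
  qed
  then show ?thesis by (rule L2_on_half_line[OF primitive_all_continuous[OF u]])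
qed

text \<open>The converse of \<open>edge_sol_outer\<close>: square integrability at infinity amounts
  to one linear condition at the single point \<open>b\<close>. This is what reduces the problem on
  half-lines to a finite linear system.\<close>

lemma edge_sol_if_outer_condition:
  assumes \<kappa>: "0 < Re \<kappa>" and f: "L2_on {0..} f"
    and u: "\<And>c. primitive c u u'" and u': "\<And>c. primitive c u' (\<lambda>x. V x * u x - f x)"
    and V: "\<And>x. b < x \<Longrightarrow> V x = \<kappa>\<^sup>2" and b: "0 \<le> b"
    and out: "u' b + \<kappa> * u b = tail_transform \<kappa> f b"
  shows "edge_sol V f u u'"
proof -
  define g where "g = tail_transform \<kappa> f"
  define G where "G y = u' y + \<kappa> * u y" for y
  define E where "E y = exp (- \<kappa> * complex_of_real y) * (G y + - g y)" for y
  have pG: "primitive c G (\<lambda>y. V y * u y - f y + \<kappa> * u' y)" for c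
    unfolding G_def by (rule primitive_add[OF u' primitive_cmult[OF u]])
  have pg: "primitive c (\<lambda>y. - g y) (\<lambda>y. - (\<kappa> * g y - f y))" for c
    unfolding g_def by (rule primitive_uminus[OF tail_transform_primitive[OF \<kappa> f]])
  let ?e = "\<lambda>y. - \<kappa> * exp (- \<kappa> * complex_of_real y) * (G y + - g y)
      + exp (- \<kappa> * complex_of_real y) * (V y * u y - f y + \<kappa> * u' y + - (\<kappa> * g y - f y))"
  have pE: "primitive c E ?e" for c
    unfolding E_def by (rule primitive_mult[OF primitive_exp primitive_add[OF pG pg]])
  have Gg: "G y = g y" if "b \<le> y" for y
  proof -
    have "integral {b..y} ?e = integral {b..y} (\<lambda>_. 0)"
      \<comment> \<open>The potential is prescribed strictly beyond \<open>b\<close> only, so the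
        single point \<open>b\<close> is discarded as a null set.\<close>
      by (rule integral_spike[of "{b}"]) (auto simp: G_def V power2_eq_square algebra_simps)
    then have "E y = E b" using primitive_increment[OF pE b that order_refl] by simp
    then show ?thesis using out by (simp add: E_def G_def g_def)
  qed
  have cG: "continuous_on {0..} G" using pG by (rule primitive_all_continuous)
  have gL: "L2_on {0..} g" unfolding g_def using \<kappa> f by (rule tail_transform_L2)
  have "L2_on {0..} G"
  proof (rule L2_on_half_line[OF cG])
    fix c :: real assume c: "0 \<le> c"
    have ci: "(\<lambda>x. (norm (G x))\<^sup>2) integrable_on {0..c}" for c
      using continuous_on_subset[OF cG, of "{0..c}"] by (intro integrable_continuous_real continuous_intros) auto
    have nn: "0 \<le> integral {0..b} (\<lambda>x. (norm (G x))\<^sup>2)" "0 \<le> integral {0..} (\<lambda>x. (norm (g x))\<^sup>2)"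
      using ci L2_on_square_integrable[OF gL] by (auto intro!: Henstock_Kurzweil_Integration.integral_nonneg)
    show "integral {0..c} (\<lambda>x. (norm (G x))\<^sup>2)
        \<le> integral {0..b} (\<lambda>x. (norm (G x))\<^sup>2) + integral {0..} (\<lambda>x. (norm (g x))\<^sup>2)"
    proof (cases "c \<le> b")
      case True
      then have "integral {0..c} (\<lambda>x. (norm (G x))\<^sup>2) \<le> integral {0..b} (\<lambda>x. (norm (G x))\<^sup>2)"
        using ci by (intro integral_subset_le) auto
      then show ?thesis using nn by linarith
    next
      case False
      then have "integral {0..b} (\<lambda>x. (norm (G x))\<^sup>2) + integral {b..c} (\<lambda>x. (norm (G x))\<^sup>2) = integral {0..c} (\<lambda>x. (norm (G x))\<^sup>2)"
        using ci b by (intro Henstock_Kurzweil_Integration.integral_combine) auto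
      moreover have "integral {b..c} (\<lambda>x. (norm (G x))\<^sup>2) = integral {b..c} (\<lambda>x. (norm (g x))\<^sup>2)"
        using Gg by (intro Henstock_Kurzweil_Integration.integral_cong) auto
      moreover have "integral {b..c} (\<lambda>x. (norm (g x))\<^sup>2) \<le> integral {0..} (\<lambda>x. (norm (g x))\<^sup>2)"
        using L2_on_square_integrable[OF gL] L2_on_square_integrable[OF L2_on_subset[OF gL, of "{b..c}"]] b
        by (intro integral_subset_le) auto
      ultimately show ?thesis by linarith
    qed
  qed
  then have GL: "L2_on {0..} (\<lambda>x. u' x + \<kappa> * u x)" unfolding G_def .
  have uL: "L2_on {0..} u"
    using \<kappa> u primitive_all_continuous[OF u'] GL by (rule damped_first_order_L2)
  have "L2_on {0..} (\<lambda>x. (u' x + \<kappa> * u x) - \<kappa> * u x)"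
    using GL uL by (intro L2_on_diff L2_on_cmult) auto
  then have "L2_on {0..} u'" by simp
  with u u' uL show ?thesis by (simp add: edge_sol_def)
qed

section \<open>The resolvent of a self-adjoint star graph\<close>

lemma edge_sol_diff:
  assumes "edge_sol V f u u'" "edge_sol V g v v'"
  shows "edge_sol V (\<lambda>x. f x - g x) (\<lambda>x. u x - v x) (\<lambda>x. u' x - v' x)"
proof -
  have "primitive b (\<lambda>x. u' x - v' x) (\<lambda>x. (V x * u x - f x) - (V x * v x - g x))" for b
    using assms by (intro primitive_diff) (auto simp: edge_sol_def)
  moreover have "(V x * u x - f x) - (V x * v x - g x) = V x * (u x - v x) - (f x - g x)" for x
    by (simp add: algebra_simps)
  moreover have "primitive b (\<lambda>x. u x - v x) (\<lambda>x. u' x - v' x)" for b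
    using assms by (intro primitive_diff) (auto simp: edge_sol_def)
  ultimately show ?thesis
    using assms by (simp add: edge_sol_def L2_on_diff)
qed

lemma edge_sol_continuous:
  assumes "edge_sol V f u u'"
  shows "continuous_on {0..} u" "continuous_on {0..} u'"
  using assms by (auto simp: edge_sol_def intro!: primitive_all_continuous)

text \<open>The bound 1 / |Im \<zeta>| for a symmetric operator, obtained from the imaginary part of
  the equation tested with \<open>u\<close>. The real potential drops out, the vertex term vanishes
  by hypothesis, and Young's inequality with weight |Im \<zeta>| absorbs half of the left side,
  which preserves the sharp constant.\<close>

lemma resolvent_a_priori:
  fixes W :: "'k \<Rightarrow> real \<Rightarrow> real" and \<zeta> :: complex
  assumes K: "finite K" and \<zeta>: "Im \<zeta> \<noteq> 0"
    and sol: "\<And>k. k \<in> K \<Longrightarrow> edge_sol (\<lambda>x. complex_of_real (W k x) - \<zeta>) (f k) (u k) (u' k)"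
    and f: "\<And>k. k \<in> K \<Longrightarrow> L2_on {0..} (f k)"
    and vertex: "Im (\<Sum>k\<in>K. u' k 0 * cnj (u k 0)) = 0"
  shows "(Im \<zeta>)\<^sup>2 * (\<Sum>k\<in>K. integral {0..} (\<lambda>x. (norm (u k x))\<^sup>2)) \<le> (\<Sum>k\<in>K. integral {0..} (\<lambda>x. (norm (f k x))\<^sup>2))"
proof -
  define c where "c = \<bar>Im \<zeta>\<bar>"
  have c: "0 < c" using \<zeta> by (simp add: c_def)
  define A where "A b = (\<Sum>k\<in>K. integral {0..b} (\<lambda>x. (norm (u k x))\<^sup>2))" for b
  define S where "S b = (\<Sum>k\<in>K. Im (u' k b * cnj (u k b)))" for b
  define F where "F = (\<Sum>k\<in>K. integral {0..} (\<lambda>x. (norm (f k x))\<^sup>2))"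
  \<comment> \<open>This dominates the boundary term at the cut-off. It is integrable, so it becomes
    small at arbitrarily large cut-offs.\<close>
  define p where "p x = (\<Sum>k\<in>K. (norm (u k x))\<^sup>2 + (norm (u' k x))\<^sup>2)" for x
  have uL: "L2_on {0..} (u k)" "L2_on {0..} (u' k)" if "k \<in> K" for k
    using sol[OF that] by (auto simp: edge_sol_def)
  have ui: "(\<lambda>x. (norm (u k x))\<^sup>2) integrable_on {0..b}" and fi: "(\<lambda>x. (norm (f k x))\<^sup>2) integrable_on {0..b}"
    if "k \<in> K" for k b
    using L2_on_square_integrable[OF L2_on_subset[OF uL(1)[OF that], of "{0..b}"]]
      L2_on_square_integrable[OF L2_on_subset[OF f[OF that], of "{0..b}"]] by auto
  have fin: "c / 2 * A b \<le> p b + F / (2 * c)" if b: "0 \<le> b" for b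
  proof -
    have edge: "c / 2 * integral {0..b} (\<lambda>x. (norm (u k x))\<^sup>2)
        \<le> - sgn (Im \<zeta>) * (Im (u' k b * cnj (u k b)) - Im (u' k 0 * cnj (u k 0)))
          + integral {0..} (\<lambda>x. (norm (f k x))\<^sup>2) / (2 * c)" if k: "k \<in> K" for k
    proof -
      let ?V = "\<lambda>x. complex_of_real (W k x) - \<zeta>"
      have pu: "primitive b (u k) (u' k)" "primitive b (u' k) (\<lambda>x. ?V x * u k x - f k x)"
        using sol[OF k] by (auto simp: edge_sol_def)
      note P = primitive_linear[OF primitive_mult[OF pu(2) primitive_linear[OF pu(1) bounded_linear_cnj]] bounded_linear_Im]
      let ?d = "\<lambda>x. Im ((?V x * u k x - f k x) * cnj (u k x) + u' k x * cnj (u' k x))"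
      \<comment> \<open>The factor \<open>- sgn (Im \<zeta>)\<close> makes the coefficient of |u|^2
        positive for either half-plane.\<close>
      have d: "- sgn (Im \<zeta>) * ?d x = c * (norm (u k x))\<^sup>2 + sgn (Im \<zeta>) * Im (f k x * cnj (u k x))" for x
      proof -
        have "?d x = - Im \<zeta> * (norm (u k x))\<^sup>2 - Im (f k x * cnj (u k x))"
          unfolding cmod_power2 by (simp add: power2_eq_square algebra_simps)
        then show ?thesis by (simp add: c_def sgn_if algebra_simps)
      qed
      have young: "- (sgn (Im \<zeta>) * Im (f k x * cnj (u k x))) \<le> (norm (f k x))\<^sup>2 / (2 * c) + c / 2 * (norm (u k x))\<^sup>2" for x
      proof -
        have "\<bar>Im (f k x * cnj (u k x))\<bar> = \<bar>Re (\<i> * f k x * cnj (u k x))\<bar>" by simp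
        then have "2 * \<bar>Im (f k x * cnj (u k x))\<bar> \<le> (norm (f k x))\<^sup>2 / c + c * (norm (u k x))\<^sup>2"
          using young_inequality_Re[OF c, of "\<i> * f k x" "u k x"] by (simp add: norm_mult)
        moreover have "- (sgn (Im \<zeta>) * Im (f k x * cnj (u k x))) \<le> \<bar>Im (f k x * cnj (u k x))\<bar>"
          using abs_ge_minus_self[of "sgn (Im \<zeta>) * Im (f k x * cnj (u k x))"]
          by (simp only: abs_mult abs_sgn_eq \<zeta> if_False mult_1)
        ultimately show ?thesis by (simp add: field_simps)
      qed
      have "c / 2 * integral {0..b} (\<lambda>x. (norm (u k x))\<^sup>2) - integral {0..b} (\<lambda>x. (norm (f k x))\<^sup>2) / (2 * c)
          = integral {0..b} (\<lambda>x. c / 2 * (norm (u k x))\<^sup>2 - (norm (f k x))\<^sup>2 / (2 * c))"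
        using ui[OF k] fi[OF k]
        by (simp add: Henstock_Kurzweil_Integration.integral_diff integrable_on_mult_right integrable_on_divide)
      also have "\<dots> \<le> integral {0..b} (\<lambda>x. - sgn (Im \<zeta>) * ?d x)"
      proof (rule integral_le)
        show "(\<lambda>x. c / 2 * (norm (u k x))\<^sup>2 - (norm (f k x))\<^sup>2 / (2 * c)) integrable_on {0..b}"
          using ui[OF k] fi[OF k] by (intro integrable_diff integrable_on_mult_right integrable_on_divide)
        show "(\<lambda>x. - sgn (Im \<zeta>) * ?d x) integrable_on {0..b}"
          using primitive_integrable[OF P] by (intro integrable_on_mult_right absolutely_integrable_on_Icc_imp_integrable)
        show "c / 2 * (norm (u k x))\<^sup>2 - (norm (f k x))\<^sup>2 / (2 * c) \<le> - sgn (Im \<zeta>) * ?d x" for x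
          unfolding d using young[of x] by linarith
      qed
      also have "\<dots> = - sgn (Im \<zeta>) * integral {0..b} ?d" by (rule integral_mult_right)
      also have "integral {0..b} ?d = Im (u' k b * cnj (u k b)) - Im (u' k 0 * cnj (u k 0))"
        using primitive_eq[OF P, of b] b by simp
      finally have "c / 2 * integral {0..b} (\<lambda>x. (norm (u k x))\<^sup>2)
        \<le> - sgn (Im \<zeta>) * (Im (u' k b * cnj (u k b)) - Im (u' k 0 * cnj (u k 0)))
          + integral {0..b} (\<lambda>x. (norm (f k x))\<^sup>2) / (2 * c)" by linarith
      moreover have "integral {0..b} (\<lambda>x. (norm (f k x))\<^sup>2) \<le> integral {0..} (\<lambda>x. (norm (f k x))\<^sup>2)"
        using fi[OF k] L2_on_square_integrable[OF f[OF k]] by (intro integral_subset_le) auto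
      then have "integral {0..b} (\<lambda>x. (norm (f k x))\<^sup>2) / (2 * c) \<le> integral {0..} (\<lambda>x. (norm (f k x))\<^sup>2) / (2 * c)"
        using c by (intro divide_right_mono) auto
      ultimately show ?thesis by linarith
    qed
    have "c / 2 * A b \<le> (\<Sum>k\<in>K. - sgn (Im \<zeta>) * (Im (u' k b * cnj (u k b)) - Im (u' k 0 * cnj (u k 0)))
          + integral {0..} (\<lambda>x. (norm (f k x))\<^sup>2) / (2 * c))"
      unfolding A_def sum_distrib_left by (intro sum_mono edge)
    also have "\<dots> = - sgn (Im \<zeta>) * (S b - S 0) + F / (2 * c)"
      unfolding S_def F_def sum.distrib sum_divide_distrib sum_distrib_left sum_subtractf[symmetric] ..
    also have "S 0 = 0" using vertex by (simp add: S_def Im_sum)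
    also have "- sgn (Im \<zeta>) * (S b - 0) \<le> \<bar>S b\<bar>"
      using abs_ge_minus_self[of "S b"] by (cases "Im \<zeta> > 0") (auto simp: sgn_if)
    also have "\<bar>S b\<bar> \<le> p b"
      unfolding S_def p_def
    proof (intro order_trans[OF sum_abs] sum_mono)
      fix k
      have "\<bar>Im (u' k b * cnj (u k b))\<bar> \<le> norm (u k b) * norm (u' k b)"
        using abs_Im_le_cmod[of "u' k b * cnj (u k b)"] by (simp add: norm_mult mult.commute)
      moreover have "0 \<le> norm (u k b) * norm (u' k b)" by simp
      ultimately show "\<bar>Im (u' k b * cnj (u k b))\<bar> \<le> (norm (u k b))\<^sup>2 + (norm (u' k b))\<^sup>2"
        using sum_squares_bound[of "norm (u k b)" "norm (u' k b)"] unfolding mult.assoc by linarith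
    qed
    finally show ?thesis by simp
  qed
  have pint: "p integrable_on {0..}"
    unfolding p_def using uL by (intro integrable_sum K integrable_add L2_on_square_integrable) auto
  have pnn: "0 \<le> p x" for x unfolding p_def by (intro sum_nonneg) auto
  \<comment> \<open>\<open>A\<close> is monotone, so it suffices to evaluate it at some
    \<open>b\<close> beyond \<open>B\<close> where the boundary term is below the given
    tolerance.\<close>
  have A: "A B \<le> F / c\<^sup>2" for B
  proof (rule field_le_epsilon)
    fix \<delta> :: real assume \<delta>: "0 < \<delta>"
    obtain b where b: "max 0 B \<le> b" "p b < c / 2 * \<delta>"
      using integrable_function_small_somewhere[OF pnn pint, of "c / 2 * \<delta>" "max 0 B"] c \<delta> by auto
    have "A B \<le> A b"
      unfolding A_def using b ui by (intro sum_mono integral_subset_le) auto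
    moreover have "c / 2 * A b \<le> c / 2 * \<delta> + F / (2 * c)" using fin[of b] b by simp
    then have "A b \<le> \<delta> + F / c\<^sup>2" using c by (simp add: field_simps power2_eq_square)
    ultimately show "A B \<le> F / c\<^sup>2 + \<delta>" by simp
  qed
  let ?s = "\<lambda>x. \<Sum>k\<in>K. (norm (u k x))\<^sup>2"
  have "integral {0..} ?s \<le> F / c\<^sup>2"
  proof (rule integrable_on_half_line(2))
    show "0 \<le> ?s x" for x by (intro sum_nonneg) auto
    show "?s integrable_on {0..b}" for b using ui by (intro integrable_sum K) auto
    show "integral {0..b} ?s \<le> F / c\<^sup>2" for b
      using A[of b] ui by (subst Henstock_Kurzweil_Integration.integral_sum) (auto simp: A_def K)
  qed
  moreover have "integral {0..} ?s = (\<Sum>k\<in>K. integral {0..} (\<lambda>x. (norm (u k x))\<^sup>2))"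
    using uL by (intro Henstock_Kurzweil_Integration.integral_sum K L2_on_square_integrable) auto
  ultimately show ?thesis
    using c by (simp add: F_def c_def field_simps)
qed

lemma L2_norm_zero_imp_zero:
  fixes u :: "real \<Rightarrow> 'a::euclidean_space"
  assumes u: "continuous_on {0..} u" "L2_on {0..} u" and 0: "integral {0..} (\<lambda>x. (norm (u x))\<^sup>2) \<le> 0"
    and x: "0 \<le> x"
  shows "u x = 0"
proof -
  let ?S = "{0..x + 1}"
  have c: "continuous_on ?S (\<lambda>x. (norm (u x))\<^sup>2)"
    by (intro continuous_intros continuous_on_subset[OF u(1)]) auto
  have "integral ?S (\<lambda>x. (norm (u x))\<^sup>2) \<le> integral {0..} (\<lambda>x. (norm (u x))\<^sup>2)"
    using c L2_on_square_integrable[OF u(2)] by (intro integral_subset_le integrable_continuous_real) auto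
  moreover have "0 \<le> integral ?S (\<lambda>x. (norm (u x))\<^sup>2)"
    using c by (intro Henstock_Kurzweil_Integration.integral_nonneg integrable_continuous_real) auto
  ultimately have "integral ?S (\<lambda>x. (norm (u x))\<^sup>2) = 0" using 0 by linarith
  then have "((\<lambda>x. (norm (u x))\<^sup>2) has_integral 0) ?S"
    using integrable_integral[OF integrable_continuous_real[OF c]] by simp
  then have "(norm (u x))\<^sup>2 = 0"
    using has_integral_0_cbox_imp_0[of 0 "x + 1" "\<lambda>x. (norm (u x))\<^sup>2" x] c x by (simp add: cbox_interval)
  then show ?thesis by simp
qed

lemma primitive_of_zero:
  assumes p: "primitive b u u'" and u': "continuous_on {0..b} u'" and u: "\<And>x. x \<in> {0..b} \<Longrightarrow> u x = 0"
    and x: "x \<in> {0..b}" and b: "0 < b"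
  shows "u' x = 0"
proof -
  have "((\<lambda>x. integral {0..x} u') has_vector_derivative u' x) (at x within {0..b})"
    using integral_has_vector_derivative[OF u' x] .
  then have "((\<lambda>_. 0) has_vector_derivative u' x) (at x within {0..b})"
  proof (rule has_vector_derivative_transform[OF x, rotated])
    fix y assume y: "y \<in> {0..b}"
    show "0 = integral {0..y} u'" using primitive_eq[OF p y] u[OF y] u[of 0] b by simp
  qed
  then show ?thesis
    using vector_derivative_unique_within_closed_interval[of 0 b x "\<lambda>_. 0" "u' x" 0] b x
    by (simp add: cbox_interval)
qed

text \<open>Vertex conditions are linear relations between the values \<open>c\<close> and the
  derivatives \<open>p\<close>, with as many rows as edges. The assumption \<open>symmetric\<close>
  says that the boundary form has no imaginary part on the admissible data. Both the approximating
  and the limit problem are instances, so one existence and uniqueness argument serves both.\<close>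

locale star_resolvent =
  fixes K :: "'k set" and R :: "'r set" and W :: "'k \<Rightarrow> real \<Rightarrow> real" and b :: "'k \<Rightarrow> real"
    and \<alpha> \<beta> :: "'r \<Rightarrow> 'k \<Rightarrow> complex" and \<zeta> \<kappa> :: complex and M :: real
  assumes finite: "finite K" "finite R" "card R = card K"
    and W_measurable: "\<And>k. k \<in> K \<Longrightarrow> W k \<in> borel_measurable (lebesgue_on {0..})"
    and W_bounded: "\<And>k x. k \<in> K \<Longrightarrow> 0 \<le> x \<Longrightarrow> \<bar>W k x\<bar> \<le> M"
    and W_support: "\<And>k x. k \<in> K \<Longrightarrow> b k < x \<Longrightarrow> W k x = 0" and b: "\<And>k. k \<in> K \<Longrightarrow> 0 \<le> b k"
    and \<zeta>: "Im \<zeta> \<noteq> 0" and \<kappa>: "0 < Re \<kappa>" "\<kappa>\<^sup>2 = - \<zeta>"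
    and symmetric: "\<And>c p. (\<And>r. r \<in> R \<Longrightarrow> (\<Sum>k\<in>K. \<alpha> r k * c k + \<beta> r k * p k) = 0) \<Longrightarrow>
      Im (\<Sum>k\<in>K. p k * cnj (c k)) = 0"
begin

definition V where "V k x = complex_of_real (W k x) - \<zeta>"

definition solution where
  "solution f u u' \<longleftrightarrow> (\<forall>k\<in>K. edge_sol (V k) (f k) (u k) (u' k)) \<and>
     (\<forall>r\<in>R. (\<Sum>k\<in>K. \<alpha> r k * u k 0 + \<beta> r k * u' k 0) = 0)"

lemma V_measurable: "k \<in> K \<Longrightarrow> V k \<in> borel_measurable (lebesgue_on {0..})"
  unfolding V_def using W_measurable by measurable

lemma V_bounded: "k \<in> K \<Longrightarrow> 0 \<le> x \<Longrightarrow> norm (V k x) \<le> M + norm \<zeta>"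
  unfolding V_def using W_bounded[of k x] norm_triangle_ineq4[of "complex_of_real (W k x)" \<zeta>] by simp

lemma V_support: "k \<in> K \<Longrightarrow> b k < x \<Longrightarrow> V k x = \<kappa>\<^sup>2"
  by (simp add: V_def W_support \<kappa>)

lemma solution_bound:
  assumes "solution f u u'" "\<And>k. k \<in> K \<Longrightarrow> L2_on {0..} (f k)"
  shows "(Im \<zeta>)\<^sup>2 * (\<Sum>k\<in>K. integral {0..} (\<lambda>x. (norm (u k x))\<^sup>2)) \<le> (\<Sum>k\<in>K. integral {0..} (\<lambda>x. (norm (f k x))\<^sup>2))"
proof (rule resolvent_a_priori[of K \<zeta> W f u u'])
  show "edge_sol (\<lambda>x. complex_of_real (W k x) - \<zeta>) (f k) (u k) (u' k)" if "k \<in> K" for k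
    using assms(1) that unfolding solution_def V_def[abs_def] by blast
  show "Im (\<Sum>k\<in>K. u' k 0 * cnj (u k 0)) = 0"
    using assms(1) by (intro symmetric) (auto simp: solution_def)
qed (use finite \<zeta> assms(2) in auto)

text \<open>The derivative is included because the linear system for existence has the full Cauchy
  data at the vertex as unknowns.\<close>

lemma solution_of_zero:
  assumes s: "solution f u u'" and f: "\<And>k x. k \<in> K \<Longrightarrow> 0 \<le> x \<Longrightarrow> f k x = 0" and k: "k \<in> K" and x: "0 \<le> x"
  shows "u k x = 0" "u' k x = 0"
proof -
  have f0: "L2_on {0..} (f k)" if "k \<in> K" for k
  proof (rule L2_onI)
    show "f k \<in> borel_measurable (lebesgue_on {0..})"
      by (subst measurable_cong[where g = "\<lambda>_. 0"]) (use f that in auto)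
    show "(\<lambda>_ :: real. 0 :: real) integrable_on {0..}" by (rule integrable_0)
  qed (use f that in auto)
  have "integral {0..} (\<lambda>x. (norm (f k x))\<^sup>2) = 0" if "k \<in> K" for k
    using f[OF that] Henstock_Kurzweil_Integration.integral_cong[of "{0..}" "\<lambda>x. (norm (f k x))\<^sup>2" "\<lambda>_. 0"] by simp
  then have "(Im \<zeta>)\<^sup>2 * (\<Sum>k\<in>K. integral {0..} (\<lambda>x. (norm (u k x))\<^sup>2)) \<le> 0"
    using solution_bound[OF s f0] by simp
  then have le: "(\<Sum>k\<in>K. integral {0..} (\<lambda>x. (norm (u k x))\<^sup>2)) \<le> 0"
    using \<zeta> by (simp add: mult_le_0_iff)
  have e: "edge_sol (V k) (f k) (u k) (u' k)" using s k by (simp add: solution_def)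
  have nn: "0 \<le> integral {0..} (\<lambda>x. (norm (u k x))\<^sup>2)" if "k \<in> K" for k
    using s that by (intro Henstock_Kurzweil_Integration.integral_nonneg L2_on_square_integrable)
      (auto simp: solution_def edge_sol_def)
  have "integral {0..} (\<lambda>x. (norm (u k x))\<^sup>2) \<le> 0"
    using le member_le_sum[of k K "\<lambda>k. integral {0..} (\<lambda>x. (norm (u k x))\<^sup>2)"] nn k finite(1) by auto
  then have u0: "u k y = 0" if "0 \<le> y" for y
    using e that by (intro L2_norm_zero_imp_zero[of "u k" y] edge_sol_continuous[OF e]) (auto simp: edge_sol_def)
  then show "u k x = 0" using x by simp
  show "u' k x = 0"
    using e u0 x by (intro primitive_of_zero[of "x + 1" "u k" "u' k" x]
      continuous_on_subset[OF edge_sol_continuous(2)[OF e]]) (auto simp: edge_sol_def)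
qed

lemma solution_unique:
  assumes s: "solution f u u'" "solution f v v'" and k: "k \<in> K" and x: "0 \<le> x"
  shows "u k x = v k x"
proof -
  have sums: "(\<Sum>k\<in>K. \<alpha> r k * (u k 0 - v k 0) + \<beta> r k * (u' k 0 - v' k 0)) =
      (\<Sum>k\<in>K. \<alpha> r k * u k 0 + \<beta> r k * u' k 0) - (\<Sum>k\<in>K. \<alpha> r k * v k 0 + \<beta> r k * v' k 0)" for r
    unfolding sum_subtractf[symmetric] by (intro sum.cong) (auto simp: algebra_simps)
  have "solution (\<lambda>k x. f k x - f k x) (\<lambda>k x. u k x - v k x) (\<lambda>k x. u' k x - v' k x)"
    unfolding solution_def
  proof (intro conjI ballI)
    fix k assume "k \<in> K"
    then show "edge_sol (V k) (\<lambda>x. f k x - f k x) (\<lambda>x. u k x - v k x) (\<lambda>x. u' k x - v' k x)"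
      using s by (intro edge_sol_diff) (auto simp: solution_def)
  qed (use s sums in \<open>simp add: solution_def\<close>)
  from solution_of_zero(1)[OF this _ k x] show ?thesis by simp
qed

text \<open>The unknowns are the value and the derivative at the vertex on each edge. The equations
  are the vertex conditions and, for each edge, the outer condition that encodes square
  integrability. The counts agree, and a kernel vector yields a solution for zero data, so the
  system is injective and hence solvable.\<close>

lemma solution_exists:
  assumes f: "\<And>k. k \<in> K \<Longrightarrow> L2_on {0..} (f k)"
  shows "\<exists>u u'. solution f u u'"
proof -
  define ivp where "ivp g k c p U U' \<longleftrightarrow> U 0 = c \<and> U' 0 = p \<and>
    (\<forall>b. primitive b U U' \<and> primitive b U' (\<lambda>x. V k x * U x - g x))" for g k c p U U'
  have ex: "\<exists>U U'. ivp g k c p U U'" if "k \<in> K" "L2_on {0..} g" for g k c p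
    unfolding ivp_def using that V_measurable V_bounded by (intro second_order_equation_exists) auto
  have z: "L2_on {0..} (\<lambda>_. 0 :: complex)" by (simp add: L2_on_def)
  define sel where "sel g k c p = (SOME q. ivp g k c p (fst q) (snd q))" for g k c p
  have sel: "ivp g k c p (fst (sel g k c p)) (snd (sel g k c p))" if "k \<in> K" "L2_on {0..} g" for g k c p
    unfolding sel_def using ex[OF that, of c p] by (rule_tac someI_ex) auto
  \<comment> \<open>\<open>C\<close> and \<open>S\<close> form the fundamental system of the edge
    with unit Cauchy data at the vertex; \<open>P\<close> below is the particular solution with zero
    Cauchy data.\<close>
  define C C' where "C k = fst (sel (\<lambda>_. 0) k 1 0)" and "C' k = snd (sel (\<lambda>_. 0) k 1 0)" for k
  define S S' where "S k = fst (sel (\<lambda>_. 0) k 0 1)" and "S' k = snd (sel (\<lambda>_. 0) k 0 1)" for k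
  define P P' where "P k = fst (sel (f k) k 0 0)" and "P' k = snd (sel (f k) k 0 0)" for k
  have C: "ivp (\<lambda>_. 0) k 1 0 (C k) (C' k)" and S: "ivp (\<lambda>_. 0) k 0 1 (S k) (S' k)"
    and P: "ivp (f k) k 0 0 (P k) (P' k)" if "k \<in> K" for k
    unfolding C_def C'_def S_def S'_def P_def P'_def using sel[OF that] z f[OF that] by blast+
  define out where "out k U U' = U' (b k) + \<kappa> * U (b k)" for k and U U' :: "real \<Rightarrow> complex"
  \<comment> \<open>Rows \<open>Inl r\<close> are vertex conditions and rows \<open>Inr j\<close>
    outer conditions. Column \<open>(k, False)\<close> carries the value and column
    \<open>(k, True)\<close> the derivative at the vertex of edge \<open>k\<close>.\<close>
  define A where "A row col = (case (row, col) of
      (Inl r, (k, i)) \<Rightarrow> if i then \<beta> r k else \<alpha> r k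
    | (Inr j, (k, i)) \<Rightarrow> if j \<noteq> k then 0 else if i then out k (S k) (S' k) else out k (C k) (C' k))"
    for row :: "'r + 'k" and col :: "'k \<times> bool"
  let ?cols = "K \<times> (UNIV :: bool set)" and ?rows = "R <+> K"
  have row: "(\<Sum>col\<in>?cols. A row col * z col) = (\<Sum>k\<in>K. A row (k, False) * z (k, False) + A row (k, True) * z (k, True))" for row z
    unfolding sum.cartesian_product[symmetric, where g = "\<lambda>k i. A row (k, i) * z (k, i)", simplified split_def prod.collapse]
    by (simp add: UNIV_bool add.commute)
  have rowl: "(\<Sum>col\<in>?cols. A (Inl r) col * z col) = (\<Sum>k\<in>K. \<alpha> r k * z (k, False) + \<beta> r k * z (k, True))" for r z
    unfolding row by (simp add: A_def)
  have rowr: "(\<Sum>col\<in>?cols. A (Inr j) col * z col) = out j (C j) (C' j) * z (j, False) + out j (S j) (S' j) * z (j, True)"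
    if "j \<in> K" for j z
  proof -
    have "(\<Sum>col\<in>?cols. A (Inr j) col * z col)
        = (\<Sum>k\<in>K. if j = k then out j (C j) (C' j) * z (j, False) + out j (S j) (S' j) * z (j, True) else 0)"
      unfolding row by (intro sum.cong) (auto simp: A_def)
    then show ?thesis using that finite(1) by simp
  qed
  \<comment> \<open>The parameter \<delta> scales the datum: 0 gives the homogeneous problem used
    for injectivity, 1 the problem to be solved. One verification covers both.\<close>
  define u where "u z \<delta> k x = z (k, False) * C k x + z (k, True) * S k x + \<delta> * P k x"
    for z :: "'k \<times> bool \<Rightarrow> complex" and \<delta> :: complex and k x
  define u' where "u' z \<delta> k x = z (k, False) * C' k x + z (k, True) * S' k x + \<delta> * P' k x"
    for z :: "'k \<times> bool \<Rightarrow> complex" and \<delta> :: complex and k x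
  have u0: "u z \<delta> k 0 = z (k, False)" "u' z \<delta> k 0 = z (k, True)" if "k \<in> K" for z \<delta> k
    using C[OF that] S[OF that] P[OF that] by (simp_all add: u_def u'_def ivp_def)
  have outu: "out k (u z \<delta> k) (u' z \<delta> k) = out k (C k) (C' k) * z (k, False) + out k (S k) (S' k) * z (k, True) + \<delta> * out k (P k) (P' k)" for z \<delta> k
    by (simp add: out_def u_def u'_def algebra_simps)
  have sol: "solution (\<lambda>k x. \<delta> * f k x) (u z \<delta>) (u' z \<delta>)"
    if r: "\<And>r. r \<in> R \<Longrightarrow> (\<Sum>col\<in>?cols. A (Inl r) col * z col) = 0"
      and j: "\<And>k. k \<in> K \<Longrightarrow> (\<Sum>col\<in>?cols. A (Inr k) col * z col) = tail_transform \<kappa> (\<lambda>x. \<delta> * f k x) (b k) - \<delta> * out k (P k) (P' k)"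
    for z \<delta>
  proof -
    have "edge_sol (V k) (\<lambda>x. \<delta> * f k x) (u z \<delta> k) (u' z \<delta> k)" if k: "k \<in> K" for k
    proof (rule edge_sol_if_outer_condition[OF \<kappa>(1) _ _ _ V_support[OF k] b[OF k]])
      show "L2_on {0..} (\<lambda>x. \<delta> * f k x)" using f[OF k] by (intro L2_on_cmult) auto
      have p: "primitive c (C k) (C' k)" "primitive c (C' k) (\<lambda>x. V k x * C k x - 0)"
        "primitive c (S k) (S' k)" "primitive c (S' k) (\<lambda>x. V k x * S k x - 0)"
        "primitive c (P k) (P' k)" "primitive c (P' k) (\<lambda>x. V k x * P k x - f k x)" for c
        using C[OF k] S[OF k] P[OF k] unfolding ivp_def by blast+
      show "primitive c (u z \<delta> k) (u' z \<delta> k)" for c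
        unfolding u_def u'_def by (rule primitive_add[OF primitive_add[OF primitive_cmult[OF p(1)] primitive_cmult[OF p(3)]] primitive_cmult[OF p(5)]])
      have "primitive c (u' z \<delta> k) (\<lambda>x. z (k, False) * (V k x * C k x - 0) + z (k, True) * (V k x * S k x - 0) + \<delta> * (V k x * P k x - f k x))" for c
        unfolding u'_def by (rule primitive_add[OF primitive_add[OF primitive_cmult[OF p(2)] primitive_cmult[OF p(4)]] primitive_cmult[OF p(6)]])
      moreover have "z (k, False) * (V k x * C k x - 0) + z (k, True) * (V k x * S k x - 0) + \<delta> * (V k x * P k x - f k x)
          = V k x * u z \<delta> k x - \<delta> * f k x" for x
        by (simp add: u_def algebra_simps)
      ultimately show "primitive c (u' z \<delta> k) (\<lambda>x. V k x * u z \<delta> k x - \<delta> * f k x)" for c by simp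
      show "u' z \<delta> k (b k) + \<kappa> * u z \<delta> k (b k) = tail_transform \<kappa> (\<lambda>x. \<delta> * f k x) (b k)"
        using j[OF k] rowr[OF k, of z] outu[of k z \<delta>] by (simp add: out_def)
    qed
    moreover have "(\<Sum>k\<in>K. \<alpha> r k * u z \<delta> k 0 + \<beta> r k * u' z \<delta> k 0) = 0" if "r \<in> R" for r
    proof -
      have "(\<Sum>k\<in>K. \<alpha> r k * u z \<delta> k 0 + \<beta> r k * u' z \<delta> k 0) = (\<Sum>k\<in>K. \<alpha> r k * z (k, False) + \<beta> r k * z (k, True))"
        using u0 by (intro sum.cong) auto
      then show ?thesis using r[OF that] rowl by simp
    qed
    ultimately show ?thesis by (simp add: solution_def)
  qed
  have inj: "\<forall>c\<in>?cols. z c = 0" if z: "\<forall>r\<in>?rows. (\<Sum>c\<in>?cols. A r c * z c) = 0" for z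
  proof -
    have "solution (\<lambda>k x. 0 * f k x) (u z 0) (u' z 0)"
    proof (rule sol)
      show "(\<Sum>col\<in>?cols. A (Inl r) col * z col) = 0" if "r \<in> R" for r
        by (rule bspec[OF z]) (use that in auto)
      show "(\<Sum>col\<in>?cols. A (Inr k) col * z col) = tail_transform \<kappa> (\<lambda>x. 0 * f k x) (b k) - 0 * out k (P k) (P' k)"
        if "k \<in> K" for k
        using bspec[OF z, of "Inr k"] that by (simp add: tail_transform_def InrI)
    qed
    note zero = solution_of_zero[OF this]
    have "z (k, i) = 0" if "k \<in> K" for k i
      using zero[OF _ that, of 0] u0[OF that, of z 0] by (cases i) auto
    then show ?thesis by auto
  qed
  have "\<exists>z. \<forall>r\<in>?rows. (\<Sum>c\<in>?cols. A r c * z c)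
      = (case r of Inl _ \<Rightarrow> 0 | Inr k \<Rightarrow> tail_transform \<kappa> (f k) (b k) - out k (P k) (P' k))"
    by (rule injective_square_system_solvable) (use finite inj in \<open>auto simp: card_Plus card_cartesian_product\<close>)
  then obtain z where z: "\<forall>r\<in>?rows. (\<Sum>c\<in>?cols. A r c * z c)
      = (case r of Inl _ \<Rightarrow> 0 | Inr k \<Rightarrow> tail_transform \<kappa> (f k) (b k) - out k (P k) (P' k))" ..
  have "solution (\<lambda>k x. 1 * f k x) (u z 1) (u' z 1)"
  proof (rule sol)
    show "(\<Sum>col\<in>?cols. A (Inl r) col * z col) = 0" if "r \<in> R" for r
      using bspec[OF z, of "Inl r"] that by auto
    show "(\<Sum>col\<in>?cols. A (Inr k) col * z col) = tail_transform \<kappa> (\<lambda>x. 1 * f k x) (b k) - 1 * out k (P k) (P' k)"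
      if "k \<in> K" for k
      using bspec[OF z, of "Inr k"] that by auto
  qed
  then show ?thesis by auto
qed

end

section \<open>The zero-energy problem on the compact star\<close>

text \<open>By \<open>\<psi>_span\<close> and \<open>\<psi>_delta\<close> a zero mode is determined
  by its values at the ends \<open>a 1\<close>, ..., \<open>a m\<close>. This is the injectivity
  behind \<open>stability\<close>.\<close>

locale neumann_star =
  fixes n m :: nat and a :: "nat \<Rightarrow> real" and Q :: "nat \<Rightarrow> real \<Rightarrow> real" and B :: real
    and \<psi> :: "nat \<Rightarrow> nat \<Rightarrow> real \<Rightarrow> real"
  assumes n: "1 \<le> n" and m: "m \<le> n" and a: "\<And>k. k \<in> {1..n} \<Longrightarrow> 0 < a k"
    and Q_meas: "\<And>k. k \<in> {1..n} \<Longrightarrow> Q k \<in> borel_measurable (lebesgue_on {0..})"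
    and Q_bdd: "\<And>k x. k \<in> {1..n} \<Longrightarrow> 0 \<le> x \<Longrightarrow> \<bar>Q k x\<bar> \<le> B"
    and \<psi>_sol: "\<And>i. i \<in> {1..m} \<Longrightarrow> solves_R n a Q (\<psi> i)"
    and \<psi>_span: "\<And>\<phi>. solves_R n a Q \<phi> \<Longrightarrow>
      \<exists>c::nat \<Rightarrow> real. \<forall>k\<in>{1..n}. \<forall>x\<in>{0..a k}. \<phi> k x = (\<Sum>i\<in>{1..m}. c i * \<psi> i k x)"
    and \<psi>_delta: "\<And>i j. i \<in> {1..m} \<Longrightarrow> j \<in> {1..m} \<Longrightarrow> \<psi> i j (a j) = (if i = j then 1 else 0)"
begin

lemma B_nonneg: "0 \<le> B"
  using Q_bdd[of 1 0] n by auto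

lemma Q_mult_integrable:
  fixes h :: "real \<Rightarrow> complex"
  assumes "k \<in> {1..n}" "h absolutely_integrable_on {0..b}"
  shows "(\<lambda>x. complex_of_real (Q k x) * h x) absolutely_integrable_on {0..b}"
proof (rule absolutely_integrable_mult_bounded[OF assms(2), where K = B])
  have "Q k \<in> borel_measurable (lebesgue_on {0..b})"
    by (rule measurable_restrict_mono[OF Q_meas[OF assms(1)]]) auto
  then show "(\<lambda>x. complex_of_real (Q k x)) \<in> borel_measurable (lebesgue_on {0..b})" by measurable
qed (use Q_bdd[OF assms(1)] in auto)

definition zero_mode_derivs where
  "zero_mode_derivs \<phi> \<phi>' \<longleftrightarrow> (\<forall>k\<in>{1..n}. primitive (a k) (\<phi> k) (\<phi>' k) \<and>
      primitive (a k) (\<phi>' k) (\<lambda>x. Q k x * \<phi> k x)) \<and>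
     (\<forall>k\<in>{1..n}. \<phi> k 0 = \<phi> 1 0) \<and> (\<Sum>k\<in>{1..n}. \<phi>' k 0) = 0 \<and> (\<forall>k\<in>{1..n}. \<phi>' k (a k) = 0)"

lemma solves_R_iff: "solves_R n a Q \<phi> \<longleftrightarrow> (\<exists>\<phi>'. zero_mode_derivs \<phi> \<phi>')"
proof
  assume "solves_R n a Q \<phi>"
  then obtain \<phi>' \<phi>'' where H: "\<And>k. k \<in> {1..n} \<Longrightarrow> H2_on {0..a k} (\<phi> k) (\<phi>' k) (\<phi>'' k)"
    and ae: "\<And>k. k \<in> {1..n} \<Longrightarrow> AE x in lebesgue_on {0..a k}. - \<phi>'' k x + Q k x * \<phi> k x = 0"
    and bc: "\<forall>k\<in>{1..n}. \<phi> k 0 = \<phi> 1 0" "(\<Sum>k\<in>{1..n}. \<phi>' k 0) = 0" "\<forall>k\<in>{1..n}. \<phi>' k (a k) = 0"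
    unfolding solves_R_def by blast
  have "primitive (a k) (\<phi> k) (\<phi>' k)" "primitive (a k) (\<phi>' k) (\<lambda>x. Q k x * \<phi> k x)" if k: "k \<in> {1..n}" for k
  proof -
    note p = H2_on_primitive[OF H[OF k] order_refl]
    show "primitive (a k) (\<phi> k) (\<phi>' k)" by (rule p) simp
    obtain N where N: "negligible N" "\<forall>x\<in>{0..a k} - N. - \<phi>'' k x + Q k x * \<phi> k x = 0"
      using ae[OF k] by (subst (asm) AE_lebesgue_on_iff_negligible) auto
    show "primitive (a k) (\<phi>' k) (\<lambda>x. Q k x * \<phi> k x)"
      by (rule primitive_cong[OF p(2) N(1)]) (use N(2) a[OF k] in auto)
  qed
  with bc show "\<exists>\<phi>'. zero_mode_derivs \<phi> \<phi>'" unfolding zero_mode_derivs_def by blast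
next
  assume "\<exists>\<phi>'. zero_mode_derivs \<phi> \<phi>'"
  then obtain \<phi>' where z: "zero_mode_derivs \<phi> \<phi>'" ..
  have "H2_on {0..a k} (\<phi> k) (\<phi>' k) (\<lambda>x. Q k x * \<phi> k x)" if k: "k \<in> {1..n}" for k
  proof -
    have p: "primitive (a k) (\<phi> k) (\<phi>' k)" "primitive (a k) (\<phi>' k) (\<lambda>x. Q k x * \<phi> k x)"
      using z k by (auto simp: zero_mode_derivs_def)
    have L: "L2_on {0..a k} (\<phi> k)" "L2_on {0..a k} (\<phi>' k)"
      using p by (auto intro: L2_on_continuous primitive_continuous)
    have "Q k \<in> borel_measurable (lebesgue_on {0..a k})"
      by (rule measurable_restrict_mono[OF Q_meas[OF k]]) auto
    then have "L2_on {0..a k} (\<lambda>x. Q k x * \<phi> k x)"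
      using L(1) Q_bdd[OF k] by (intro L2_on_mult_bounded[where K = B]) auto
    with L show ?thesis
      unfolding H2_on_def using primitive_eq[OF p(1)] primitive_eq[OF p(2)] by blast
  qed
  note H2 = this
  have bc: "\<forall>k\<in>{1..n}. \<phi> k 0 = \<phi> 1 0" "(\<Sum>k\<in>{1..n}. \<phi>' k 0) = 0" "\<forall>k\<in>{1..n}. \<phi>' k (a k) = 0"
    using z unfolding zero_mode_derivs_def by blast+
  show "solves_R n a Q \<phi>"
    unfolding solves_R_def
  proof (rule exI[of _ \<phi>'], rule exI[of _ "\<lambda>k x. Q k x * \<phi> k x"], intro conjI bc)
    show "\<forall>k\<in>{1..n}. H2_on {0..a k} (\<phi> k) (\<phi>' k) (\<lambda>x. Q k x * \<phi> k x)" using H2 by blast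
    show "\<forall>k\<in>{1..n}. AE x in lebesgue_on {0..a k}. - (Q k x * \<phi> k x) + Q k x * \<phi> k x = 0" by simp
  qed
qed

definition \<psi>' where "\<psi>' i = (SOME \<phi>'. zero_mode_derivs (\<psi> i) \<phi>')"

lemma \<psi>': "i \<in> {1..m} \<Longrightarrow> zero_mode_derivs (\<psi> i) (\<psi>' i)"
  unfolding \<psi>'_def using \<psi>_sol[unfolded solves_R_iff] by (rule someI_ex)

lemma \<psi>_primitive:
  assumes "i \<in> {1..m}" "k \<in> {1..n}"
  shows "primitive (a k) (\<psi> i k) (\<psi>' i k)" "primitive (a k) (\<psi>' i k) (\<lambda>x. Q k x * \<psi> i k x)"
  using \<psi>'[OF assms(1)] assms(2) by (auto simp: zero_mode_derivs_def)

lemma \<psi>_bounded: "\<exists>P\<ge>0. \<forall>i\<in>{1..m}. \<forall>k\<in>{1..n}. \<forall>x\<in>{0..a k}. \<bar>\<psi> i k x\<bar> \<le> P"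
proof -
  have "\<exists>p. \<forall>x\<in>{0..a k}. \<bar>\<psi> i k x\<bar> \<le> p" if "i \<in> {1..m}" "k \<in> {1..n}" for i k
  proof -
    have "compact (\<psi> i k ` {0..a k})"
      using primitive_continuous[OF \<psi>_primitive(1)[OF that]] by (intro compact_continuous_image) auto
    from compact_imp_bounded[OF this, unfolded bounded_iff] show ?thesis by auto
  qed
  then have "\<forall>z\<in>{1..m} \<times> {1..n}. \<exists>p. \<forall>x\<in>{0..a (snd z)}. \<bar>\<psi> (fst z) (snd z) x\<bar> \<le> p" by auto
  from bchoice[OF this] obtain p where p: "\<forall>z\<in>{1..m} \<times> {1..n}. \<forall>x\<in>{0..a (snd z)}. \<bar>\<psi> (fst z) (snd z) x\<bar> \<le> p z" ..
  have "\<bar>\<psi> i k x\<bar> \<le> (\<Sum>z\<in>{1..m} \<times> {1..n}. \<bar>p z\<bar>)" if "i \<in> {1..m}" "k \<in> {1..n}" "x \<in> {0..a k}" for i k x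
  proof -
    have z: "(i, k) \<in> {1..m} \<times> {1..n}" using that by auto
    have "\<bar>\<psi> i k x\<bar> \<le> \<bar>p (i, k)\<bar>" using p z that(3) by force
    also have "\<dots> \<le> (\<Sum>z\<in>{1..m} \<times> {1..n}. \<bar>p z\<bar>)" using z by (intro member_le_sum) auto
    finally show ?thesis .
  qed
  then show ?thesis by (intro exI[of _ "\<Sum>z\<in>{1..m} \<times> {1..n}. \<bar>p z\<bar>"]) (auto intro!: sum_nonneg)
qed

text \<open>Fredholm alternative for (R), quantitatively: the map from the Cauchy data at the vertex to the
  Kirchhoff sum, the end point derivatives and the first \<open>m\<close> end point values is injective.\<close>

lemma stability:
  "\<exists>C\<ge>0. \<forall>D D' F :: nat \<Rightarrow> real \<Rightarrow> complex.
    (\<forall>k\<in>{1..n}. primitive (a k) (D k) (D' k) \<and> primitive (a k) (D' k) (\<lambda>x. complex_of_real (Q k x) * D k x - F k x)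
      \<and> F k absolutely_integrable_on {0..a k}) \<longrightarrow>
    (\<forall>k\<in>{1..n}. D k 0 = D 1 0) \<longrightarrow> (\<Sum>k\<in>{1..n}. D' k 0) = 0 \<longrightarrow> (\<forall>i\<in>{1..m}. D i (a i) = 0) \<longrightarrow>
    (\<forall>k\<in>{1..n}. \<forall>x\<in>{0..a k}. norm (D k x) \<le>
       C * ((\<Sum>k\<in>{1..n}. norm (D' k (a k))) + (\<Sum>k\<in>{1..n}. integral {0..a k} (\<lambda>x. norm (F k x)))))"
proof -
  define ivp where "ivp k c p U U' \<longleftrightarrow> U 0 = c \<and> U' 0 = p \<and>
    (\<forall>b. primitive b U U' \<and> primitive b U' (\<lambda>x. Q k x * U x - 0))" for k c p and U U' :: "real \<Rightarrow> real"
  have ex: "\<exists>U U'. ivp k c p U U'" if "k \<in> {1..n}" for k c p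
    unfolding ivp_def using Q_meas[OF that] Q_bdd[OF that]
    by (intro second_order_equation_exists[where K = B]) (auto simp: L2_on_def)
  define sel where "sel k c p = (SOME q. ivp k c p (fst q) (snd q))" for k c p
  have sel: "ivp k c p (fst (sel k c p)) (snd (sel k c p))" if "k \<in> {1..n}" for k c p
    unfolding sel_def using ex[OF that, of c p] by (rule_tac someI_ex) auto
  define C C' where "C k = fst (sel k 1 0)" and "C' k = snd (sel k 1 0)" for k
  define S S' where "S k = fst (sel k 0 1)" and "S' k = snd (sel k 0 1)" for k
  have C: "ivp k 1 0 (C k) (C' k)" and S: "ivp k 0 1 (S k) (S' k)" if "k \<in> {1..n}" for k
    unfolding C_def C'_def S_def S'_def using sel[OF that] by blast+
  have pCS: "primitive b (C k) (C' k)" "primitive b (C' k) (\<lambda>x. Q k x * C k x)"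
      "primitive b (S k) (S' k)" "primitive b (S' k) (\<lambda>x. Q k x * S k x)"
    and CS0: "C k 0 = 1" "C' k 0 = 0" "S k 0 = 0" "S' k 0 = 1"
    if "k \<in> {1..n}" for k b
    using C[OF that] S[OF that] unfolding ivp_def by auto
  \<comment> \<open>Column 0 is the common value at the vertex, column \<open>k\<close> the
    derivative there on edge \<open>k\<close>. Row \<open>Inl 0\<close> is the Kirchhoff sum, row
    \<open>Inl k\<close> the derivative at the end of edge \<open>k\<close>, row
    \<open>Inr i\<close> the value at the end of edge \<open>i\<close>. There are \<open>m\<close>
    more rows than columns, hence a left inverse instead of an inverse.\<close>
  define A :: "nat + nat \<Rightarrow> nat \<Rightarrow> real" where "A r c = (case r of
      Inl k \<Rightarrow> if k = 0 then (if c = 0 then 0 else 1) else if c = 0 then C' k (a k) else if c = k then S' k (a k) else 0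
    | Inr i \<Rightarrow> if c = 0 then C i (a i) else if c = i then S i (a i) else 0)" for r c
  let ?R = "{0..n} <+> {1..m}"
  have split: "(\<Sum>c\<in>{0..n}. h c) = h 0 + (\<Sum>c\<in>{1..n}. h c)" for h :: "nat \<Rightarrow> real"
    by (simp add: sum.atLeast_Suc_atMost)
  have delta: "(\<Sum>c\<in>{1..n}. (if c = 0 then x else if c = k then y else 0) * z c) = y * z k"
    if "k \<in> {1..n}" for x y k and z :: "nat \<Rightarrow> real"
  proof -
    have "(\<Sum>c\<in>{1..n}. (if c = 0 then x else if c = k then y else 0) * z c) = (\<Sum>c\<in>{1..n}. if c = k then y * z k else 0)"
      by (intro sum.cong) auto
    then show ?thesis using that by simp
  qed
  have row0: "(\<Sum>c\<in>{0..n}. A (Inl 0) c * z c) = (\<Sum>k\<in>{1..n}. z k)" for z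
    unfolding split by (simp add: A_def)
  have rowl: "(\<Sum>c\<in>{0..n}. A (Inl k) c * z c) = C' k (a k) * z 0 + S' k (a k) * z k" if "k \<in> {1..n}" for k z
    unfolding split using that delta[OF that] by (simp add: A_def)
  have rowr: "(\<Sum>c\<in>{0..n}. A (Inr k) c * z c) = C k (a k) * z 0 + S k (a k) * z k" if "k \<in> {1..n}" for k z
    unfolding split using that delta[OF that] by (simp add: A_def)
  have inj: "\<forall>c\<in>{0..n}. z c = 0" if z: "\<forall>r\<in>?R. (\<Sum>c\<in>{0..n}. A r c * z c) = 0" for z
  proof -
    have zl: "(\<Sum>c\<in>{0..n}. A (Inl k) c * z c) = 0" if "k \<in> {0..n}" for k
      by (rule bspec[OF z]) (use that in auto)
    have zr: "(\<Sum>c\<in>{0..n}. A (Inr k) c * z c) = 0" if "k \<in> {1..m}" for k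
      by (rule bspec[OF z]) (use that in auto)
    define \<phi> where "\<phi> k x = z 0 * C k x + z k * S k x" for k x
    define \<phi>' where "\<phi>' k x = z 0 * C' k x + z k * S' k x" for k x
    have "zero_mode_derivs \<phi> \<phi>'"
      unfolding zero_mode_derivs_def
    proof (intro conjI ballI)
      fix k assume k: "k \<in> {1..n}"
      show "primitive (a k) (\<phi> k) (\<phi>' k)"
        unfolding \<phi>_def \<phi>'_def by (rule primitive_add[OF primitive_cmult[OF pCS(1)[OF k]] primitive_cmult[OF pCS(3)[OF k]]])
      have "primitive (a k) (\<phi>' k) (\<lambda>x. z 0 * (Q k x * C k x) + z k * (Q k x * S k x))"
        unfolding \<phi>'_def by (rule primitive_add[OF primitive_cmult[OF pCS(2)[OF k]] primitive_cmult[OF pCS(4)[OF k]]])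
      then show "primitive (a k) (\<phi>' k) (\<lambda>x. Q k x * \<phi> k x)"
        by (rule primitive_cong_deriv) (simp add: \<phi>_def algebra_simps)
      show "\<phi> k 0 = \<phi> 1 0" using CS0[OF k] CS0[of 1] n by (simp add: \<phi>_def)
      show "\<phi>' k (a k) = 0"
        using zl[of k] rowl[OF k, of z] k by (simp add: \<phi>'_def mult.commute)
    next
      have "(\<Sum>k\<in>{1..n}. \<phi>' k 0) = (\<Sum>k\<in>{1..n}. z k)"
        using CS0 by (intro sum.cong) (auto simp: \<phi>'_def)
      then show "(\<Sum>k\<in>{1..n}. \<phi>' k 0) = 0" using zl[of 0] row0[of z] by simp
    qed
    note zm = this
    then have "solves_R n a Q \<phi>" unfolding solves_R_iff by blast
    from \<psi>_span[OF this] obtain c where c: "\<forall>k\<in>{1..n}. \<forall>x\<in>{0..a k}. \<phi> k x = (\<Sum>i\<in>{1..m}. c i * \<psi> i k x)" ..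
    \<comment> \<open>A kernel vector produces a zero mode. Its coefficient along
      \<open>\<psi> j\<close> equals its value at \<open>a j\<close>, which row \<open>Inr j\<close>
      forces to vanish.\<close>
    have c0: "c j = 0" if j: "j \<in> {1..m}" for j
    proof -
      have jn: "j \<in> {1..n}" using j m by auto
      have "\<phi> j (a j) = (\<Sum>i\<in>{1..m}. c i * \<psi> i j (a j))" using c jn a[OF jn] by auto
      also have "\<dots> = (\<Sum>i\<in>{1..m}. if i = j then c j else 0)"
        using \<psi>_delta j by (intro sum.cong) auto
      finally have "\<phi> j (a j) = c j" using j by simp
      moreover have "\<phi> j (a j) = 0"
        using zr[of j] rowr[OF jn, of z] j by (simp add: \<phi>_def mult.commute)
      ultimately show ?thesis by simp
    qed
    have \<phi>0: "\<phi> k x = 0" if "k \<in> {1..n}" "x \<in> {0..a k}" for k x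
      using c that c0 by simp
    have "z 0 = 0" using \<phi>0[of 1 0] CS0[of 1] n a[of 1] by (simp add: \<phi>_def)
    moreover have "z k = 0" if k: "k \<in> {1..n}" for k
    proof -
      have p: "primitive (a k) (\<phi> k) (\<phi>' k)" "primitive (a k) (\<phi>' k) (\<lambda>x. Q k x * \<phi> k x)"
        using zm k by (auto simp: zero_mode_derivs_def)
      have "\<phi>' k 0 = 0"
        using \<phi>0[OF k] a[OF k] by (intro primitive_of_zero[OF p(1) primitive_continuous[OF p(2)]]) auto
      then show ?thesis using CS0[OF k] by (simp add: \<phi>'_def)
    qed
    ultimately show ?thesis by (metis atLeastAtMost_iff less_one linorder_not_le)
  qed
  have "\<exists>L. \<forall>z. \<forall>c\<in>{0..n}. z c = (\<Sum>r\<in>?R. L c r * (\<Sum>d\<in>{0..n}. A r d * z d))"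
    by (rule injective_system_left_inverse) (use inj in auto)
  then obtain L where L0: "\<forall>z. \<forall>c\<in>{0..n}. z c = (\<Sum>r\<in>?R. L c r * (\<Sum>d\<in>{0..n}. A r d * z d))" ..
  define Ls where "Ls = (\<Sum>c\<in>{0..n}. \<Sum>r\<in>?R. \<bar>L c r\<bar>)"
  have Ls0: "0 \<le> Ls" unfolding Ls_def by (intro sum_nonneg) auto
  have Lr: "\<bar>z c\<bar> \<le> Ls * (\<Sum>r\<in>?R. \<bar>\<Sum>d\<in>{0..n}. A r d * z d\<bar>)" if c: "c \<in> {0..n}" for z c
  proof -
    define y where "y r = (\<Sum>d\<in>{0..n}. A r d * z d)" for r
    have fR: "finite ?R" by simp
    have "\<bar>z c\<bar> = \<bar>\<Sum>r\<in>?R. L c r * y r\<bar>"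
      using L0[THEN spec, of z, THEN bspec, OF c] by (simp add: y_def)
    also have "\<dots> \<le> (\<Sum>r\<in>?R. \<bar>L c r\<bar> * \<bar>y r\<bar>)" by (rule order_trans[OF sum_abs]) (simp add: abs_mult)
    also have "\<dots> \<le> (\<Sum>r\<in>?R. Ls * \<bar>y r\<bar>)"
    proof (intro sum_mono mult_right_mono)
      fix r assume r: "r \<in> ?R"
      have "\<bar>L c r\<bar> \<le> (\<Sum>r\<in>?R. \<bar>L c r\<bar>)" using r fR by (intro member_le_sum) auto
      also have "\<dots> \<le> Ls" unfolding Ls_def
        using member_le_sum[of c "{0..n}" "\<lambda>c. \<Sum>r\<in>?R. \<bar>L c r\<bar>"] c by (simp add: sum_nonneg)
      finally show "\<bar>L c r\<bar> \<le> Ls" .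
    qed auto
    finally show ?thesis by (simp add: y_def sum_distrib_left)
  qed
  define K where "K = max 1 B"
  define G where "G = (\<Sum>k\<in>{1..n}. exp (K * a k))"
  have G: "exp (K * x) \<le> G" if k: "k \<in> {1..n}" "x \<in> {0..a k}" for k x
  proof -
    have "exp (K * x) \<le> exp (K * a k)" using that by (auto simp: K_def intro!: mult_left_mono)
    also have "\<dots> \<le> G" unfolding G_def using k by (intro member_le_sum) auto
    finally show ?thesis .
  qed
  have G0: "0 \<le> G" unfolding G_def by (intro sum_nonneg) auto
  \<comment> \<open>\<open>Ls * (1 + 2 * G)\<close> bounds each real and imaginary part of the
    Cauchy data; the factor 4 accounts for two parts of two numbers, the summand 1 for the forcing
    on the edge, and the last \<open>G\<close> for Gronwall's inequality along it.\<close>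
  define C0 where "C0 = (4 * (Ls * (1 + 2 * G)) + 1) * G"
  show ?thesis
  proof (intro exI[of _ C0] conjI allI impI ballI)
    show "0 \<le> C0" unfolding C0_def using Ls0 G0 by auto
    fix D D' F :: "nat \<Rightarrow> real \<Rightarrow> complex" and k x
    assume hyp: "\<forall>k\<in>{1..n}. primitive (a k) (D k) (D' k) \<and> primitive (a k) (D' k) (\<lambda>x. complex_of_real (Q k x) * D k x - F k x)
      \<and> F k absolutely_integrable_on {0..a k}"
      and cont: "\<forall>k\<in>{1..n}. D k 0 = D 1 0" and kirch: "(\<Sum>k\<in>{1..n}. D' k 0) = 0"
      and vanish: "\<forall>i\<in>{1..m}. D i (a i) = 0" and k: "k \<in> {1..n}" and x: "x \<in> {0..a k}"
    define T1 where "T1 = (\<Sum>k\<in>{1..n}. norm (D' k (a k)))"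
    define I where "I k = integral {0..a k} (\<lambda>x. norm (F k x))" for k
    define T where "T = T1 + (\<Sum>k\<in>{1..n}. I k)"
    have Fi: "(\<lambda>x. norm (F k x)) integrable_on {0..a k}" if "k \<in> {1..n}" for k
      using hyp that by (auto simp: absolutely_integrable_on_def)
    have I0: "0 \<le> I k" if "k \<in> {1..n}" for k
      unfolding I_def using Fi[OF that] by (intro Henstock_Kurzweil_Integration.integral_nonneg) auto
    have gron: "norm (Y x) + norm (Y' x) \<le> (norm (Y 0) + norm (Y' 0) + I k) * G"
      if k: "k \<in> {1..n}" and x: "x \<in> {0..a k}" and Y: "primitive (a k) Y Y'"
        and Y': "primitive (a k) Y' (\<lambda>x. complex_of_real (Q k x) * Y x - F k x)" for k x Y Y'
    proof -
      have "norm (Y x) + norm (Y' x) \<le> (norm (Y 0) + norm (Y' 0) + I k) * exp (K * x)"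
        unfolding I_def
      proof (rule second_order_gronwall[OF Y Y' Fi[OF k] _ _ _ negligible_empty x])
        show "1 \<le> K" by (simp add: K_def)
        fix t assume t: "t \<in> {0..a k} - {}"
        have "norm (complex_of_real (Q k t) * Y t - F k t) \<le> \<bar>Q k t\<bar> * norm (Y t) + norm (F k t)"
          using norm_triangle_ineq4[of "complex_of_real (Q k t) * Y t" "F k t"] by (simp add: norm_mult)
        also have "\<bar>Q k t\<bar> * norm (Y t) \<le> K * norm (Y t)"
          using Q_bdd[OF k, of t] t by (intro mult_right_mono) (auto simp: K_def)
        finally show "norm (complex_of_real (Q k t) * Y t - F k t) \<le> K * norm (Y t) + norm (F k t)" by simp
      qed auto
      also have "\<dots> \<le> (norm (Y 0) + norm (Y' 0) + I k) * G"
        using G[OF k x] I0[OF k] by (intro mult_left_mono) auto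
      finally show ?thesis .
    qed
    define z where "z c = (if c = 0 then D 1 0 else D' c 0)" for c
    \<comment> \<open>\<open>D\<close> minus the homogeneous solution with the same Cauchy data. It
      starts from zero and is driven by \<open>F\<close> alone, so it measures how far the end data
      of \<open>D\<close> differ from those produced by the matrix.\<close>
    define E where "E k x = D k x - (complex_of_real (C k x) * z 0 + complex_of_real (S k x) * z k)" for k x
    define E' where "E' k x = D' k x - (complex_of_real (C' k x) * z 0 + complex_of_real (S' k x) * z k)" for k x
    have EE: "norm (E k x) + norm (E' k x) \<le> I k * G" if k: "k \<in> {1..n}" and x: "x \<in> {0..a k}" for k x
    proof -
      have E0: "E k 0 = 0" "E' k 0 = 0"
        using CS0[OF k] k bspec[OF cont k] by (auto simp: E_def E'_def z_def)
      have hk: "primitive (a k) (D k) (D' k)" "primitive (a k) (D' k) (\<lambda>x. complex_of_real (Q k x) * D k x - F k x)"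
        using hyp k by auto
      have 1: "primitive (a k) (E k) (E' k)"
        unfolding E_def E'_def
        by (rule primitive_diff[OF hk(1) primitive_add[OF primitive_cmult_right[OF primitive_of_real[OF pCS(1)[OF k]]]
            primitive_cmult_right[OF primitive_of_real[OF pCS(3)[OF k]]]]])
      have "primitive (a k) (E' k) (\<lambda>x. (complex_of_real (Q k x) * D k x - F k x)
          - (complex_of_real (Q k x * C k x) * z 0 + complex_of_real (Q k x * S k x) * z k))"
        unfolding E'_def
        by (rule primitive_diff[OF hk(2) primitive_add[OF primitive_cmult_right[OF primitive_of_real[OF pCS(2)[OF k]]]
            primitive_cmult_right[OF primitive_of_real[OF pCS(4)[OF k]]]]])
      then have 2: "primitive (a k) (E' k) (\<lambda>x. complex_of_real (Q k x) * E k x - F k x)"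
        by (rule primitive_cong_deriv) (simp add: E_def algebra_simps)
      show ?thesis using gron[OF k x 1 2] E0 by simp
    qed
    have E1: "norm (E k (a k)) \<le> I k * G" "norm (E' k (a k)) \<le> I k * G" if "k \<in> {1..n}" for k
      using EE[OF that, of "a k"] a[OF that] norm_ge_zero[of "E k (a k)"] norm_ge_zero[of "E' k (a k)"]
      by (auto simp del: norm_ge_zero)
    \<comment> \<open>The matrix and its left inverse are real while \<open>D\<close> is complex, so
      the estimate is made for a real-linear functional and used with \<open>Re\<close> and
      \<open>Im\<close>.\<close>
    have rows: "(\<Sum>r\<in>?R. \<bar>\<Sum>d\<in>{0..n}. A r d * Rf (z d)\<bar>) \<le> (1 + 2 * G) * T"
      if Rf: "bounded_linear Rf" "\<And>w. \<bar>Rf w\<bar> \<le> norm w" "\<And>c w. Rf (complex_of_real c * w) = c * Rf w"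
      for Rf :: "complex \<Rightarrow> real"
    proof -
      interpret Rf: bounded_linear Rf by (rule Rf)
      have r0: "\<bar>\<Sum>d\<in>{0..n}. A (Inl 0) d * Rf (z d)\<bar> = 0"
      proof -
        have "(\<Sum>k\<in>{1..n}. Rf (z k)) = Rf (\<Sum>k\<in>{1..n}. D' k 0)"
          unfolding Rf.sum by (intro sum.cong) (auto simp: z_def)
        then show ?thesis unfolding row0 kirch by (simp add: Rf.zero)
      qed
      have rl: "\<bar>\<Sum>d\<in>{0..n}. A (Inl k) d * Rf (z d)\<bar> \<le> norm (D' k (a k)) + I k * G" if k: "k \<in> {1..n}" for k
      proof -
        have "(\<Sum>d\<in>{0..n}. A (Inl k) d * Rf (z d)) = Rf (D' k (a k) - E' k (a k))"
          unfolding rowl[OF k] by (simp add: E'_def Rf.add Rf(3))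
        also have "\<bar>\<dots>\<bar> \<le> norm (D' k (a k)) + norm (E' k (a k))"
          by (rule order_trans[OF Rf(2) norm_triangle_ineq4])
        also have "norm (E' k (a k)) \<le> I k * G"
          by (rule E1[OF k])
        finally show ?thesis by simp
      qed
      have rr: "\<bar>\<Sum>d\<in>{0..n}. A (Inr k) d * Rf (z d)\<bar> \<le> I k * G" if k: "k \<in> {1..m}" for k
      proof -
        have kn: "k \<in> {1..n}" using k m by auto
        have "(\<Sum>d\<in>{0..n}. A (Inr k) d * Rf (z d)) = Rf (D k (a k) - E k (a k))"
          unfolding rowr[OF kn] by (simp add: E_def Rf.add Rf(3))
        also have "\<dots> = Rf (- E k (a k))" using vanish k by simp
        also have "\<bar>\<dots>\<bar> \<le> norm (E k (a k))" using Rf(2)[of "- E k (a k)"] by simp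
        also have "norm (E k (a k)) \<le> I k * G"
          by (rule E1[OF kn])
        finally show ?thesis .
      qed
      have "(\<Sum>r\<in>?R. \<bar>\<Sum>d\<in>{0..n}. A r d * Rf (z d)\<bar>)
          = (\<Sum>k\<in>{0..n}. \<bar>\<Sum>d\<in>{0..n}. A (Inl k) d * Rf (z d)\<bar>) + (\<Sum>k\<in>{1..m}. \<bar>\<Sum>d\<in>{0..n}. A (Inr k) d * Rf (z d)\<bar>)"
        by (subst sum.Plus) auto
      also have "(\<Sum>k\<in>{0..n}. \<bar>\<Sum>d\<in>{0..n}. A (Inl k) d * Rf (z d)\<bar>)
          = (\<Sum>k\<in>{1..n}. \<bar>\<Sum>d\<in>{0..n}. A (Inl k) d * Rf (z d)\<bar>)"
        by (subst split) (simp only: r0 add_0)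
      also have "\<dots> \<le> (\<Sum>k\<in>{1..n}. norm (D' k (a k)) + I k * G)" by (intro sum_mono rl)
      also have "(\<Sum>k\<in>{1..m}. \<bar>\<Sum>d\<in>{0..n}. A (Inr k) d * Rf (z d)\<bar>) \<le> (\<Sum>k\<in>{1..m}. I k * G)" by (intro sum_mono rr)
      also have "\<dots> \<le> (\<Sum>k\<in>{1..n}. I k * G)" using m I0 G0 by (intro sum_mono2) auto
      also have "(\<Sum>k\<in>{1..n}. norm (D' k (a k)) + I k * G) + (\<Sum>k\<in>{1..n}. I k * G) = T1 + 2 * G * (\<Sum>k\<in>{1..n}. I k)"
          by (simp add: T1_def sum.distrib sum_distrib_right[symmetric])
      also have "\<dots> \<le> (1 + 2 * G) * T"
      proof -
        have "0 \<le> T1" unfolding T1_def by (intro sum_nonneg) auto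
        then have "0 \<le> 2 * G * T1" using G0 by simp
        moreover have "0 \<le> (\<Sum>k\<in>{1..n}. I k)" by (intro sum_nonneg I0)
        ultimately show ?thesis by (simp add: T_def algebra_simps)
      qed
      finally show ?thesis by simp
    qed
    have zb: "norm (z c) \<le> 2 * (Ls * ((1 + 2 * G) * T))" if c: "c \<in> {0..n}" for c
    proof -
      have "(\<Sum>r\<in>?R. \<bar>\<Sum>d\<in>{0..n}. A r d * Re (z d)\<bar>) \<le> (1 + 2 * G) * T"
        by (rule rows[OF bounded_linear_Re]) (simp_all add: abs_Re_le_cmod)
      from order_trans[OF Lr[OF c, of "\<lambda>c. Re (z c)"] mult_left_mono[OF this Ls0]]
      have "\<bar>Re (z c)\<bar> \<le> Ls * ((1 + 2 * G) * T)" .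
      moreover have "(\<Sum>r\<in>?R. \<bar>\<Sum>d\<in>{0..n}. A r d * Im (z d)\<bar>) \<le> (1 + 2 * G) * T"
        by (rule rows[OF bounded_linear_Im]) (simp_all add: abs_Im_le_cmod)
      from order_trans[OF Lr[OF c, of "\<lambda>c. Im (z c)"] mult_left_mono[OF this Ls0]]
      have "\<bar>Im (z c)\<bar> \<le> Ls * ((1 + 2 * G) * T)" .
      ultimately show ?thesis using cmod_le[of "z c"] by linarith
    qed
    have "D k 0 = z 0" "D' k 0 = z k" using bspec[OF cont k] k by (auto simp: z_def)
    then have "norm (D k 0) + norm (D' k 0) \<le> 4 * (Ls * ((1 + 2 * G) * T))"
      using zb[of 0] zb[of k] k by auto
    moreover have "I k \<le> T"
    proof -
      have "I k \<le> (\<Sum>k\<in>{1..n}. I k)" using k I0 by (intro member_le_sum) auto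
      moreover have "0 \<le> T1" unfolding T1_def by (intro sum_nonneg) auto
      ultimately show ?thesis by (simp add: T_def)
    qed
    ultimately have "(norm (D k 0) + norm (D' k 0) + I k) * G \<le> (4 * (Ls * ((1 + 2 * G) * T)) + T) * G"
      using G0 by (intro mult_right_mono) auto
    also have "\<dots> = C0 * T" by (simp add: C0_def algebra_simps)
    finally have "(norm (D k 0) + norm (D' k 0) + I k) * G \<le> C0 * T" .
    moreover have "norm (D k x) + norm (D' k x) \<le> (norm (D k 0) + norm (D' k 0) + I k) * G"
      using hyp k by (intro gron[OF k x]) auto
    ultimately show "norm (D k x) \<le> C0 * ((\<Sum>k\<in>{1..n}. norm (D' k (a k))) + (\<Sum>k\<in>{1..n}. integral {0..a k} (\<lambda>x. norm (F k x))))"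
      unfolding T_def T1_def I_def using norm_ge_zero[of "D' k x"] by linarith
  qed
qed

end

section \<open>The rescaled problem on the compact star\<close>

text \<open>\<open>lam\<close> and \<open>L\<close> stand for the first-order coefficient and the
  remainder constant of the coupling, and \<open>M0\<close> for the constant bounding the
  derivatives at the ends of the small star by the datum and the end values.\<close>

locale scaled_star = neumann_star +
  fixes \<zeta> :: complex and lam L M0 :: real
  assumes L: "0 \<le> L" and M0: "0 \<le> M0"
begin

definition \<theta> :: "nat \<Rightarrow> nat \<Rightarrow> real" where "\<theta> i j = \<psi> i j (a j)"

definition q :: "nat \<Rightarrow> nat \<Rightarrow> real" where
  "q i j = (\<Sum>k\<in>{1..n}. integral {0..a k} (\<lambda>x. Q k x * \<psi> i k x * \<psi> j k x))"

text \<open>\<open>U(y) = u(\<epsilon> y)\<close> for a solution \<open>u\<close> of the resolvent equation, with \<open>p\<^sub>k = u\<^sub>k'(\<epsilon> a\<^sub>k)\<close>,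
  \<open>F(y) = f(\<epsilon> y)\<close> and \<open>N\<close> comparable to the norm of \<open>f\<close>.\<close>

definition scaled_data where
  "scaled_data \<epsilon> l N U U' F p \<longleftrightarrow> 0 < \<epsilon> \<and> \<epsilon> \<le> 1 \<and> \<bar>l - 1 - \<epsilon> * lam\<bar> \<le> L * \<epsilon>\<^sup>2 \<and> 0 \<le> N \<and>
    (\<forall>k\<in>{1..n}. primitive (a k) (U k) (U' k) \<and>
      primitive (a k) (U' k) (\<lambda>x. (complex_of_real (l * Q k x) - complex_of_real (\<epsilon>\<^sup>2) * \<zeta>) * U k x - complex_of_real (\<epsilon>\<^sup>2) * F k x) \<and>
      F k absolutely_integrable_on {0..a k} \<and> \<epsilon> * integral {0..a k} (\<lambda>x. norm (F k x)) \<le> sqrt \<epsilon> * N \<and>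
      U' k (a k) = complex_of_real \<epsilon> * p k \<and> norm (p k) \<le> M0 * (N + norm (U k (a k)))) \<and>
    (\<forall>k\<in>{1..n}. U k 0 = U 1 0) \<and> (\<Sum>k\<in>{1..n}. U' k 0) = 0"

text \<open>Provides the maximum over all edges as an actual finite number, without which it could
  not be absorbed in \<open>scaled_estimate\<close>.\<close>

lemma sup_attained:
  fixes U :: "nat \<Rightarrow> real \<Rightarrow> complex"
  assumes "\<And>k. k \<in> {1..n} \<Longrightarrow> continuous_on {0..a k} (U k)"
  shows "\<exists>k\<in>{1..n}. \<exists>x\<in>{0..a k}. \<forall>j\<in>{1..n}. \<forall>y\<in>{0..a j}. norm (U j y) \<le> norm (U k x)"
proof -
  have "\<forall>k\<in>{1..n}. \<exists>x\<in>{0..a k}. \<forall>y\<in>{0..a k}. norm (U k y) \<le> norm (U k x)"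
  proof
    fix k assume k: "k \<in> {1..n}"
    show "\<exists>x\<in>{0..a k}. \<forall>y\<in>{0..a k}. norm (U k y) \<le> norm (U k x)"
      using a[OF k] assms[OF k] by (intro continuous_attains_sup continuous_on_norm) auto
  qed
  then have "\<forall>k\<in>{1..n}. \<exists>x. x \<in> {0..a k} \<and> (\<forall>y\<in>{0..a k}. norm (U k y) \<le> norm (U k x))" by blast
  from bchoice[OF this] obtain x where x: "\<forall>k\<in>{1..n}. x k \<in> {0..a k} \<and> (\<forall>y\<in>{0..a k}. norm (U k y) \<le> norm (U k (x k)))" ..
  let ?V = "(\<lambda>k. norm (U k (x k))) ` {1..n}"
  have fin: "finite ?V" "?V \<noteq> {}" using n by auto
  from Max_in[OF fin] obtain k where k: "k \<in> {1..n}" "Max ?V = norm (U k (x k))" by auto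
  have "norm (U j y) \<le> norm (U k (x k))" if "j \<in> {1..n}" "y \<in> {0..a j}" for j y
  proof -
    have "norm (U j y) \<le> norm (U j (x j))" using x that by blast
    also have "\<dots> \<le> Max ?V" using that(1) fin by (intro Max_ge) auto
    finally show ?thesis using k(2) by simp
  qed
  then show ?thesis using x k(1) by blast
qed

text \<open>\<open>U\<close> is compared with the zero mode \<open>Z\<close> having the same values
  at the first \<open>m\<close> ends. The difference \<open>D\<close> solves the zero-energy problem
  with forcing and end derivatives of order \<epsilon>, so \<open>stability\<close> applies, and the
  maximum of |U| is absorbed. The flux condition comes from Green's identity with each
  \<open>\<psi> i\<close>, divided by \<epsilon>. The datum is the only term of order
  \<surd>\<epsilon>; \<open>S\<close> appears with the full factor \<epsilon>, which is decisive
  when it is eliminated later.\<close>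

lemma scaled_estimate:
  "\<exists>C\<ge>0. \<exists>\<delta>>0. \<forall>\<epsilon> l N U U' F p. scaled_data \<epsilon> l N U U' F p \<longrightarrow> \<epsilon> \<le> \<delta> \<longrightarrow>
    (let S = (\<Sum>k\<in>{1..n}. norm (U k (a k))) in
      (\<forall>k\<in>{1..n}. \<forall>x\<in>{0..a k}. norm (U k x) \<le> C * (N + S)) \<and>
      (\<forall>j\<in>{1..n}. norm (U j (a j) - (\<Sum>i\<in>{1..m}. complex_of_real (\<theta> i j) * U i (a i))) \<le> C * (\<epsilon> * (N + S))) \<and>
      (\<forall>i\<in>{1..m}. norm ((\<Sum>k\<in>{1..n}. complex_of_real (\<theta> i k) * p k)
          - complex_of_real lam * (\<Sum>j\<in>{1..m}. complex_of_real (q i j) * U j (a j))) \<le> C * (sqrt \<epsilon> * N + \<epsilon> * S)))"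
proof -
  obtain Cs where Cs: "0 \<le> Cs" and stab: "\<forall>D D' F :: nat \<Rightarrow> real \<Rightarrow> complex.
    (\<forall>k\<in>{1..n}. primitive (a k) (D k) (D' k) \<and> primitive (a k) (D' k) (\<lambda>x. complex_of_real (Q k x) * D k x - F k x)
      \<and> F k absolutely_integrable_on {0..a k}) \<longrightarrow>
    (\<forall>k\<in>{1..n}. D k 0 = D 1 0) \<longrightarrow> (\<Sum>k\<in>{1..n}. D' k 0) = 0 \<longrightarrow> (\<forall>i\<in>{1..m}. D i (a i) = 0) \<longrightarrow>
    (\<forall>k\<in>{1..n}. \<forall>x\<in>{0..a k}. norm (D k x) \<le>
       Cs * ((\<Sum>k\<in>{1..n}. norm (D' k (a k))) + (\<Sum>k\<in>{1..n}. integral {0..a k} (\<lambda>x. norm (F k x)))))"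
    using stability by blast
  obtain P where P: "0 \<le> P" "\<forall>i\<in>{1..m}. \<forall>k\<in>{1..n}. \<forall>x\<in>{0..a k}. \<bar>\<psi> i k x\<bar> \<le> P"
    using \<psi>_bounded by blast
  define Am where "Am = (\<Sum>k\<in>{1..n}. a k)"
  have Am: "a k \<le> Am" if "k \<in> {1..n}" for k
    unfolding Am_def using that a by (intro member_le_sum) (auto intro: less_imp_le)
  have Am0: "0 \<le> Am" unfolding Am_def using a by (intro sum_nonneg) (auto intro: less_imp_le)
  define Bd where "Bd = (\<bar>lam\<bar> + L) * B"
  have Bd0: "0 \<le> Bd" unfolding Bd_def using L B_nonneg by simp
  \<comment> \<open>\<open>c1\<close> collects the inputs of the stability estimate,
    \<open>c2\<close> bounds the difference \<open>D\<close>, \<open>c3\<close> the maximum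
    \<open>M\<close>, \<open>c4\<close> again \<open>D\<close> once \<open>M\<close> has been
    eliminated, and \<open>c5\<close> the tested identity.\<close>
  define c1 where "c1 = M0 * n + M0 + n * (Am * (Bd + norm \<zeta>)) + n"
  define c2 where "c2 = Cs * c1"
  define c3 where "c3 = 1 + 2 * P"
  define c4 where "c4 = c2 * (1 + c3)"
  define c5 where "c5 = P * (n * (Am * (L * B * c3 + \<bar>lam\<bar> * B * c4 + norm \<zeta> * c3)) + n)"
  define C where "C = c3 + c4 + 2 * c5"
  have c1: "0 \<le> c1" unfolding c1_def using M0 Am0 Bd0 by simp
  have c2: "0 \<le> c2" unfolding c2_def using Cs c1 by simp
  have c3: "0 \<le> c3" unfolding c3_def using P by simp
  have c4: "0 \<le> c4" unfolding c4_def using c2 c3 by simp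
  have c5: "0 \<le> c5" unfolding c5_def using P Am0 L B_nonneg c3 c4 by simp
  \<comment> \<open>Chosen so that \<open>c2 * \<epsilon> \<le> 1 / 2\<close>, which allows the
    maximum of |U| to be absorbed.\<close>
  define \<delta> where "\<delta> = 1 / (2 * (c2 + 1))"
  have \<delta>: "0 < \<delta>" unfolding \<delta>_def using c2 by simp
  have main: "(\<forall>k\<in>{1..n}. \<forall>x\<in>{0..a k}. norm (U k x) \<le> c3 * (N + S)) \<and>
      (\<forall>j\<in>{1..n}. norm (U j (a j) - (\<Sum>i\<in>{1..m}. complex_of_real (\<theta> i j) * U i (a i))) \<le> c4 * (\<epsilon> * (N + S))) \<and>
      (\<forall>i\<in>{1..m}. norm ((\<Sum>k\<in>{1..n}. complex_of_real (\<theta> i k) * p k)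
          - complex_of_real lam * (\<Sum>j\<in>{1..m}. complex_of_real (q i j) * U j (a j))) \<le> (2 * c5) * (sqrt \<epsilon> * N + \<epsilon> * S))"
    if sd: "scaled_data \<epsilon> l N U U' F p" and \<epsilon>\<delta>: "\<epsilon> \<le> \<delta>" and S: "S = (\<Sum>k\<in>{1..n}. norm (U k (a k)))"
    for \<epsilon> l N S and U U' F :: "nat \<Rightarrow> real \<Rightarrow> complex" and p
  proof -
    have \<epsilon>: "0 < \<epsilon>" "\<epsilon> \<le> 1" and l: "\<bar>l - 1 - \<epsilon> * lam\<bar> \<le> L * \<epsilon>\<^sup>2" and N: "0 \<le> N"
      and cont: "\<forall>k\<in>{1..n}. U k 0 = U 1 0" and kirch: "(\<Sum>k\<in>{1..n}. U' k 0) = 0"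
      using sd unfolding scaled_data_def by blast+
    have edge: "primitive (a k) (U k) (U' k)"
      "primitive (a k) (U' k) (\<lambda>x. (complex_of_real (l * Q k x) - complex_of_real (\<epsilon>\<^sup>2) * \<zeta>) * U k x - complex_of_real (\<epsilon>\<^sup>2) * F k x)"
      "F k absolutely_integrable_on {0..a k}" "\<epsilon> * integral {0..a k} (\<lambda>x. norm (F k x)) \<le> sqrt \<epsilon> * N"
      "U' k (a k) = complex_of_real \<epsilon> * p k" "norm (p k) \<le> M0 * (N + norm (U k (a k)))" if "k \<in> {1..n}" for k
      using sd that unfolding scaled_data_def by blast+
    have \<epsilon>2: "\<epsilon>\<^sup>2 \<le> \<epsilon>" using \<epsilon> by (simp add: power2_eq_square mult_left_le)
    have \<epsilon>s: "\<epsilon> \<le> sqrt \<epsilon>" using \<epsilon> \<epsilon>2 by (intro real_le_rsqrt)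
    have sq1: "sqrt \<epsilon> \<le> 1" using \<epsilon> by simp
    have S0: "0 \<le> S" unfolding S by (intro sum_nonneg) auto
    have XS: "norm (U k (a k)) \<le> S" if "k \<in> {1..n}" for k
      unfolding S using that by (intro member_le_sum) auto
    have Uc: "continuous_on {0..a k} (U k)" if "k \<in> {1..n}" for k using edge(1)[OF that] by (rule primitive_continuous)
    obtain k0 x0 where k0: "k0 \<in> {1..n}" "x0 \<in> {0..a k0}" and "\<forall>j\<in>{1..n}. \<forall>y\<in>{0..a j}. norm (U j y) \<le> norm (U k0 x0)"
      using sup_attained[of U] Uc by blast
    define M where "M = norm (U k0 x0)"
    have M: "norm (U j y) \<le> M" if "j \<in> {1..n}" "y \<in> {0..a j}" for j y
      unfolding M_def using \<open>\<forall>j\<in>{1..n}. \<forall>y\<in>{0..a j}. norm (U j y) \<le> norm (U k0 x0)\<close> that by blast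
    have M0': "0 \<le> M" by (simp add: M_def)
    \<comment> \<open>Everything that separates the rescaled equation from the zero-energy one: in
      these terms it reads \<open>U'' = Q U - R\<close>.\<close>
    define R where "R k x = complex_of_real (1 - l) * (complex_of_real (Q k x) * U k x)
      + complex_of_real (\<epsilon>\<^sup>2) * \<zeta> * U k x + complex_of_real (\<epsilon>\<^sup>2) * F k x" for k x
    have Ui: "U k absolutely_integrable_on {0..a k}" if "k \<in> {1..n}" for k
      using Uc[OF that] by (rule absolutely_integrable_continuous_real)
    have cmult_ai: "(\<lambda>x. c * h x) absolutely_integrable_on {0..b}" if "h absolutely_integrable_on {0..b}"
      for c and h :: "real \<Rightarrow> complex" and b
      using that by (rule absolutely_integrable_mult_continuous) (rule continuous_on_const)
    have Ri: "R k absolutely_integrable_on {0..a k}" if k: "k \<in> {1..n}" for k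
      unfolding R_def using Q_mult_integrable[OF k Ui[OF k]] Ui[OF k] edge(3)[OF k]
      by (intro set_integral_add cmult_ai)
    have l1: "\<bar>1 - l\<bar> \<le> \<epsilon> * (\<bar>lam\<bar> + L)"
    proof -
      have "\<bar>1 - l\<bar> \<le> \<bar>l - 1 - \<epsilon> * lam\<bar> + \<bar>\<epsilon> * lam\<bar>" by simp
      also have "\<dots> \<le> L * \<epsilon> + \<epsilon> * \<bar>lam\<bar>"
        using l \<epsilon> mult_left_mono[OF \<epsilon>2 L] by (simp add: abs_mult)
      finally show ?thesis by (simp add: algebra_simps)
    qed
    have QM: "norm (complex_of_real (Q k x) * U k x) \<le> B * M" if "k \<in> {1..n}" "x \<in> {0..a k}" for k x
      unfolding norm_mult norm_of_real
      using M[OF that] Q_bdd[OF that(1), of x] that(2) B_nonneg by (intro mult_mono) auto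
    have \<epsilon>F: "\<epsilon>\<^sup>2 * integral {0..a k} (\<lambda>x. norm (F k x)) \<le> \<epsilon> * (sqrt \<epsilon> * N)" if "k \<in> {1..n}" for k
      using mult_left_mono[OF edge(4)[OF that], of \<epsilon>] \<epsilon> by (simp add: power2_eq_square mult.assoc)
    have Fi: "(\<lambda>x. norm (F k x)) integrable_on {0..a k}" if "k \<in> {1..n}" for k
      using edge(3)[OF that] by (auto simp: absolutely_integrable_on_def)
    have const_plus: "integral {0..a k} (\<lambda>x. A + c * norm (F k x)) = a k * A + c * integral {0..a k} (\<lambda>x. norm (F k x))"
      "(\<lambda>x. A + c * norm (F k x)) integrable_on {0..a k}" if "k \<in> {1..n}" for k A c
    proof -
      have c: "(\<lambda>x. c * norm (F k x)) integrable_on {0..a k}" using Fi[OF that] by (rule integrable_on_mult_right)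
      have A: "(\<lambda>_ :: real. A) integrable_on {0..a k}" by (rule integrable_const_ivl)
      show "(\<lambda>x. A + c * norm (F k x)) integrable_on {0..a k}" using A c by (rule integrable_add)
      show "integral {0..a k} (\<lambda>x. A + c * norm (F k x)) = a k * A + c * integral {0..a k} (\<lambda>x. norm (F k x))"
        unfolding Henstock_Kurzweil_Integration.integral_add[OF A c] using a[OF that] by simp
    qed
    have IR: "integral {0..a k} (\<lambda>x. norm (R k x)) \<le> \<epsilon> * (Am * (Bd + norm \<zeta>) * M + N)" if k: "k \<in> {1..n}" for k
    proof -
      have "integral {0..a k} (\<lambda>x. norm (R k x)) \<le> integral {0..a k} (\<lambda>x. \<epsilon> * (Bd + norm \<zeta>) * M + \<epsilon>\<^sup>2 * norm (F k x))"
      proof (rule integral_le)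
        show "(\<lambda>x. norm (R k x)) integrable_on {0..a k}" using Ri[OF k] by (auto simp: absolutely_integrable_on_def)
        fix x assume x: "x \<in> {0..a k}"
        have "norm (R k x) \<le> \<bar>1 - l\<bar> * norm (complex_of_real (Q k x) * U k x) + \<epsilon>\<^sup>2 * norm \<zeta> * norm (U k x) + \<epsilon>\<^sup>2 * norm (F k x)"
          unfolding R_def using norm_triangle_ineq
          by (smt (verit) norm_mult norm_of_real abs_of_nonneg zero_le_power2)
        also have "\<dots> \<le> (\<epsilon> * (\<bar>lam\<bar> + L)) * (B * M) + \<epsilon> * norm \<zeta> * M + \<epsilon>\<^sup>2 * norm (F k x)"
          using l1 QM[OF k x] M[OF k x] \<epsilon>2 \<epsilon>(1) L by (intro add_mono mult_mono order_refl) auto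
        finally show "norm (R k x) \<le> \<epsilon> * (Bd + norm \<zeta>) * M + \<epsilon>\<^sup>2 * norm (F k x)"
          by (simp add: Bd_def algebra_simps)
      qed (rule const_plus(2)[OF k])
      also have "\<dots> = a k * (\<epsilon> * (Bd + norm \<zeta>) * M) + \<epsilon>\<^sup>2 * integral {0..a k} (\<lambda>x. norm (F k x))"
        by (rule const_plus(1)[OF k])
      also have "\<dots> \<le> Am * (\<epsilon> * (Bd + norm \<zeta>) * M) + \<epsilon> * (1 * N)"
      proof (rule add_mono)
        show "a k * (\<epsilon> * (Bd + norm \<zeta>) * M) \<le> Am * (\<epsilon> * (Bd + norm \<zeta>) * M)"
          using Am[OF k] \<epsilon> Bd0 M0' by (intro mult_right_mono) auto
        show "\<epsilon>\<^sup>2 * integral {0..a k} (\<lambda>x. norm (F k x)) \<le> \<epsilon> * (1 * N)"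
          using \<epsilon>F[OF k] sq1 N \<epsilon> by (elim order_trans) (intro mult_left_mono mult_right_mono; simp)
      qed
      finally show ?thesis by (simp add: algebra_simps)
    qed
    define X where "X i = U i (a i)" for i
    \<comment> \<open>By the normalisation of the basis, \<open>Z\<close> takes the value
      \<open>X i\<close> at the end of edge \<open>i\<close> for \<open>i \<le> m\<close>. Hence
      \<open>D\<close> vanishes there, as \<open>stability\<close> requires.\<close>
    define Z where "Z k x = (\<Sum>i\<in>{1..m}. complex_of_real (\<psi> i k x) * X i)" for k x
    define Z' where "Z' k x = (\<Sum>i\<in>{1..m}. complex_of_real (\<psi>' i k x) * X i)" for k x
    define D where "D k x = U k x - Z k x" for k x
    define D' where "D' k x = U' k x - Z' k x" for k x
    have Zp: "primitive (a k) (Z k) (Z' k)" "primitive (a k) (Z' k) (\<lambda>x. complex_of_real (Q k x) * Z k x)" if k: "k \<in> {1..n}" for k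
    proof -
      show "primitive (a k) (Z k) (Z' k)"
        unfolding Z_def Z'_def
        by (rule primitive_sum, simp, rule primitive_cmult_right, rule primitive_of_real, rule \<psi>_primitive(1)[OF _ k])
      have "primitive (a k) (Z' k) (\<lambda>x. \<Sum>i\<in>{1..m}. complex_of_real (Q k x * \<psi> i k x) * X i)"
        unfolding Z'_def
        by (rule primitive_sum, simp, rule primitive_cmult_right, rule primitive_of_real, rule \<psi>_primitive(2)[OF _ k])
      then show "primitive (a k) (Z' k) (\<lambda>x. complex_of_real (Q k x) * Z k x)"
        by (rule primitive_cong_deriv) (simp add: Z_def sum_distrib_left mult.assoc)
    qed
    have RQ: "(complex_of_real (l * Q k x) - complex_of_real (\<epsilon>\<^sup>2) * \<zeta>) * U k x - complex_of_real (\<epsilon>\<^sup>2) * F k x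
        = complex_of_real (Q k x) * U k x - R k x" for k x
      by (simp add: R_def algebra_simps)
    have U'p: "primitive (a k) (U' k) (\<lambda>x. complex_of_real (Q k x) * U k x - R k x)" if "k \<in> {1..n}" for k
      using edge(2)[OF that] by (rule primitive_cong_deriv) (rule RQ)
    have z: "zero_mode_derivs (\<psi> i) (\<psi>' i)" if "i \<in> {1..m}" for i using \<psi>'[OF that] .
    have Da: "D' k (a k) = complex_of_real \<epsilon> * p k" if k: "k \<in> {1..n}" for k
    proof -
      have "Z' k (a k) = 0"
        unfolding Z'_def using z k by (intro sum.neutral) (auto simp: zero_mode_derivs_def)
      then show ?thesis using edge(5)[OF k] by (simp add: D'_def)
    qed
    define T where "T = (\<Sum>k\<in>{1..n}. norm (D' k (a k))) + (\<Sum>k\<in>{1..n}. integral {0..a k} (\<lambda>x. norm (R k x)))"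
    have DT: "norm (D k x) \<le> Cs * T" if "k \<in> {1..n}" "x \<in> {0..a k}" for k x
    proof -
      have 1: "\<forall>k\<in>{1..n}. primitive (a k) (D k) (D' k) \<and> primitive (a k) (D' k) (\<lambda>x. complex_of_real (Q k x) * D k x - R k x)
          \<and> R k absolutely_integrable_on {0..a k}"
      proof (intro ballI conjI Ri)
        fix k assume k: "k \<in> {1..n}"
        show "primitive (a k) (D k) (D' k)"
          unfolding D_def D'_def by (rule primitive_diff[OF edge(1)[OF k] Zp(1)[OF k]])
        have "primitive (a k) (D' k) (\<lambda>x. (complex_of_real (Q k x) * U k x - R k x) - complex_of_real (Q k x) * Z k x)"
          unfolding D'_def by (rule primitive_diff[OF U'p[OF k] Zp(2)[OF k]])
        then show "primitive (a k) (D' k) (\<lambda>x. complex_of_real (Q k x) * D k x - R k x)"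
          by (rule primitive_cong_deriv) (simp add: D_def algebra_simps)
      qed
      have 2: "\<forall>k\<in>{1..n}. D k 0 = D 1 0"
      proof
        fix k assume k: "k \<in> {1..n}"
        have "Z k 0 = Z 1 0"
          unfolding Z_def
        proof (intro sum.cong refl)
          fix i assume "i \<in> {1..m}"
          from z[OF this] have "\<psi> i k 0 = \<psi> i 1 0" using k unfolding zero_mode_derivs_def by blast
          then show "complex_of_real (\<psi> i k 0) * X i = complex_of_real (\<psi> i 1 0) * X i" by simp
        qed
        then show "D k 0 = D 1 0" using bspec[OF cont k] by (simp add: D_def)
      qed
      have 3: "(\<Sum>k\<in>{1..n}. D' k 0) = 0"
      proof -
        have "(\<Sum>k\<in>{1..n}. Z' k 0) = (\<Sum>i\<in>{1..m}. complex_of_real (\<Sum>k\<in>{1..n}. \<psi>' i k 0) * X i)"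
          unfolding Z'_def of_real_sum sum_distrib_right by (rule sum.swap)
        also have "\<dots> = 0" using z by (intro sum.neutral) (auto simp: zero_mode_derivs_def)
        finally show ?thesis using kirch by (simp add: D'_def sum_subtractf)
      qed
      have 4: "\<forall>i\<in>{1..m}. D i (a i) = 0"
      proof
        fix i assume i: "i \<in> {1..m}"
        have "Z i (a i) = (\<Sum>j\<in>{1..m}. if j = i then X i else 0)"
          unfolding Z_def using \<psi>_delta i by (intro sum.cong) auto
        then show "D i (a i) = 0" using i by (simp add: D_def X_def)
      qed
      show ?thesis
        using stab[THEN spec, of D, THEN spec, of D', THEN spec, of R, THEN mp, OF 1, THEN mp, OF 2, THEN mp, OF 3, THEN mp, OF 4] that
        unfolding T_def by blast
    qed
    have T: "T \<le> \<epsilon> * (c1 * (N + S + M))"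
    proof -
      have "(\<Sum>k\<in>{1..n}. norm (D' k (a k))) \<le> (\<Sum>k\<in>{1..n}. \<epsilon> * (M0 * (N + norm (U k (a k)))))"
      proof (intro sum_mono)
        fix k assume k: "k \<in> {1..n}"
        show "norm (D' k (a k)) \<le> \<epsilon> * (M0 * (N + norm (U k (a k))))"
          unfolding Da[OF k] norm_mult using edge(6)[OF k] \<epsilon> by (simp add: mult_left_mono)
      qed
      also have "\<dots> = \<epsilon> * (M0 * n * N + M0 * S)"
        by (simp add: S sum.distrib distrib_left sum_distrib_left[symmetric])
      finally have 1: "(\<Sum>k\<in>{1..n}. norm (D' k (a k))) \<le> \<epsilon> * (M0 * n * N + M0 * S)" .
      have "(\<Sum>k\<in>{1..n}. integral {0..a k} (\<lambda>x. norm (R k x))) \<le> (\<Sum>k\<in>{1..n}. \<epsilon> * (Am * (Bd + norm \<zeta>) * M + N))"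
        by (intro sum_mono IR)
      also have "\<dots> = \<epsilon> * (n * (Am * (Bd + norm \<zeta>)) * M + n * N)" by (simp add: algebra_simps)
      finally have "T \<le> \<epsilon> * (M0 * n * N + M0 * S) + \<epsilon> * (n * (Am * (Bd + norm \<zeta>)) * M + n * N)"
        using 1 unfolding T_def by linarith
      also have "\<dots> = \<epsilon> * (M0 * n * N + M0 * S + n * (Am * (Bd + norm \<zeta>)) * M + n * N)"
        by (simp add: algebra_simps)
      also have "\<dots> \<le> \<epsilon> * (c1 * (N + S + M))"
      proof (rule mult_left_mono)
        define A1 A2 A3 A4 where "A1 = M0 * n" "A2 = M0" "A3 = n * (Am * (Bd + norm \<zeta>))" "A4 = real n"
        have c1A: "c1 = A1 + A2 + A3 + A4" by (simp add: c1_def A1_A2_A3_A4_def)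
        have A: "0 \<le> A1" "0 \<le> A2" "0 \<le> A3" "0 \<le> A4"
          unfolding A1_A2_A3_A4_def using M0 Am0 Bd0 by auto
        have "A1 * N \<le> A1 * (N + S + M)" "A2 * S \<le> A2 * (N + S + M)" "A3 * M \<le> A3 * (N + S + M)" "A4 * N \<le> A4 * (N + S + M)"
          using A N S0 M0' by (auto intro!: mult_left_mono)
        then have "A1 * N + A2 * S + A3 * M + A4 * N \<le> c1 * (N + S + M)"
          unfolding c1A distrib_right[of _ _ "N + S + M"] by linarith
        then show "M0 * n * N + M0 * S + n * (Am * (Bd + norm \<zeta>)) * M + n * N \<le> c1 * (N + S + M)"
          unfolding A1_A2_A3_A4_def .
      qed (use \<epsilon> in simp)
      finally show ?thesis .
    qed
    have D1: "norm (D k x) \<le> c2 * (\<epsilon> * (N + S + M))" if "k \<in> {1..n}" "x \<in> {0..a k}" for k x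
      using order_trans[OF DT[OF that] mult_left_mono[OF T Cs]] by (simp add: c2_def mult_ac)
    have Zb: "norm (Z k x) \<le> P * S" if k: "k \<in> {1..n}" "x \<in> {0..a k}" for k x
    proof -
      have "norm (Z k x) \<le> (\<Sum>i\<in>{1..m}. P * norm (X i))"
        unfolding Z_def
      proof (rule order_trans[OF norm_sum], intro sum_mono)
        fix i assume i: "i \<in> {1..m}"
        then show "norm (complex_of_real (\<psi> i k x) * X i) \<le> P * norm (X i)"
          unfolding norm_mult norm_of_real using P k by (intro mult_right_mono) auto
      qed
      also have "\<dots> = P * (\<Sum>i\<in>{1..m}. norm (X i))" by (simp add: sum_distrib_left)
      also have "\<dots> \<le> P * S"
        unfolding S X_def using m P(1) by (intro mult_left_mono sum_mono2) auto
      finally show ?thesis .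
    qed
    \<comment> \<open>At a point of maximum |U| \<le> |D| + |Z|. The first part contains at most
      half of \<open>M\<close>, the second is controlled by the end values.\<close>
    have Mb: "M \<le> c3 * (N + S)"
    proof -
      have "M \<le> norm (D k0 x0) + norm (Z k0 x0)"
        using norm_triangle_ineq[of "D k0 x0" "Z k0 x0"] by (simp add: M_def D_def)
      also have "\<dots> \<le> c2 * (\<epsilon> * (N + S + M)) + P * S" by (intro add_mono D1 Zb k0)
      also have "c2 * (\<epsilon> * (N + S + M)) = (c2 * \<epsilon>) * (N + S + M)" by simp
      also have "\<dots> \<le> (1 / 2) * (N + S + M)"
      proof (rule mult_right_mono)
        have "(c2 + 1) * \<epsilon> \<le> (c2 + 1) * \<delta>" using \<epsilon>\<delta> c2 by (intro mult_left_mono) auto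
        also have "\<dots> = 1 / 2" using c2 by (simp add: \<delta>_def)
        finally show "c2 * \<epsilon> \<le> 1 / 2" using \<epsilon> by (simp add: distrib_right)
      qed (use N S0 M0' in auto)
      finally have "M \<le> 1 / 2 * (N + S + M) + P * S" by simp
      then have "M \<le> N + S + 2 * (P * S)" by (simp add: field_simps)
      also have "\<dots> \<le> c3 * (N + S)" unfolding c3_def using P(1) N by (simp add: algebra_simps)
      finally show ?thesis .
    qed
    have D2: "norm (D k x) \<le> c4 * (\<epsilon> * (N + S))" if "k \<in> {1..n}" "x \<in> {0..a k}" for k x
    proof -
      have "\<epsilon> * (N + S + M) \<le> \<epsilon> * ((1 + c3) * (N + S))"
        using Mb \<epsilon> by (intro mult_left_mono) (auto simp: algebra_simps)
      from order_trans[OF D1[OF that] mult_left_mono[OF this c2]] show ?thesis by (simp add: c4_def mult_ac)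
    qed
    have R3: "norm ((\<Sum>k\<in>{1..n}. complex_of_real (\<theta> i k) * p k)
          - complex_of_real lam * (\<Sum>j\<in>{1..m}. complex_of_real (q i j) * U j (a j))) \<le> (2 * c5) * (sqrt \<epsilon> * N + \<epsilon> * S)"
      if i: "i \<in> {1..m}" for i
    proof -
      let ?\<psi> = "\<lambda>k x. complex_of_real (\<psi> i k x)" and ?\<psi>' = "\<lambda>k x. complex_of_real (\<psi>' i k x)"
      \<comment> \<open>The Wronskian of \<open>U\<close> and \<open>\<psi> i\<close>. The
        zero-energy parts cancel in its derivative, the vertex contributions sum to zero because
        both functions satisfy the Kirchhoff conditions, and the Neumann condition of
        \<open>\<psi> i\<close> leaves only the derivative of \<open>U\<close> at the end.\<close>
      define Y where "Y k x = U' k x * ?\<psi> k x - U k x * ?\<psi>' k x" for k x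
      have Yp: "primitive (a k) (Y k) (\<lambda>x. - (R k x * ?\<psi> k x))" if k: "k \<in> {1..n}" for k
      proof -
        note pr = primitive_of_real[OF \<psi>_primitive(1)[OF i k]] primitive_of_real[OF \<psi>_primitive(2)[OF i k]]
        have "primitive (a k) (Y k) (\<lambda>x. ((complex_of_real (Q k x) * U k x - R k x) * ?\<psi> k x + U' k x * ?\<psi>' k x)
          - (U' k x * ?\<psi>' k x + U k x * complex_of_real (Q k x * \<psi> i k x)))"
          unfolding Y_def by (rule primitive_diff[OF primitive_mult[OF U'p[OF k] pr(1)] primitive_mult[OF edge(1)[OF k] pr(2)]])
        then show ?thesis by (rule primitive_cong_deriv) (simp add: algebra_simps)
      qed
      have Y0: "(\<Sum>k\<in>{1..n}. Y k 0) = 0"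
      proof -
        have c: "\<psi> i k 0 = \<psi> i 1 0" if "k \<in> {1..n}" for k
          using z[OF i] that unfolding zero_mode_derivs_def by blast
        have "(\<Sum>k\<in>{1..n}. Y k 0) = (\<Sum>k\<in>{1..n}. U' k 0 * ?\<psi> 1 0 - U 1 0 * ?\<psi>' k 0)"
          unfolding Y_def
        proof (intro sum.cong refl)
          fix k assume k: "k \<in> {1..n}"
          show "U' k 0 * ?\<psi> k 0 - U k 0 * ?\<psi>' k 0 = U' k 0 * ?\<psi> 1 0 - U 1 0 * ?\<psi>' k 0"
            unfolding c[OF k] bspec[OF cont k] ..
        qed
        also have "\<dots> = (\<Sum>k\<in>{1..n}. U' k 0) * ?\<psi> 1 0 - U 1 0 * complex_of_real (\<Sum>k\<in>{1..n}. \<psi>' i k 0)"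
          by (simp add: sum_subtractf sum_distrib_right sum_distrib_left)
        also have "(\<Sum>k\<in>{1..n}. \<psi>' i k 0) = 0" using z[OF i] by (simp add: zero_mode_derivs_def)
        finally show ?thesis using kirch by simp
      qed
      have Ya: "Y k (a k) = complex_of_real \<epsilon> * (complex_of_real (\<theta> i k) * p k)" if k: "k \<in> {1..n}" for k
      proof -
        have "\<psi>' i k (a k) = 0" using z[OF i] k by (auto simp: zero_mode_derivs_def)
        then show ?thesis using edge(5)[OF k] by (simp add: Y_def \<theta>_def)
      qed
      define qk where "qk k j = integral {0..a k} (\<lambda>x. Q k x * \<psi> i k x * \<psi> j k x)" for k j
      \<comment> \<open>Removes from \<open>- R \<psi>\<close> its leading part, the first-order
        coupling acting on the zero mode. That part integrates to the matrix \<open>q\<close>; in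
        what remains every term has a factor \<epsilon>^2 or two factors of order
        \<epsilon>.\<close>
      define G where "G k x = - (R k x * ?\<psi> k x) - complex_of_real (\<epsilon> * lam) * (complex_of_real (Q k x) * ?\<psi> k x * Z k x)" for k x
      have GI: "(G k has_integral (Y k (a k) - Y k 0)
          - complex_of_real (\<epsilon> * lam) * (\<Sum>j\<in>{1..m}. complex_of_real (qk k j) * X j)) {0..a k}" if k: "k \<in> {1..n}" for k
      proof -
        have 1: "((\<lambda>x. - (R k x * ?\<psi> k x)) has_integral Y k (a k) - Y k 0) {0..a k}"
          using integrable_integral[OF absolutely_integrable_on_Icc_imp_integrable[OF primitive_integrable[OF Yp[OF k]]]]
            primitive_eq[OF Yp[OF k], of "a k"] a[OF k] by simp
        have 2: "((\<lambda>x. \<Sum>j\<in>{1..m}. complex_of_real (Q k x * \<psi> i k x * \<psi> j k x) * X j) has_integral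
            (\<Sum>j\<in>{1..m}. complex_of_real (qk k j) * X j)) {0..a k}"
        proof (rule has_integral_sum)
          fix j assume j: "j \<in> {1..m}"
          have "(\<lambda>x. \<psi> j k x * (Q k x * \<psi> i k x)) absolutely_integrable_on {0..a k}"
            by (rule absolutely_integrable_mult_continuous[OF primitive_integrable[OF \<psi>_primitive(2)[OF i k]]
              primitive_continuous[OF \<psi>_primitive(1)[OF j k]]])
          then have "((\<lambda>x. Q k x * \<psi> i k x * \<psi> j k x) has_integral qk k j) {0..a k}"
            unfolding qk_def
            by (intro integrable_integral absolutely_integrable_on_Icc_imp_integrable) (simp add: mult_ac)
          from has_integral_linear[OF this bounded_linear_of_real]
          have "((\<lambda>x. complex_of_real (Q k x * \<psi> i k x * \<psi> j k x)) has_integral complex_of_real (qk k j)) {0..a k}"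
            by (simp add: o_def)
          then show "((\<lambda>x. complex_of_real (Q k x * \<psi> i k x * \<psi> j k x) * X j) has_integral complex_of_real (qk k j) * X j) {0..a k}"
            by (rule has_integral_mult_left)
        qed simp
        have "(\<Sum>j\<in>{1..m}. complex_of_real (Q k x * \<psi> i k x * \<psi> j k x) * X j) = complex_of_real (Q k x) * ?\<psi> k x * Z k x" for x
          by (simp add: Z_def sum_distrib_left mult.assoc)
        with 2 have 3: "((\<lambda>x. complex_of_real (Q k x) * ?\<psi> k x * Z k x) has_integral
            (\<Sum>j\<in>{1..m}. complex_of_real (qk k j) * X j)) {0..a k}" by simp
        show ?thesis unfolding G_def by (intro has_integral_diff 1 has_integral_mult_right 3)
      qed
      have Gb: "norm (integral {0..a k} (G k)) \<le> \<epsilon> * (P * (Am * (L * B * c3 + \<bar>lam\<bar> * B * c4 + norm \<zeta> * c3) * (\<epsilon> * (N + S)) + sqrt \<epsilon> * N))"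
        if k: "k \<in> {1..n}" for k
      proof -
        define e1 where "e1 = (L * B * c3 + \<bar>lam\<bar> * B * c4 + norm \<zeta> * c3) * (\<epsilon>\<^sup>2 * (N + S))"
        have e1: "0 \<le> e1" unfolding e1_def using L B_nonneg c3 c4 N S0 by simp
        have "norm (integral {0..a k} (G k)) \<le> integral {0..a k} (\<lambda>x. P * e1 + (P * \<epsilon>\<^sup>2) * norm (F k x))"
        proof (rule Henstock_Kurzweil_Integration.integral_norm_bound_integral)
          show "G k integrable_on {0..a k}" using GI[OF k] by blast
          show "(\<lambda>x. P * e1 + (P * \<epsilon>\<^sup>2) * norm (F k x)) integrable_on {0..a k}" by (rule const_plus(2)[OF k])
          fix x assume x: "x \<in> {0..a k}"
          \<comment> \<open>The remainder grouped by origin: second-order part of the coupling,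
            deviation from the zero mode, spectral parameter, datum.\<close>
          define H where "H = complex_of_real (l - 1 - \<epsilon> * lam) * (complex_of_real (Q k x) * U k x)
            + complex_of_real (\<epsilon> * lam * Q k x) * D k x - complex_of_real (\<epsilon>\<^sup>2) * (\<zeta> * U k x) - complex_of_real (\<epsilon>\<^sup>2) * F k x"
          have GH: "G k x = H * ?\<psi> k x"
            by (simp add: G_def H_def R_def D_def algebra_simps)
          have "norm H \<le> \<bar>l - 1 - \<epsilon> * lam\<bar> * norm (complex_of_real (Q k x) * U k x)
              + \<bar>\<epsilon> * lam * Q k x\<bar> * norm (D k x) + \<epsilon>\<^sup>2 * (norm \<zeta> * norm (U k x)) + \<epsilon>\<^sup>2 * norm (F k x)"
          proof -
            have n3: "norm (A + B' - C' - D'') \<le> norm A + norm B' + norm C' + norm D''" for A B' C' D'' :: complex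
              using norm_triangle_ineq[of A B'] norm_triangle_ineq4[of "A + B'" C'] norm_triangle_ineq4[of "A + B' - C'" D''] by linarith
            show ?thesis unfolding H_def
              by (rule order_trans[OF n3]) (simp only: norm_mult norm_of_real abs_power2 order_refl)
          qed
          also have "\<dots> \<le> (L * \<epsilon>\<^sup>2) * (B * (c3 * (N + S))) + (\<epsilon> * \<bar>lam\<bar> * B) * (c4 * (\<epsilon> * (N + S)))
              + \<epsilon>\<^sup>2 * (norm \<zeta> * (c3 * (N + S))) + \<epsilon>\<^sup>2 * norm (F k x)"
          proof (intro add_mono order_refl)
            have "norm (complex_of_real (Q k x) * U k x) \<le> B * (c3 * (N + S))"
              using QM[OF k x] mult_left_mono[OF Mb B_nonneg] by simp
            then show "\<bar>l - 1 - \<epsilon> * lam\<bar> * norm (complex_of_real (Q k x) * U k x) \<le> (L * \<epsilon>\<^sup>2) * (B * (c3 * (N + S)))"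
              using l L by (intro mult_mono) auto
            have "\<bar>\<epsilon> * lam * Q k x\<bar> \<le> \<epsilon> * \<bar>lam\<bar> * B"
              unfolding abs_mult using Q_bdd[OF k, of x] x \<epsilon> by (intro mult_mono) auto
            then show "\<bar>\<epsilon> * lam * Q k x\<bar> * norm (D k x) \<le> (\<epsilon> * \<bar>lam\<bar> * B) * (c4 * (\<epsilon> * (N + S)))"
              using D2[OF k x] \<epsilon> B_nonneg by (intro mult_mono) auto
            show "\<epsilon>\<^sup>2 * (norm \<zeta> * norm (U k x)) \<le> \<epsilon>\<^sup>2 * (norm \<zeta> * (c3 * (N + S)))"
              using M[OF k x] Mb by (intro mult_left_mono) auto
          qed
          also have "\<dots> = e1 + \<epsilon>\<^sup>2 * norm (F k x)"
            by (simp add: e1_def algebra_simps power2_eq_square)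
          finally have "norm H \<le> e1 + \<epsilon>\<^sup>2 * norm (F k x)" .
          then have "norm H * \<bar>\<psi> i k x\<bar> \<le> (e1 + \<epsilon>\<^sup>2 * norm (F k x)) * P"
            using P(2) i k x e1 by (intro mult_mono) auto
          then show "norm (G k x) \<le> P * e1 + (P * \<epsilon>\<^sup>2) * norm (F k x)"
            unfolding GH norm_mult norm_of_real by (simp add: algebra_simps)
        qed
        also have "\<dots> = a k * (P * e1) + P * (\<epsilon>\<^sup>2 * integral {0..a k} (\<lambda>x. norm (F k x)))"
          by (simp add: const_plus(1)[OF k])
        also have "\<dots> \<le> Am * (P * e1) + P * (\<epsilon> * (sqrt \<epsilon> * N))"
          using Am[OF k] P(1) e1 \<epsilon>F[OF k] by (intro add_mono mult_right_mono mult_left_mono) auto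
        also have "\<dots> = \<epsilon> * (P * (Am * (L * B * c3 + \<bar>lam\<bar> * B * c4 + norm \<zeta> * c3) * (\<epsilon> * (N + S)) + sqrt \<epsilon> * N))"
          by (simp add: e1_def algebra_simps power2_eq_square)
        finally show ?thesis .
      qed
      \<comment> \<open>The factor \<epsilon> on the left is divided out afterwards, which turns the
        \<epsilon>^(3/2) of the datum term into \<surd>\<epsilon>.\<close>
      have sumG: "complex_of_real \<epsilon> * ((\<Sum>k\<in>{1..n}. complex_of_real (\<theta> i k) * p k)
          - complex_of_real lam * (\<Sum>j\<in>{1..m}. complex_of_real (q i j) * U j (a j))) = (\<Sum>k\<in>{1..n}. integral {0..a k} (G k))"
      proof -
        have q: "complex_of_real (q i j) = (\<Sum>k\<in>{1..n}. complex_of_real (qk k j))" for j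
          by (simp add: q_def qk_def)
        have "(\<Sum>k\<in>{1..n}. integral {0..a k} (G k)) = (\<Sum>k\<in>{1..n}. (Y k (a k) - Y k 0)
            - complex_of_real (\<epsilon> * lam) * (\<Sum>j\<in>{1..m}. complex_of_real (qk k j) * X j))"
          by (intro sum.cong refl integral_unique GI)
        also have "\<dots> = (\<Sum>k\<in>{1..n}. Y k (a k)) - (\<Sum>k\<in>{1..n}. Y k 0)
            - complex_of_real (\<epsilon> * lam) * (\<Sum>k\<in>{1..n}. \<Sum>j\<in>{1..m}. complex_of_real (qk k j) * X j)"
          by (simp add: sum_subtractf sum_distrib_left)
        also have "(\<Sum>k\<in>{1..n}. \<Sum>j\<in>{1..m}. complex_of_real (qk k j) * X j) = (\<Sum>j\<in>{1..m}. complex_of_real (q i j) * X j)"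
          unfolding q sum_distrib_right by (rule sum.swap)
        also have "(\<Sum>k\<in>{1..n}. Y k (a k)) = complex_of_real \<epsilon> * (\<Sum>k\<in>{1..n}. complex_of_real (\<theta> i k) * p k)"
          unfolding sum_distrib_left using Ya by (intro sum.cong) auto
        finally show ?thesis unfolding Y0 X_def by (simp add: algebra_simps)
      qed
      define \<tau> where "\<tau> = norm ((\<Sum>k\<in>{1..n}. complex_of_real (\<theta> i k) * p k)
          - complex_of_real lam * (\<Sum>j\<in>{1..m}. complex_of_real (q i j) * U j (a j)))"
      define c6 where "c6 = Am * (L * B * c3 + \<bar>lam\<bar> * B * c4 + norm \<zeta> * c3)"
      have c6: "0 \<le> c6" unfolding c6_def using Am0 L B_nonneg c3 c4 by simp
      have "\<epsilon> * \<tau> = norm (\<Sum>k\<in>{1..n}. integral {0..a k} (G k))"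
        unfolding \<tau>_def sumG[symmetric] norm_mult using \<epsilon> by simp
      also have "\<dots> \<le> (\<Sum>k\<in>{1..n}. \<epsilon> * (P * (c6 * (\<epsilon> * (N + S)) + sqrt \<epsilon> * N)))"
        unfolding c6_def by (rule order_trans[OF norm_sum], intro sum_mono Gb)
      also have "\<dots> = \<epsilon> * (n * (P * (c6 * (\<epsilon> * (N + S)) + sqrt \<epsilon> * N)))" by simp
      finally have "\<tau> \<le> n * (P * (c6 * (\<epsilon> * (N + S)) + sqrt \<epsilon> * N))"
        using \<epsilon> by (simp only: mult_le_cancel_left_pos)
      also have "\<dots> \<le> n * (P * ((c6 + 1) * (2 * (sqrt \<epsilon> * N + \<epsilon> * S))))"
      proof (intro mult_left_mono)
        have b: "\<epsilon> * (N + S) \<le> sqrt \<epsilon> * N + \<epsilon> * S" using mult_right_mono[OF \<epsilon>s N] by (simp add: algebra_simps)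
        have nn: "0 \<le> sqrt \<epsilon> * N" "0 \<le> \<epsilon> * S" using \<epsilon> N S0 by auto
        have "c6 * (\<epsilon> * (N + S)) \<le> c6 * (sqrt \<epsilon> * N + \<epsilon> * S)" using b c6 by (rule mult_left_mono)
        moreover have "0 \<le> c6 * (sqrt \<epsilon> * N + \<epsilon> * S)" using c6 nn by simp
        moreover define X where "X = sqrt \<epsilon> * N + \<epsilon> * S"
        moreover have "(c6 + 1) * (2 * X) = c6 * X + c6 * X + 2 * X" by (simp add: algebra_simps)
        moreover have "sqrt \<epsilon> * N \<le> X" "0 \<le> X" using nn by (simp_all add: X_def)
        ultimately show "c6 * (\<epsilon> * (N + S)) + sqrt \<epsilon> * N \<le> (c6 + 1) * (2 * (sqrt \<epsilon> * N + \<epsilon> * S))"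
          by (fold X_def) linarith
      qed (use P in auto)
      also have "\<dots> = (2 * c5) * (sqrt \<epsilon> * N + \<epsilon> * S)"
        unfolding c5_def c6_def by (simp add: algebra_simps)
      finally show ?thesis unfolding \<tau>_def .
    qed
    have R2: "norm (U j (a j) - (\<Sum>i\<in>{1..m}. complex_of_real (\<theta> i j) * U i (a i))) \<le> c4 * (\<epsilon> * (N + S))" if j: "j \<in> {1..n}" for j
      using D2[OF j, of "a j"] a[OF j] by (simp add: D_def Z_def X_def \<theta>_def)
    have R1: "norm (U k x) \<le> c3 * (N + S)" if "k \<in> {1..n}" "x \<in> {0..a k}" for k x
      using M[OF that] Mb by simp
    show ?thesis using R1 R2 R3 by blast
  qed
  have C: "c3 \<le> C" "c4 \<le> C" "2 * c5 \<le> C" "0 \<le> C" using c3 c4 c5 by (auto simp: C_def)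
  show ?thesis
  proof (rule exI[of _ C], rule conjI[OF C(4)], rule exI[of _ \<delta>], rule conjI[OF \<delta>], intro allI impI)
    fix \<epsilon> l N and U U' F :: "nat \<Rightarrow> real \<Rightarrow> complex" and p
    assume sd: "scaled_data \<epsilon> l N U U' F p" and \<epsilon>\<delta>: "\<epsilon> \<le> \<delta>"
    define S where "S = (\<Sum>k\<in>{1..n}. norm (U k (a k)))"
    have S0: "0 \<le> S" unfolding S_def by (intro sum_nonneg) auto
    have nn: "0 \<le> N + S" "0 \<le> \<epsilon> * (N + S)" "0 \<le> sqrt \<epsilon> * N + \<epsilon> * S"
      using sd S0 by (auto simp: scaled_data_def)
    note up = mult_right_mono[OF C(1) nn(1)] mult_right_mono[OF C(2) nn(2)] mult_right_mono[OF C(3) nn(3)]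
    show "let S = (\<Sum>k\<in>{1..n}. norm (U k (a k))) in
      (\<forall>k\<in>{1..n}. \<forall>x\<in>{0..a k}. norm (U k x) \<le> C * (N + S)) \<and>
      (\<forall>j\<in>{1..n}. norm (U j (a j) - (\<Sum>i\<in>{1..m}. complex_of_real (\<theta> i j) * U i (a i))) \<le> C * (\<epsilon> * (N + S))) \<and>
      (\<forall>i\<in>{1..m}. norm ((\<Sum>k\<in>{1..n}. complex_of_real (\<theta> i k) * p k)
          - complex_of_real lam * (\<Sum>j\<in>{1..m}. complex_of_real (q i j) * U j (a j))) \<le> C * (sqrt \<epsilon> * N + \<epsilon> * S))"
      unfolding Let_def S_def[symmetric]
      using main[OF sd \<epsilon>\<delta> S_def] up by (intro conjI ballI) (blast intro: order_trans)+
  qed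
qed

end

section \<open>Convergence of the resolvents\<close>

lemma primitive_diff_bound:
  assumes F: "primitive b F f" and x: "x \<in> {0..b}" and h: "h integrable_on {0..x}"
    and le: "\<And>t. t \<in> {0..x} \<Longrightarrow> norm (f t) \<le> h t"
  shows "norm (F x - F 0) \<le> integral {0..x} h"
proof -
  have "f integrable_on {0..x}"
    using absolutely_integrable_on_subinterval[OF primitive_integrable[OF F], of 0 x] x
    by (auto intro: absolutely_integrable_on_Icc_imp_integrable)
  then have "norm (integral {0..x} f) \<le> integral {0..x} h"
    using h le by (rule Henstock_Kurzweil_Integration.integral_norm_bound_integral)
  then show ?thesis using primitive_eq[OF F x] by simp
qed

lemma scaled_argument_integral:
  fixes h :: "real \<Rightarrow> 'a::euclidean_space"
  assumes h: "h absolutely_integrable_on {0..e * b}" and e: "0 < e" and b: "0 \<le> b"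
  shows "(\<lambda>x. h (e * x)) absolutely_integrable_on {0..b}"
    and "e *\<^sub>R integral {0..b} (\<lambda>x. h (e * x)) = integral {0..e * b} h"
proof -
  have "primitive (e * b) (\<lambda>x. integral {0..x} h) h" using h by (simp add: primitive_def)
  note p = primitive_scaled_argument[OF this e]
  have "(\<lambda>x. (1 / e) *\<^sub>R (e *\<^sub>R h (e * x))) absolutely_integrable_on {0..b}"
    by (rule absolutely_integrable_scaleR_left[OF primitive_integrable[OF p]])
  then show "(\<lambda>x. h (e * x)) absolutely_integrable_on {0..b}" using e by simp
  show "e *\<^sub>R integral {0..b} (\<lambda>x. h (e * x)) = integral {0..e * b} h"
    using primitive_eq[OF p, of b] b by simp
qed

lemma L1_le_L2:
  fixes f :: "real \<Rightarrow> complex"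
  assumes f: "L2_on {0..} f" and b: "0 \<le> b"
  shows "integral {0..b} (\<lambda>x. norm (f x)) \<le> sqrt b * sqrt (integral {0..} (\<lambda>x. (norm (f x))\<^sup>2))"
proof -
  have fb: "L2_on {0..b} f" by (rule L2_on_subset[OF f]) auto
  have one: "L2_on {0..b} (\<lambda>_. 1 :: complex)" by (intro L2_on_continuous continuous_on_const)
  have le: "integral {0..b} (\<lambda>x. (norm (f x))\<^sup>2) \<le> integral {0..} (\<lambda>x. (norm (f x))\<^sup>2)"
    using L2_on_square_integrable[OF fb] L2_on_square_integrable[OF f] by (intro integral_subset_le) auto
  have "(integral {0..b} (\<lambda>x. norm (f x)))\<^sup>2 \<le> integral {0..b} (\<lambda>x. (norm (f x))\<^sup>2) * b"
    using L2_on_cauchy_schwarz(2)[OF fb one] b by simp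
  also have "\<dots> \<le> integral {0..} (\<lambda>x. (norm (f x))\<^sup>2) * b" using le b by (rule mult_right_mono)
  finally have "integral {0..b} (\<lambda>x. norm (f x)) \<le> sqrt (integral {0..} (\<lambda>x. (norm (f x))\<^sup>2) * b)"
    by (rule real_le_rsqrt)
  then show ?thesis by (simp add: real_sqrt_mult mult.commute)
qed

text \<open>The identity for the derivative of |w|^2 is integrated directly; dropping |w(c)|^2 makes
  the bound uniform in the cut-off \<open>c\<close>.\<close>

lemma exponential_decay_L2:
  fixes w :: "real \<Rightarrow> complex"
  assumes w: "\<And>c. primitive c w w'" and dec: "\<And>x. b \<le> x \<Longrightarrow> w' x = - \<kappa> * w x"
    and \<kappa>: "0 < Re \<kappa>" and b: "0 \<le> b" "b \<le> c"
  shows "integral {b..c} (\<lambda>x. (norm (w x))\<^sup>2) \<le> (norm (w b))\<^sup>2 / (2 * Re \<kappa>)"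
proof -
  have "(norm (w c))\<^sup>2 = (norm (w b))\<^sup>2 + integral {b..c} (\<lambda>x. 2 * Re (w' x * cnj (w x)))"
    by (rule primitive_increment[OF primitive_norm_square[OF w] b order_refl])
  also have "integral {b..c} (\<lambda>x. 2 * Re (w' x * cnj (w x))) = integral {b..c} (\<lambda>x. - (2 * Re \<kappa>) * (norm (w x))\<^sup>2)"
  proof (rule Henstock_Kurzweil_Integration.integral_cong)
    fix x assume "x \<in> {b..c}"
    then have "w' x = - \<kappa> * w x" by (intro dec) auto
    then show "2 * Re (w' x * cnj (w x)) = - (2 * Re \<kappa>) * (norm (w x))\<^sup>2"
      using Re_mult_norm_square[of "- \<kappa>" "w x"] by simp
  qed
  also have "\<dots> = - (2 * Re \<kappa>) * integral {b..c} (\<lambda>x. (norm (w x))\<^sup>2)" by (rule integral_mult_right)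
  finally have "2 * Re \<kappa> * integral {b..c} (\<lambda>x. (norm (w x))\<^sup>2) \<le> (norm (w b))\<^sup>2"
    using zero_le_power2[of "norm (w c)"] by linarith
  then show ?thesis using \<kappa> by (simp add: field_simps)
qed

text \<open>The form of \<open>M0\<close> comes from \<open>p = g - \<kappa> X\<close> at the ends
  of the small star: the first summand is the constant in \<open>tail_transform_bound\<close>, the
  second multiplies the end value.\<close>

locale star_limit = scaled_star +
  fixes \<kappa> :: complex
  assumes Q_supp: "\<And>k x. k \<in> {1..n} \<Longrightarrow> a k < x \<Longrightarrow> Q k x = 0"
    and \<zeta>: "Im \<zeta> \<noteq> 0" and \<kappa>: "0 < Re \<kappa>" "\<kappa>\<^sup>2 = - \<zeta>"
    and M0_eq: "M0 = 1 / sqrt (2 * Re \<kappa>) + norm \<kappa>"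
begin

lemma Im_\<kappa>: "Im \<kappa> \<noteq> 0"
proof
  assume "Im \<kappa> = 0"
  then have "Im (\<kappa>\<^sup>2) = 0" by (simp add: power2_eq_square)
  then show False using \<kappa>(2) \<zeta> by simp
qed

lemma \<theta>_delta: "i \<in> {1..m} \<Longrightarrow> j \<in> {1..m} \<Longrightarrow> \<theta> i j = (if i = j then 1 else 0)"
  by (simp add: \<theta>_def \<psi>_delta)

lemma q_symmetric: "q i j = q j i"
  by (simp add: q_def mult_ac)

lemma quadratic_form_real:
  "Im (\<Sum>i\<in>{1..m}. cnj (Y i) * (\<Sum>j\<in>{1..m}. complex_of_real (q i j) * Y j)) = 0"
proof -
  let ?T = "\<lambda>Y. \<Sum>i\<in>{1..m}. cnj (Y i) * (\<Sum>j\<in>{1..m}. complex_of_real (q i j) * Y j)"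
  have "cnj (?T Y) = (\<Sum>i\<in>{1..m}. \<Sum>j\<in>{1..m}. Y i * (complex_of_real (q i j) * cnj (Y j)))"
    by (simp add: sum_distrib_left)
  also have "\<dots> = (\<Sum>j\<in>{1..m}. \<Sum>i\<in>{1..m}. Y i * (complex_of_real (q i j) * cnj (Y j)))" by (rule sum.swap)
  also have "\<dots> = ?T Y"
    unfolding sum_distrib_left
  proof (intro sum.cong refl)
    show "Y i * (complex_of_real (q i j) * cnj (Y j)) = cnj (Y j) * (complex_of_real (q j i) * Y i)" for i j
      using q_symmetric[of i j] by simp
  qed
  finally have "cnj (?T Y) = ?T Y" .
  from arg_cong[OF this, of Im] show ?thesis by (simp only: cnj.simps)
qed

lemma sum_\<theta>_left:
  fixes x :: "nat \<Rightarrow> complex"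
  assumes "i \<in> {1..m}"
  shows "(\<Sum>k\<in>{1..n}. complex_of_real (\<theta> i k) * x k) = x i + (\<Sum>j\<in>{m+1..n}. complex_of_real (\<theta> i j) * x j)"
proof -
  have "{1..n} = {1..m} \<union> {m+1..n}" using m by auto
  then have "(\<Sum>k\<in>{1..n}. complex_of_real (\<theta> i k) * x k)
      = (\<Sum>k\<in>{1..m}. complex_of_real (\<theta> i k) * x k) + (\<Sum>j\<in>{m+1..n}. complex_of_real (\<theta> i j) * x j)"
    by (simp add: sum.union_disjoint)
  also have "(\<Sum>k\<in>{1..m}. complex_of_real (\<theta> i k) * x k) = (\<Sum>k\<in>{1..m}. if k = i then x i else 0)"
    using \<theta>_delta[OF assms] by (intro sum.cong) auto
  finally show ?thesis using assms by simp
qed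

lemma sum_\<theta>_right:
  fixes x :: "nat \<Rightarrow> complex"
  assumes "j \<in> {1..m}"
  shows "(\<Sum>i\<in>{1..m}. complex_of_real (\<theta> i j) * x i) = x j"
proof -
  have "(\<Sum>i\<in>{1..m}. complex_of_real (\<theta> i j) * x i) = (\<Sum>i\<in>{1..m}. if i = j then x j else 0)"
    using \<theta>_delta[OF _ assms] by (intro sum.cong) auto
  then show ?thesis using assms by simp
qed

text \<open>The value and flux conditions are dual to each other: when the values lie in the range
  of \<open>\<theta>\<close>, pairing with them moves the matrix onto the derivatives. The identity
  serves both the coercivity estimate and the symmetry of the limit operator.\<close>

lemma boundary_form:
  assumes "\<And>j. j \<in> {1..n} \<Longrightarrow> c j = (\<Sum>i\<in>{1..m}. complex_of_real (\<theta> i j) * c' i)"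
  shows "(\<Sum>k\<in>{1..n}. p k * cnj (c k)) = (\<Sum>i\<in>{1..m}. cnj (c' i) * (\<Sum>k\<in>{1..n}. complex_of_real (\<theta> i k) * p k))"
proof -
  have "(\<Sum>k\<in>{1..n}. p k * cnj (c k)) = (\<Sum>k\<in>{1..n}. \<Sum>i\<in>{1..m}. p k * (complex_of_real (\<theta> i k) * cnj (c' i)))"
    using assms by (intro sum.cong) (auto simp: sum_distrib_left)
  also have "\<dots> = (\<Sum>i\<in>{1..m}. \<Sum>k\<in>{1..n}. p k * (complex_of_real (\<theta> i k) * cnj (c' i)))" by (rule sum.swap)
  also have "\<dots> = (\<Sum>i\<in>{1..m}. cnj (c' i) * (\<Sum>k\<in>{1..n}. complex_of_real (\<theta> i k) * p k))"
    by (simp add: sum_distrib_left mult_ac)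
  finally show ?thesis .
qed

text \<open>The matrix of the limit vertex conditions, applied to outgoing waves, is bounded below because its
  quadratic form is \<open>\<kappa> |Y|\<^sup>2\<close> plus a real number.\<close>

lemma coercive:
  assumes e: "\<And>j. j \<in> {1..n} \<Longrightarrow> Y j = (\<Sum>i\<in>{1..m}. complex_of_real (\<theta> i j) * Y i) + e j"
    and \<rho>: "\<And>i. i \<in> {1..m} \<Longrightarrow> (\<Sum>k\<in>{1..n}. complex_of_real (\<theta> i k) * (\<kappa> * Y k))
      + complex_of_real lam * (\<Sum>j\<in>{1..m}. complex_of_real (q i j) * Y j) = \<rho> i"
  shows "\<bar>Im \<kappa>\<bar> * (\<Sum>k\<in>{1..n}. norm (Y k)) \<le> n * (norm \<kappa> * (\<Sum>k\<in>{1..n}. norm (e k)) + (\<Sum>i\<in>{1..m}. norm (\<rho> i)))"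
proof -
  define s where "s = (\<Sum>k\<in>{1..n}. norm (Y k))"
  define s2 where "s2 = (\<Sum>k\<in>{1..n}. (norm (Y k))\<^sup>2)"
  define r where "r = norm \<kappa> * (\<Sum>k\<in>{1..n}. norm (e k)) + (\<Sum>i\<in>{1..m}. norm (\<rho> i))"
  define T where "T = (\<Sum>i\<in>{1..m}. cnj (Y i) * (\<Sum>j\<in>{1..m}. complex_of_real (q i j) * Y j))"
  have Ys: "norm (Y k) \<le> s" if "k \<in> {1..n}" for k unfolding s_def using that by (intro member_le_sum) auto
  have s0: "0 \<le> s" unfolding s_def by (intro sum_nonneg) auto
  have r0: "0 \<le> r" unfolding r_def by (intro add_nonneg_nonneg mult_nonneg_nonneg sum_nonneg) auto
  \<comment> \<open>Subtracting the error \<open>e\<close> places the values exactly in the range of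
    \<open>\<theta>\<close>, so that \<open>boundary_form\<close> applies with the derivatives
    replaced by \<open>\<kappa> * Y k\<close>.\<close>
  have "(\<Sum>k\<in>{1..n}. \<kappa> * Y k * cnj (Y k - e k))
      = (\<Sum>i\<in>{1..m}. cnj (Y i) * (\<Sum>k\<in>{1..n}. complex_of_real (\<theta> i k) * (\<kappa> * Y k)))"
    by (rule boundary_form) (simp add: e[symmetric] algebra_simps, use e in \<open>simp add: algebra_simps\<close>)
  also have "\<dots> = (\<Sum>i\<in>{1..m}. cnj (Y i) * \<rho> i - complex_of_real lam * (cnj (Y i) * (\<Sum>j\<in>{1..m}. complex_of_real (q i j) * Y j)))"
    by (intro sum.cong refl) (simp add: \<rho>[symmetric] algebra_simps)
  also have "\<dots> = (\<Sum>i\<in>{1..m}. cnj (Y i) * \<rho> i) - complex_of_real lam * T"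
    by (simp add: T_def sum_subtractf sum_distrib_left)
  finally have "(\<Sum>k\<in>{1..n}. \<kappa> * Y k * cnj (Y k)) - (\<Sum>k\<in>{1..n}. \<kappa> * Y k * cnj (e k))
      = (\<Sum>i\<in>{1..m}. cnj (Y i) * \<rho> i) - complex_of_real lam * T"
    by (simp add: right_diff_distrib sum_subtractf)
  moreover have "(\<Sum>k\<in>{1..n}. \<kappa> * Y k * cnj (Y k)) = \<kappa> * complex_of_real s2"
    by (simp add: s2_def sum_distrib_left mult.assoc complex_norm_square[symmetric])
  ultimately have eq: "\<kappa> * complex_of_real s2 + complex_of_real lam * T
      = (\<Sum>k\<in>{1..n}. \<kappa> * Y k * cnj (e k)) + (\<Sum>i\<in>{1..m}. cnj (Y i) * \<rho> i)"
    by (simp add: algebra_simps)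
  have "Im T = 0" unfolding T_def by (rule quadratic_form_real)
  then have "Im \<kappa> * s2 = Im (\<kappa> * complex_of_real s2 + complex_of_real lam * T)" by simp
  also have "\<bar>\<dots>\<bar> \<le> norm (\<kappa> * complex_of_real s2 + complex_of_real lam * T)" by (rule abs_Im_le_cmod)
  also have "\<dots> \<le> (\<Sum>k\<in>{1..n}. norm (\<kappa> * Y k * cnj (e k))) + (\<Sum>i\<in>{1..m}. norm (cnj (Y i) * \<rho> i))"
    unfolding eq by (intro order_trans[OF norm_triangle_ineq] add_mono norm_sum)
  also have "\<dots> \<le> (\<Sum>k\<in>{1..n}. norm \<kappa> * s * norm (e k)) + (\<Sum>i\<in>{1..m}. s * norm (\<rho> i))"
  proof (intro add_mono sum_mono)
    show "norm (\<kappa> * Y k * cnj (e k)) \<le> norm \<kappa> * s * norm (e k)" if "k \<in> {1..n}" for k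
      unfolding norm_mult complex_mod_cnj using Ys[OF that] by (intro mult_right_mono mult_left_mono) auto
    show "norm (cnj (Y i) * \<rho> i) \<le> s * norm (\<rho> i)" if "i \<in> {1..m}" for i
      unfolding norm_mult complex_mod_cnj using Ys[of i] that m by (intro mult_right_mono) auto
  qed
  also have "\<dots> = s * r" by (simp add: r_def distrib_left sum_distrib_left mult_ac)
  finally have 1: "\<bar>Im \<kappa>\<bar> * s2 \<le> s * r" by (simp add: abs_mult s2_def sum_nonneg)
  \<comment> \<open>The imaginary part controls the sum of squares; passing to the sum of norms
    costs the factor \<open>n\<close>, after which one power of \<open>s\<close> is
    cancelled.\<close>
  have 2: "s\<^sup>2 \<le> s2 * n"
    unfolding s_def s2_def using sum_squared_le_sum_of_squares[of "\<lambda>k. norm (Y k)" "{1..n}"] by simp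
  have "\<bar>Im \<kappa>\<bar> * s \<le> n * r"
  proof (cases "s = 0")
    case True then show ?thesis using r0 by simp
  next
    case False
    then have s: "0 < s" using s0 by simp
    have "\<bar>Im \<kappa>\<bar> * s\<^sup>2 \<le> \<bar>Im \<kappa>\<bar> * (s2 * n)" using 2 by (rule mult_left_mono) simp
    also have "\<dots> = n * (\<bar>Im \<kappa>\<bar> * s2)" by simp
    also have "\<dots> \<le> n * (s * r)" using 1 by (rule mult_left_mono) simp
    finally have "s * (\<bar>Im \<kappa>\<bar> * s) \<le> s * (n * r)" by (simp add: power2_eq_square mult_ac)
    then show ?thesis using s by (simp only: mult_le_cancel_left_pos)
  qed
  then show ?thesis unfolding s_def r_def .
qed

section \<open>Solutions of the two resolvent equations and their bounds\<close>

definition eps_sol where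
  "eps_sol \<epsilon> l f u u' \<longleftrightarrow>
    (\<forall>k\<in>{1..n}. edge_sol (\<lambda>x. complex_of_real (l / \<epsilon>^2 * Q k (x / \<epsilon>)) - \<zeta>) (f k) (u k) (u' k)) \<and>
    (\<forall>k\<in>{1..n}. u k 0 = u 1 0) \<and> (\<Sum>k\<in>{1..n}. u' k 0) = 0"

text \<open>The zero potential is written out so that the edge condition has the shape used in
  \<open>star_resolvent\<close>.\<close>

definition lim_sol where
  "lim_sol f u u' \<longleftrightarrow>
    (\<forall>k\<in>{1..n}. edge_sol (\<lambda>x. complex_of_real 0 - \<zeta>) (f k) (u k) (u' k)) \<and>
    (\<forall>j\<in>{m+1..n}. u j 0 - (\<Sum>i\<in>{1..m}. complex_of_real (\<theta> i j) * u i 0) = 0) \<and>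
    (\<forall>i\<in>{1..m}. u' i 0 + (\<Sum>j\<in>{m+1..n}. complex_of_real (\<theta> i j) * u' j 0)
       - complex_of_real lam * (\<Sum>j\<in>{1..m}. complex_of_real (q i j) * u j 0) = 0)"

lemma lim_sol_vertex:
  assumes "lim_sol f v v'"
  shows "j \<in> {1..n} \<Longrightarrow> v j 0 = (\<Sum>i\<in>{1..m}. complex_of_real (\<theta> i j) * v i 0)"
    and "i \<in> {1..m} \<Longrightarrow> (\<Sum>k\<in>{1..n}. complex_of_real (\<theta> i k) * v' k 0)
      = complex_of_real lam * (\<Sum>j\<in>{1..m}. complex_of_real (q i j) * v j 0)"
proof -
  show "v j 0 = (\<Sum>i\<in>{1..m}. complex_of_real (\<theta> i j) * v i 0)" if "j \<in> {1..n}"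
  proof (cases "j \<le> m")
    case True then show ?thesis using sum_\<theta>_right[of j "\<lambda>i. v i 0"] that by simp
  next
    case False then show ?thesis using assms that by (simp add: lim_sol_def)
  qed
  show "(\<Sum>k\<in>{1..n}. complex_of_real (\<theta> i k) * v' k 0)
      = complex_of_real lam * (\<Sum>j\<in>{1..m}. complex_of_real (q i j) * v j 0)" if "i \<in> {1..m}"
    unfolding sum_\<theta>_left[OF that] using assms that by (simp add: lim_sol_def)
qed

text \<open>The norm of the graph with the gauge integral in place of the Lebesgue integral; both
  agree on square integrable data by \<open>L2norm_graph_eq_Nf\<close>.\<close>

definition Nf :: "(nat \<Rightarrow> real \<Rightarrow> complex) \<Rightarrow> real" where
  "Nf f = sqrt (\<Sum>k\<in>{1..n}. integral {0..} (\<lambda>x. (norm (f k x))\<^sup>2))"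

definition Am :: real where "Am = (\<Sum>k\<in>{1..n}. a k)"

definition Th :: real where "Th = (\<Sum>i\<in>{1..m}. \<Sum>k\<in>{1..n}. \<bar>\<theta> i k\<bar>)"

lemma a_le_Am: "k \<in> {1..n} \<Longrightarrow> a k \<le> Am"
  unfolding Am_def using a by (intro member_le_sum) (auto intro: less_imp_le)

lemma Am_pos: "0 < Am"
  using a_le_Am[of 1] a[of 1] n by simp

lemma Th_nonneg: "0 \<le> Th"
  unfolding Th_def by (intro sum_nonneg) auto

lemma sum_\<theta>_bound:
  fixes x :: "nat \<Rightarrow> complex"
  assumes "\<And>k. k \<in> {1..n} \<Longrightarrow> norm (x k) \<le> y"
  shows "(\<Sum>i\<in>{1..m}. norm (\<Sum>k\<in>{1..n}. complex_of_real (\<theta> i k) * x k)) \<le> Th * y"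
  unfolding Th_def sum_distrib_right
proof (intro sum_mono order_trans[OF norm_sum])
  fix i k assume "k \<in> {1..n}"
  then show "norm (complex_of_real (\<theta> i k) * x k) \<le> \<bar>\<theta> i k\<bar> * y"
    unfolding norm_mult norm_of_real using assms by (intro mult_left_mono) auto
qed

context
  fixes f :: "nat \<Rightarrow> real \<Rightarrow> complex"
  assumes f: "\<forall>k\<in>{1..n}. L2_on {0..} (f k)"
begin

lemma f_square_nonneg: "k \<in> {1..n} \<Longrightarrow> 0 \<le> integral {0..} (\<lambda>x. (norm (f k x))\<^sup>2)"
  using f by (intro Henstock_Kurzweil_Integration.integral_nonneg L2_on_square_integrable) auto

lemma Nf_nonneg: "0 \<le> Nf f"
  unfolding Nf_def using f_square_nonneg by (intro real_sqrt_ge_zero sum_nonneg)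

lemma Nf_square: "(Nf f)\<^sup>2 = (\<Sum>k\<in>{1..n}. integral {0..} (\<lambda>x. (norm (f k x))\<^sup>2))"
  unfolding Nf_def using f_square_nonneg by (intro real_sqrt_pow2 sum_nonneg)

lemma sqrt_le_Nf: "k \<in> {1..n} \<Longrightarrow> sqrt (integral {0..} (\<lambda>x. (norm (f k x))\<^sup>2)) \<le> Nf f"
  unfolding Nf_def using f_square_nonneg by (intro real_sqrt_le_mono member_le_sum) auto

lemma g_bound:
  assumes k: "k \<in> {1..n}" and x: "0 \<le> x"
  shows "norm (tail_transform \<kappa> (f k) x) \<le> M0 * Nf f"
    and "0 \<le> y \<Longrightarrow> norm (tail_transform \<kappa> (f k) x) + norm \<kappa> * y \<le> M0 * (Nf f + y)"
proof -
  have "norm (tail_transform \<kappa> (f k) x) \<le> sqrt (integral {0..} (\<lambda>t. (norm (f k t))\<^sup>2) / (2 * Re \<kappa>))"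
    by (rule tail_transform_bound[OF \<kappa>(1) bspec[OF f k] x])
  also have "\<dots> = 1 / sqrt (2 * Re \<kappa>) * sqrt (integral {0..} (\<lambda>t. (norm (f k t))\<^sup>2))"
    by (simp add: real_sqrt_divide)
  also have "\<dots> \<le> 1 / sqrt (2 * Re \<kappa>) * Nf f"
    using \<kappa>(1) by (intro mult_left_mono sqrt_le_Nf k) auto
  finally have 1: "norm (tail_transform \<kappa> (f k) x) \<le> 1 / sqrt (2 * Re \<kappa>) * Nf f" .
  have 2: "0 \<le> norm \<kappa> * Nf f" using Nf_nonneg by simp
  show "norm (tail_transform \<kappa> (f k) x) \<le> M0 * Nf f"
    unfolding M0_eq distrib_right using 1 2 by linarith
  have 3: "0 \<le> 1 / sqrt (2 * Re \<kappa>) * y" if "0 \<le> y" for y using \<kappa>(1) that by simp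
  show "norm (tail_transform \<kappa> (f k) x) + norm \<kappa> * y \<le> M0 * (Nf f + y)" if "0 \<le> y"
    unfolding M0_eq distrib_right distrib_left using 1 2 3[OF that] by linarith
qed

text \<open>Since \<open>g' = \<kappa> g - f\<close> with \<open>g\<close> bounded, the first term
  contributes order \<open>x\<close> and the merely square integrable \<open>f\<close> contributes
  order \<surd>x. It is needed because the outer conditions hold at \<open>\<epsilon> * a k\<close>
  for one problem and at 0 for the other.\<close>

lemma g_increment:
  assumes k: "k \<in> {1..n}" and x: "0 \<le> x"
  shows "norm (tail_transform \<kappa> (f k) x - tail_transform \<kappa> (f k) 0) \<le> (x * (norm \<kappa> * M0) + sqrt x) * Nf f"
proof -
  let ?g = "tail_transform \<kappa> (f k)"
  have fi: "(\<lambda>t. norm (f k t)) integrable_on {0..x}"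
    using absolutely_integrable_norm_comp[OF L2_on_locally_integrable(1)[OF bspec[OF f k], of 0 x]]
    by (auto intro: absolutely_integrable_on_Icc_imp_integrable)
  have "norm (?g x - ?g 0) \<le> integral {0..x} (\<lambda>t. norm \<kappa> * (M0 * Nf f) + norm (f k t))"
  proof (rule primitive_diff_bound[OF tail_transform_primitive[OF \<kappa>(1) bspec[OF f k], of x]])
    show "(\<lambda>t. norm \<kappa> * (M0 * Nf f) + norm (f k t)) integrable_on {0..x}"
      using fi by (intro integrable_add) auto
    fix t assume t: "t \<in> {0..x}"
    have "norm (\<kappa> * ?g t - f k t) \<le> norm \<kappa> * norm (?g t) + norm (f k t)"
      using norm_triangle_ineq4[of "\<kappa> * ?g t" "f k t"] by (simp add: norm_mult)
    also have "norm \<kappa> * norm (?g t) \<le> norm \<kappa> * (M0 * Nf f)"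
      using g_bound(1)[OF k, of t] t by (intro mult_left_mono) auto
    finally show "norm (\<kappa> * ?g t - f k t) \<le> norm \<kappa> * (M0 * Nf f) + norm (f k t)" by simp
  qed (use x in auto)
  also have "\<dots> = x * (norm \<kappa> * (M0 * Nf f)) + integral {0..x} (\<lambda>t. norm (f k t))"
    using fi x by (subst Henstock_Kurzweil_Integration.integral_add) auto
  also have "integral {0..x} (\<lambda>t. norm (f k t)) \<le> sqrt x * Nf f"
    using order_trans[OF L1_le_L2[OF bspec[OF f k] x] mult_left_mono[OF sqrt_le_Nf[OF k]]] x by simp
  finally show ?thesis by (simp add: algebra_simps)
qed

lemma lim_sol_first_order:
  assumes v: "lim_sol f v v'" and k: "k \<in> {1..n}" and x: "0 \<le> x"
  shows "v' k x + \<kappa> * v k x = tail_transform \<kappa> (f k) x"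
  by (rule edge_sol_outer[OF \<kappa>(1) bspec[OF f k], of "\<lambda>x. complex_of_real 0 - \<zeta>" _ _ 0])
    (use v k x \<kappa> in \<open>auto simp: lim_sol_def\<close>)

lemma eps_sol_first_order:
  assumes u: "eps_sol \<epsilon> l f u u'" and \<epsilon>: "0 < \<epsilon>" and k: "k \<in> {1..n}" and x: "\<epsilon> * a k \<le> x"
  shows "u' k x + \<kappa> * u k x = tail_transform \<kappa> (f k) x"
proof (rule edge_sol_outer[OF \<kappa>(1) bspec[OF f k], of "\<lambda>x. complex_of_real (l / \<epsilon>^2 * Q k (x / \<epsilon>)) - \<zeta>" _ _ "\<epsilon> * a k"])
  show "edge_sol (\<lambda>x. complex_of_real (l / \<epsilon>^2 * Q k (x / \<epsilon>)) - \<zeta>) (f k) (u k) (u' k)"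
    using u k by (simp add: eps_sol_def)
  fix y assume "\<epsilon> * a k < y"
  then have "a k < y / \<epsilon>" using \<epsilon> by (simp add: field_simps)
  then show "complex_of_real (l / \<epsilon>^2 * Q k (y / \<epsilon>)) - \<zeta> = \<kappa>\<^sup>2" using Q_supp[OF k] \<kappa> by simp
qed (use \<epsilon> a[OF k] x in auto)

end

text \<open>The limit vertex conditions hold exactly, so \<open>coercive\<close> with
  \<open>e = 0\<close> bounds the values at the vertex. Gronwall's inequality for
  \<open>v' = g - \<kappa> v\<close> carries this along the edges, and the increment bound compares
  \<open>v\<close> at the end of the small star with its vertex value.\<close>

lemma lim_sol_bound:
  "\<exists>C\<ge>0. \<forall>f v v'. (\<forall>k\<in>{1..n}. L2_on {0..} (f k)) \<longrightarrow> lim_sol f v v' \<longrightarrow>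
    (\<Sum>k\<in>{1..n}. norm (v k 0)) \<le> C * Nf f \<and>
    (\<forall>k\<in>{1..n}. \<forall>x\<in>{0..a k}. norm (v k x) \<le> C * Nf f \<and> norm (v k x - v k 0) \<le> C * (x * Nf f))"
proof -
  define C1 where "C1 = n * (Th * M0) / \<bar>Im \<kappa>\<bar>"
  define C2 where "C2 = (C1 + Am * M0) * exp (norm \<kappa> * Am)"
  define C3 where "C3 = M0 + norm \<kappa> * C2"
  have C: "0 \<le> C1" "0 \<le> C2" "0 \<le> C3"
    unfolding C1_def C2_def C3_def using Th_nonneg M0 Am_pos by (auto intro!: add_nonneg_nonneg)
  have main: "(\<Sum>k\<in>{1..n}. norm (v k 0)) \<le> C1 * Nf f \<and>
    (\<forall>k\<in>{1..n}. \<forall>x\<in>{0..a k}. norm (v k x) \<le> C2 * Nf f \<and> norm (v k x - v k 0) \<le> C3 * (x * Nf f))"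
    if f: "\<forall>k\<in>{1..n}. L2_on {0..} (f k)" and v: "lim_sol f v v'" for f v v'
  proof -
    note N0 = Nf_nonneg[OF f] and first = lim_sol_first_order[OF f v] and gb = g_bound(1)[OF f]
    have "\<bar>Im \<kappa>\<bar> * (\<Sum>k\<in>{1..n}. norm (v k 0))
        \<le> n * (norm \<kappa> * (\<Sum>k\<in>{1..n}. norm (0 :: complex)) + (\<Sum>i\<in>{1..m}. norm (\<Sum>k\<in>{1..n}. complex_of_real (\<theta> i k) * tail_transform \<kappa> (f k) 0)))"
    proof (rule coercive)
      show "v j 0 = (\<Sum>i\<in>{1..m}. complex_of_real (\<theta> i j) * v i 0) + 0" if "j \<in> {1..n}" for j
        using lim_sol_vertex(1)[OF v that] by simp
      show "(\<Sum>k\<in>{1..n}. complex_of_real (\<theta> i k) * (\<kappa> * v k 0)) + complex_of_real lam * (\<Sum>j\<in>{1..m}. complex_of_real (q i j) * v j 0)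
          = (\<Sum>k\<in>{1..n}. complex_of_real (\<theta> i k) * tail_transform \<kappa> (f k) 0)" if i: "i \<in> {1..m}" for i
        unfolding lim_sol_vertex(2)[OF v i, symmetric] sum.distrib[symmetric]
      proof (intro sum.cong refl)
        fix k assume "k \<in> {1..n}"
        from first[OF this order_refl]
        show "complex_of_real (\<theta> i k) * (\<kappa> * v k 0) + complex_of_real (\<theta> i k) * v' k 0
          = complex_of_real (\<theta> i k) * tail_transform \<kappa> (f k) 0"
          by (simp add: distrib_left[symmetric] add.commute)
      qed
    qed
    also have "\<dots> = n * (\<Sum>i\<in>{1..m}. norm (\<Sum>k\<in>{1..n}. complex_of_real (\<theta> i k) * tail_transform \<kappa> (f k) 0))" by simp
    also have "\<dots> \<le> n * (Th * (M0 * Nf f))"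
      using gb by (intro mult_left_mono sum_\<theta>_bound) auto
    finally have V: "(\<Sum>k\<in>{1..n}. norm (v k 0)) \<le> C1 * Nf f"
      using Im_\<kappa> by (simp add: C1_def field_simps)
    have "norm (v k x) \<le> C2 * Nf f \<and> norm (v k x - v k 0) \<le> C3 * (x * Nf f)" if k: "k \<in> {1..n}" and x: "x \<in> {0..a k}" for k x
    proof -
      have pv: "primitive (a k) (v k) (v' k)" using v k by (simp add: lim_sol_def edge_sol_def)
      have cv: "continuous_on {0..a k} (v k)" using pv by (rule primitive_continuous)
      have v'b: "norm (v' k t) \<le> M0 * Nf f + norm \<kappa> * norm (v k t)" if "t \<in> {0..a k}" for t
      proof -
        have "v' k t = tail_transform \<kappa> (f k) t - \<kappa> * v k t"
          using first[OF k, of t] that by (simp add: algebra_simps)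
        then have "norm (v' k t) \<le> norm (tail_transform \<kappa> (f k) t) + norm (\<kappa> * v k t)"
          using norm_triangle_ineq4 by metis
        then show ?thesis using gb[OF k, of t] that by (simp add: norm_mult)
      qed
      have ni: "(\<lambda>t. norm (v k t)) integrable_on {0..y}" if "y \<in> {0..a k}" for y
        using continuous_on_subset[OF cv, of "{0..y}"] that by (intro integrable_continuous_real continuous_on_norm) auto
      have inc: "norm (v k y - v k 0) \<le> integral {0..y} (\<lambda>t. M0 * Nf f + norm \<kappa> * norm (v k t))" if y: "y \<in> {0..a k}" for y
        using ni[OF y] v'b y by (intro primitive_diff_bound[OF pv y] integrable_add integrable_on_mult_right) auto
      have int: "integral {0..y} (\<lambda>t. M0 * Nf f + norm \<kappa> * norm (v k t)) = y * (M0 * Nf f) + norm \<kappa> * integral {0..y} (\<lambda>t. norm (v k t))"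
        if y: "y \<in> {0..a k}" for y
        using ni[OF y] y by (subst Henstock_Kurzweil_Integration.integral_add) (auto intro: integrable_on_mult_right)
      have gron: "norm (v k y) \<le> (C1 + Am * M0) * Nf f * exp (norm \<kappa> * y)" if y: "y \<in> {0..a k}" for y
      proof (rule gronwall[OF _ _ _ y])
        show "continuous_on {0..a k} (\<lambda>t. norm (v k t))" using cv by (rule continuous_on_norm)
        fix y assume y: "y \<in> {0..a k}"
        have "norm (v k y) \<le> norm (v k 0) + norm (v k y - v k 0)" using norm_triangle_sub[of "v k y" "v k 0"] by simp
        also have "norm (v k 0) \<le> C1 * Nf f"
          using V member_le_sum[of k "{1..n}" "\<lambda>k. norm (v k 0)"] k by simp
        also have "norm (v k y - v k 0) \<le> y * (M0 * Nf f) + norm \<kappa> * integral {0..y} (\<lambda>t. norm (v k t))"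
          using inc[OF y] int[OF y] by simp
        also have "y * (M0 * Nf f) \<le> Am * (M0 * Nf f)"
          using y a_le_Am[OF k] M0 N0 by (intro mult_right_mono) auto
        finally show "norm (v k y) \<le> (C1 + Am * M0) * Nf f + norm \<kappa> * integral {0..y} (\<lambda>t. norm (v k t))"
          by (simp add: algebra_simps)
      qed simp
      have vb: "norm (v k y) \<le> C2 * Nf f" if y: "y \<in> {0..a k}" for y
      proof -
        have "(C1 + Am * M0) * Nf f * exp (norm \<kappa> * y) \<le> (C1 + Am * M0) * Nf f * exp (norm \<kappa> * Am)"
          using y a_le_Am[OF k] C N0 M0 Am_pos by (intro mult_left_mono mult_nonneg_nonneg add_nonneg_nonneg) (auto intro!: mult_left_mono)
        then show ?thesis using gron[OF y] by (simp add: C2_def mult_ac)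
      qed
      have "norm (v k x - v k 0) \<le> integral {0..x} (\<lambda>_. C3 * Nf f)"
      proof (rule primitive_diff_bound[OF pv x])
        fix t assume t: "t \<in> {0..x}"
        have "norm (v' k t) \<le> M0 * Nf f + norm \<kappa> * norm (v k t)" using t x by (intro v'b) auto
        also have "\<dots> \<le> M0 * Nf f + norm \<kappa> * (C2 * Nf f)"
          using vb[of t] t x by (intro add_left_mono mult_left_mono) auto
        finally show "norm (v' k t) \<le> C3 * Nf f" by (simp add: C3_def algebra_simps)
      qed auto
      then show ?thesis using vb[OF x] x by (simp add: mult_ac)
    qed
    with V show ?thesis by blast
  qed
  have up: "c \<le> C1 + C2 + C3" if "c = C1 \<or> c = C2 \<or> c = C3" for c using C that by auto
  show ?thesis
  proof (rule exI[of _ "C1 + C2 + C3"], intro conjI allI impI ballI)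
    show "0 \<le> C1 + C2 + C3" using C by simp
    fix f v v' assume f: "\<forall>k\<in>{1..n}. L2_on {0..} (f k)" and v: "lim_sol f v v'"
    note mn = main[OF f v]
    have N0: "0 \<le> Nf f" by (rule Nf_nonneg[OF f])
    show "(\<Sum>k\<in>{1..n}. norm (v k 0)) \<le> (C1 + C2 + C3) * Nf f"
      using mn mult_right_mono[OF up[of C1] N0] by linarith
    fix k x assume k: "k \<in> {1..n}" and x: "x \<in> {0..a k}"
    show "norm (v k x) \<le> (C1 + C2 + C3) * Nf f"
      using mn k x mult_right_mono[OF up[of C2] N0] by (meson order_trans)
    have "0 \<le> x * Nf f" using N0 x by simp
    then show "norm (v k x - v k 0) \<le> (C1 + C2 + C3) * (x * Nf f)"
      using mn k x mult_right_mono[OF up[of C3]] by (meson order_trans)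
  qed
qed

text \<open>In the factor \<open>1 + sqrt Am\<close> the root comes from Cauchy-Schwarz on an
  interval of length \<open>\<epsilon> * a k\<close>, while the summand 1 keeps the norm of
  \<open>f\<close> below \<open>N\<close> for the bound on the end derivatives.\<close>

lemma eps_sol_scaled_data:
  assumes f: "\<forall>k\<in>{1..n}. L2_on {0..} (f k)" and u: "eps_sol \<epsilon> l f u u'" and \<epsilon>: "0 < \<epsilon>" "\<epsilon> \<le> 1"
    and l: "\<bar>l - 1 - \<epsilon> * lam\<bar> \<le> L * \<epsilon>\<^sup>2"
  shows "scaled_data \<epsilon> l ((1 + sqrt Am) * Nf f) (\<lambda>k y. u k (\<epsilon> * y)) (\<lambda>k y. complex_of_real \<epsilon> * u' k (\<epsilon> * y))
    (\<lambda>k y. f k (\<epsilon> * y)) (\<lambda>k. u' k (\<epsilon> * a k))"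
  unfolding scaled_data_def
proof (intro conjI ballI \<epsilon> l)
  have N0: "0 \<le> Nf f" using f by (rule Nf_nonneg)
  show "0 \<le> (1 + sqrt Am) * Nf f" using N0 Am_pos by simp
  have NN: "Nf f \<le> (1 + sqrt Am) * Nf f" using N0 Am_pos mult_right_mono[of 1 "1 + sqrt Am" "Nf f"] by simp
  have sol: "edge_sol (\<lambda>x. complex_of_real (l / \<epsilon>^2 * Q k (x / \<epsilon>)) - \<zeta>) (f k) (u k) (u' k)" if "k \<in> {1..n}" for k
    using u that by (simp add: eps_sol_def)
  have cont: "\<forall>k\<in>{1..n}. u k 0 = u 1 0" and kirch: "(\<Sum>k\<in>{1..n}. u' k 0) = 0" using u unfolding eps_sol_def by blast+
  show "u k (\<epsilon> * 0) = u 1 (\<epsilon> * 0)" if "k \<in> {1..n}" for k using bspec[OF cont that] by simp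
  show "(\<Sum>k\<in>{1..n}. complex_of_real \<epsilon> * u' k (\<epsilon> * 0)) = 0"
    using kirch by (simp add: sum_distrib_left[symmetric])
  fix k assume k: "k \<in> {1..n}"
  have p: "primitive (\<epsilon> * a k) (u k) (u' k)"
    "primitive (\<epsilon> * a k) (u' k) (\<lambda>x. (complex_of_real (l / \<epsilon>^2 * Q k (x / \<epsilon>)) - \<zeta>) * u k x - f k x)"
    using sol[OF k] unfolding edge_sol_def by blast+
  show "primitive (a k) (\<lambda>y. u k (\<epsilon> * y)) (\<lambda>y. complex_of_real \<epsilon> * u' k (\<epsilon> * y))"
    using primitive_scaled_argument[OF p(1) \<epsilon>(1)] by (simp add: scaleR_conv_of_real)
  show "primitive (a k) (\<lambda>y. complex_of_real \<epsilon> * u' k (\<epsilon> * y))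
      (\<lambda>x. (complex_of_real (l * Q k x) - complex_of_real (\<epsilon>\<^sup>2) * \<zeta>) * u k (\<epsilon> * x) - complex_of_real (\<epsilon>\<^sup>2) * f k (\<epsilon> * x))"
  proof (rule primitive_cong_deriv[OF primitive_cmult[OF primitive_scaled_argument[OF p(2) \<epsilon>(1)]]])
    fix x
    have sq: "complex_of_real \<epsilon> * (\<epsilon> *\<^sub>R z) = complex_of_real (\<epsilon>\<^sup>2) * z" for z
      by (simp add: scaleR_conv_of_real power2_eq_square)
    have "complex_of_real (\<epsilon>\<^sup>2) * complex_of_real (l / \<epsilon>^2 * Q k (\<epsilon> * x / \<epsilon>)) = complex_of_real (l * Q k x)"
      using \<epsilon> unfolding of_real_mult[symmetric] by simp
    then show "complex_of_real \<epsilon> * (\<epsilon> *\<^sub>R ((complex_of_real (l / \<epsilon>^2 * Q k (\<epsilon> * x / \<epsilon>)) - \<zeta>) * u k (\<epsilon> * x) - f k (\<epsilon> * x)))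
      = (complex_of_real (l * Q k x) - complex_of_real (\<epsilon>\<^sup>2) * \<zeta>) * u k (\<epsilon> * x) - complex_of_real (\<epsilon>\<^sup>2) * f k (\<epsilon> * x)"
      unfolding sq right_diff_distrib left_diff_distrib mult.assoc[symmetric] by simp
  qed
  have fa: "f k absolutely_integrable_on {0..\<epsilon> * a k}" by (rule L2_on_locally_integrable[OF bspec[OF f k]]) auto
  have ak: "0 \<le> a k" using a[OF k] by simp
  show "(\<lambda>y. f k (\<epsilon> * y)) absolutely_integrable_on {0..a k}" by (rule scaled_argument_integral[OF fa \<epsilon>(1) ak])
  have "\<epsilon> * integral {0..a k} (\<lambda>x. norm (f k (\<epsilon> * x))) = integral {0..\<epsilon> * a k} (\<lambda>x. norm (f k x))"
    using scaled_argument_integral(2)[OF absolutely_integrable_norm_comp[OF fa] \<epsilon>(1) ak] by simp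
  also have "\<dots> \<le> sqrt (\<epsilon> * a k) * sqrt (integral {0..} (\<lambda>x. (norm (f k x))\<^sup>2))"
    using \<epsilon> ak by (intro L1_le_L2 bspec[OF f k]) auto
  also have "\<dots> \<le> (sqrt \<epsilon> * sqrt Am) * Nf f"
    unfolding real_sqrt_mult using a_le_Am[OF k] \<epsilon> ak f_square_nonneg[of f k, OF f k] Am_pos
    by (intro mult_mono mult_nonneg_nonneg sqrt_le_Nf[OF f] k) auto
  also have "\<dots> \<le> sqrt \<epsilon> * ((1 + sqrt Am) * Nf f)"
    using \<epsilon> N0 unfolding mult.assoc by (intro mult_left_mono mult_right_mono) auto
  finally show "\<epsilon> * integral {0..a k} (\<lambda>x. norm (f k (\<epsilon> * x))) \<le> sqrt \<epsilon> * ((1 + sqrt Am) * Nf f)" .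
  have "u' k (\<epsilon> * a k) = tail_transform \<kappa> (f k) (\<epsilon> * a k) - \<kappa> * u k (\<epsilon> * a k)"
    using eps_sol_first_order[OF f u \<epsilon>(1) k order_refl] by (simp add: algebra_simps)
  then have "norm (u' k (\<epsilon> * a k)) \<le> norm (tail_transform \<kappa> (f k) (\<epsilon> * a k)) + norm \<kappa> * norm (u k (\<epsilon> * a k))"
    using norm_triangle_ineq4[of "tail_transform \<kappa> (f k) (\<epsilon> * a k)" "\<kappa> * u k (\<epsilon> * a k)"] by (simp add: norm_mult)
  also have "\<dots> \<le> M0 * (Nf f + norm (u k (\<epsilon> * a k)))"
    using g_bound(2)[OF f k] \<epsilon> ak by simp
  also have "\<dots> \<le> M0 * ((1 + sqrt Am) * Nf f + norm (u k (\<epsilon> * a k)))"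
    using NN M0 by (intro mult_left_mono) auto
  finally show "norm (u' k (\<epsilon> * a k)) \<le> M0 * ((1 + sqrt Am) * Nf f + norm (u k (\<epsilon> * a k)))" .
qed simp

end

lemma resolvent_equation_iff:
  fixes y c \<zeta> w f :: complex
  shows "y = (c - \<zeta>) * w - f \<longleftrightarrow> - y + c * w - \<zeta> * w = f"
proof
  assume "- y + c * w - \<zeta> * w = f"
  then have "f = - y + c * w - \<zeta> * w" ..
  then show "y = (c - \<zeta>) * w - f" by (simp add: left_diff_distrib)
qed (simp add: left_diff_distrib)

context star_limit
begin

text \<open>The difference \<open>W\<close> of the values of \<open>u\<close> at the ends of the
  small star and of \<open>v\<close> at the vertex satisfies the limit conditions up to errors of
  size \<open>T = sqrt \<epsilon> * N + \<epsilon> * S\<close>. Coercivity bounds \<open>W\<close>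
  by \<open>T\<close>, the triangle inequality bounds \<open>S\<close> by \<open>W\<close> and the
  limit values, and for small \<epsilon> this closes. The L2 bounds inside and outside the small
  star follow.\<close>

lemma resolvent_difference:
  "\<exists>C\<ge>0. \<exists>\<delta>>0. \<forall>\<epsilon> l f u u' v v'. 0 < \<epsilon> \<longrightarrow> \<epsilon> \<le> 1 \<longrightarrow> \<epsilon> \<le> \<delta> \<longrightarrow> \<bar>l - 1 - \<epsilon> * lam\<bar> \<le> L * \<epsilon>\<^sup>2 \<longrightarrow>
     (\<forall>k\<in>{1..n}. L2_on {0..} (f k)) \<longrightarrow> eps_sol \<epsilon> l f u u' \<longrightarrow> lim_sol f v v' \<longrightarrow>
     (\<Sum>k\<in>{1..n}. integral {0..} (\<lambda>x. (norm (u k x - v k x))\<^sup>2)) \<le> C * (\<epsilon> * (Nf f)\<^sup>2)"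
proof -
  obtain C0 \<delta>0 where C0: "0 \<le> C0" and \<delta>0: "0 < \<delta>0" and scaled: "\<forall>\<epsilon> l N U U' F p. scaled_data \<epsilon> l N U U' F p \<longrightarrow> \<epsilon> \<le> \<delta>0 \<longrightarrow>
    (let S = (\<Sum>k\<in>{1..n}. norm (U k (a k))) in
      (\<forall>k\<in>{1..n}. \<forall>x\<in>{0..a k}. norm (U k x) \<le> C0 * (N + S)) \<and>
      (\<forall>j\<in>{1..n}. norm (U j (a j) - (\<Sum>i\<in>{1..m}. complex_of_real (\<theta> i j) * U i (a i))) \<le> C0 * (\<epsilon> * (N + S))) \<and>
      (\<forall>i\<in>{1..m}. norm ((\<Sum>k\<in>{1..n}. complex_of_real (\<theta> i k) * p k)
          - complex_of_real lam * (\<Sum>j\<in>{1..m}. complex_of_real (q i j) * U j (a j))) \<le> C0 * (sqrt \<epsilon> * N + \<epsilon> * S)))"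
    using scaled_estimate by blast
  obtain C1 where C1: "0 \<le> C1" and limb: "\<forall>f v v'. (\<forall>k\<in>{1..n}. L2_on {0..} (f k)) \<longrightarrow> lim_sol f v v' \<longrightarrow>
    (\<Sum>k\<in>{1..n}. norm (v k 0)) \<le> C1 * Nf f \<and>
    (\<forall>k\<in>{1..n}. \<forall>x\<in>{0..a k}. norm (v k x) \<le> C1 * Nf f \<and> norm (v k x - v k 0) \<le> C1 * (x * Nf f))"
    using lim_sol_bound by blast
  define cN where "cN = 1 + sqrt Am"
  have cN: "1 \<le> cN" unfolding cN_def using Am_pos by simp
  define Cg where "Cg = Am * (norm \<kappa> * M0) + sqrt Am"
  have Cg: "0 \<le> Cg" unfolding Cg_def using Am_pos M0 by simp
  \<comment> \<open>\<open>C3\<close> and \<open>C4\<close> bound \<open>W\<close> by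
    \<open>T\<close>, \<open>C5\<close> bounds \<open>S\<close> by \<open>N\<close>,
    \<open>C6\<close> then bounds \<open>W\<close> by the multiple
    \<open>sqrt \<epsilon> * N\<close>; \<open>C7\<close> bounds \<open>u\<close> on the small star,
    \<open>C8\<close> the difference of the solutions at its ends, and \<open>C9\<close> the total
    square norm.\<close>
  define C3 where "C3 = n * (norm \<kappa> * (n * C0) + (Th * Cg + m * C0))"
  define C4 where "C4 = C3 / \<bar>Im \<kappa>\<bar>"
  define C5 where "C5 = 2 * (C4 + C1)"
  define C6 where "C6 = C4 * (1 + C5)"
  define C7 where "C7 = C0 * (1 + C5)"
  define C8 where "C8 = C6 + C1 * Am"
  define C9 where "C9 = n * (Am * (C7 + C1)\<^sup>2 + C8\<^sup>2 / (2 * Re \<kappa>))"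
  have C3: "0 \<le> C3" unfolding C3_def using C0 Th_nonneg Cg by simp
  have C4: "0 \<le> C4" unfolding C4_def using C3 by simp
  have C5: "0 \<le> C5" unfolding C5_def using C4 C1 by simp
  have C6: "0 \<le> C6" unfolding C6_def using C4 C5 by simp
  have C7: "0 \<le> C7" unfolding C7_def using C0 C5 by simp
  have C8: "0 \<le> C8" unfolding C8_def using C6 C1 Am_pos by simp
  have C9: "0 \<le> C9" unfolding C9_def using Am_pos \<kappa> by simp
  \<comment> \<open>The second entry gives \<open>C4 * \<epsilon> \<le> 1 / 2\<close>, which absorbs
    the \<open>S\<close> on the right of its own bound.\<close>
  define \<delta> where "\<delta> = min \<delta>0 (1 / (2 * (C4 + 1)))"
  have \<delta>: "0 < \<delta>" unfolding \<delta>_def using \<delta>0 C4 by simp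
  have main: "(\<Sum>k\<in>{1..n}. integral {0..} (\<lambda>x. (norm (u k x - v k x))\<^sup>2)) \<le> C9 * (\<epsilon> * (cN * Nf f)\<^sup>2)"
    if \<epsilon>: "0 < \<epsilon>" "\<epsilon> \<le> 1" and \<epsilon>\<delta>: "\<epsilon> \<le> \<delta>" and l: "\<bar>l - 1 - \<epsilon> * lam\<bar> \<le> L * \<epsilon>\<^sup>2"
      and f: "\<forall>k\<in>{1..n}. L2_on {0..} (f k)" and u: "eps_sol \<epsilon> l f u u'" and v: "lim_sol f v v'"
    for \<epsilon> l f u u' v v'
  proof -
    define N where "N = cN * Nf f"
    have Nf0: "0 \<le> Nf f" by (rule Nf_nonneg[OF f])
    have N: "0 \<le> N" "Nf f \<le> N" unfolding N_def using cN Nf0 mult_right_mono[OF cN Nf0] by simp_all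
    have CN: "C1 * Nf f \<le> C1 * N" using N(2) C1 by (rule mult_left_mono)
    define b where "b k = \<epsilon> * a k" for k
    define X where "X k = u k (b k)" for k
    define p where "p k = u' k (b k)" for k
    define S where "S = (\<Sum>k\<in>{1..n}. norm (X k))"
    have S0: "0 \<le> S" unfolding S_def by (intro sum_nonneg) auto
    have ak: "0 < a k" if "k \<in> {1..n}" for k using a[OF that] .
    have b0: "0 \<le> b k" "b k \<le> a k" "b k \<le> \<epsilon> * Am" if "k \<in> {1..n}" for k
      unfolding b_def using \<epsilon> ak[OF that] a_le_Am[OF that] by (auto simp: mult_left_le_one_le)
    have \<epsilon>s: "\<epsilon> \<le> sqrt \<epsilon>" using \<epsilon> by (intro real_le_rsqrt) (simp add: power2_eq_square mult_left_le)
    have \<epsilon>Am: "\<epsilon> * Am \<le> sqrt \<epsilon> * Am" by (rule mult_right_mono[OF \<epsilon>s]) (use Am_pos in simp)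
    note sd = eps_sol_scaled_data[OF f u \<epsilon> l, folded cN_def N_def]
    have "\<epsilon> \<le> \<delta>0" using \<epsilon>\<delta> by (simp add: \<delta>_def)
    from scaled[THEN spec, THEN spec, THEN spec, THEN spec, THEN spec, THEN spec, THEN spec, THEN mp, OF sd, THEN mp, OF this]
    have sc: "(\<forall>k\<in>{1..n}. \<forall>x\<in>{0..a k}. norm (u k (\<epsilon> * x)) \<le> C0 * (N + S)) \<and>
      (\<forall>j\<in>{1..n}. norm (X j - (\<Sum>i\<in>{1..m}. complex_of_real (\<theta> i j) * X i)) \<le> C0 * (\<epsilon> * (N + S))) \<and>
      (\<forall>i\<in>{1..m}. norm ((\<Sum>k\<in>{1..n}. complex_of_real (\<theta> i k) * p k)
          - complex_of_real lam * (\<Sum>j\<in>{1..m}. complex_of_real (q i j) * X j)) \<le> C0 * (sqrt \<epsilon> * N + \<epsilon> * S))"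
      by (simp only: Let_def X_def p_def b_def S_def)
    note vb = limb[THEN spec, THEN spec, THEN spec, THEN mp, OF f, THEN mp, OF v]
    define g where "g k = tail_transform \<kappa> (f k)" for k
    \<comment> \<open>The two solutions are compared at different points on purpose: the limit
      conditions hold for \<open>v\<close> at 0 and approximately for \<open>u\<close> at
      \<open>b k\<close>.\<close>
    define W where "W k = X k - v k 0" for k
    define e where "e j = X j - (\<Sum>i\<in>{1..m}. complex_of_real (\<theta> i j) * X i)" for j
    define \<tau> where "\<tau> i = (\<Sum>k\<in>{1..n}. complex_of_real (\<theta> i k) * p k)
          - complex_of_real lam * (\<Sum>j\<in>{1..m}. complex_of_real (q i j) * X j)" for i
    \<comment> \<open>The error in the flux condition has two sources: the shift of the evaluation
      point of \<open>g\<close> from 0 to \<open>b k\<close>, and the defect of the tested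
      identity.\<close>
    define \<rho> where "\<rho> i = (\<Sum>k\<in>{1..n}. complex_of_real (\<theta> i k) * (g k (b k) - g k 0)) - \<tau> i" for i
    define T where "T = sqrt \<epsilon> * N + \<epsilon> * S"
    have T0: "0 \<le> T" unfolding T_def using \<epsilon> N S0 by simp
    have \<epsilon>NS: "\<epsilon> * (N + S) \<le> T" unfolding T_def using mult_right_mono[OF \<epsilon>s N(1)] by (simp add: algebra_simps)
    have sN: "sqrt \<epsilon> * N \<le> T" unfolding T_def using \<epsilon> S0 by simp
    have eb: "norm (e j) \<le> C0 * T" if "j \<in> {1..n}" for j
    proof -
      have "norm (e j) \<le> C0 * (\<epsilon> * (N + S))" unfolding e_def using sc that by blast
      also have "\<dots> \<le> C0 * T" using \<epsilon>NS C0 by (rule mult_left_mono)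
      finally show ?thesis .
    qed
    have \<tau>b: "norm (\<tau> i) \<le> C0 * T" if "i \<in> {1..m}" for i
      unfolding \<tau>_def T_def using sc that by blast
    have gd: "norm (g k (b k) - g k 0) \<le> Cg * T" if k: "k \<in> {1..n}" for k
    proof -
      have "norm (g k (b k) - g k 0) \<le> (b k * (norm \<kappa> * M0) + sqrt (b k)) * Nf f"
        unfolding g_def by (rule g_increment[OF f k b0(1)[OF k]])
      also have "\<dots> \<le> (sqrt \<epsilon> * Am * (norm \<kappa> * M0) + sqrt \<epsilon> * sqrt Am) * N"
      proof (intro mult_mono add_mono)
        show "b k \<le> sqrt \<epsilon> * Am" by (rule order_trans[OF b0(3)[OF k] \<epsilon>Am])
        show "sqrt (b k) \<le> sqrt \<epsilon> * sqrt Am"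
          unfolding real_sqrt_mult[symmetric] using b0(3)[OF k] by simp
      qed (use \<epsilon> Am_pos M0 N Nf0 in \<open>auto intro!: add_nonneg_nonneg mult_nonneg_nonneg\<close>)
      also have "\<dots> = Cg * (sqrt \<epsilon> * N)" by (simp add: Cg_def algebra_simps)
      also have "\<dots> \<le> Cg * T" using sN Cg by (rule mult_left_mono)
      finally show ?thesis .
    qed
    have Wb: "\<bar>Im \<kappa>\<bar> * (\<Sum>k\<in>{1..n}. norm (W k)) \<le> C3 * T"
    proof -
      have "\<bar>Im \<kappa>\<bar> * (\<Sum>k\<in>{1..n}. norm (W k)) \<le> n * (norm \<kappa> * (\<Sum>k\<in>{1..n}. norm (e k)) + (\<Sum>i\<in>{1..m}. norm (\<rho> i)))"
      proof (rule coercive)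
        fix j assume j: "j \<in> {1..n}"
        show "W j = (\<Sum>i\<in>{1..m}. complex_of_real (\<theta> i j) * W i) + e j"
          unfolding W_def e_def using lim_sol_vertex(1)[OF v j]
          by (simp add: right_diff_distrib sum_subtractf)
      next
        fix i assume i: "i \<in> {1..m}"
        have 1: "complex_of_real (\<theta> i k) * (\<kappa> * W k) = complex_of_real (\<theta> i k) * (g k (b k) - g k 0)
            - complex_of_real (\<theta> i k) * p k + complex_of_real (\<theta> i k) * v' k 0" if k: "k \<in> {1..n}" for k
        proof -
          have "\<kappa> * X k = g k (b k) - p k"
            using eps_sol_first_order[OF f u \<epsilon>(1) k, of "b k"] by (simp add: X_def p_def g_def b_def algebra_simps)
          moreover have "\<kappa> * v k 0 = g k 0 - v' k 0"
            using lim_sol_first_order[OF f v k order_refl] by (simp add: g_def algebra_simps)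
          ultimately have \<kappa>W: "\<kappa> * W k = (g k (b k) - g k 0) - p k + v' k 0"
            by (simp add: W_def right_diff_distrib)
          show ?thesis unfolding \<kappa>W by (simp add: algebra_simps)
        qed
        have "(\<Sum>k\<in>{1..n}. complex_of_real (\<theta> i k) * (\<kappa> * W k)) = (\<Sum>k\<in>{1..n}. complex_of_real (\<theta> i k) * (g k (b k) - g k 0)
            - complex_of_real (\<theta> i k) * p k + complex_of_real (\<theta> i k) * v' k 0)"
          using 1 by (intro sum.cong) auto
        also have "\<dots> = (\<Sum>k\<in>{1..n}. complex_of_real (\<theta> i k) * (g k (b k) - g k 0))
            - (\<Sum>k\<in>{1..n}. complex_of_real (\<theta> i k) * p k) + (\<Sum>k\<in>{1..n}. complex_of_real (\<theta> i k) * v' k 0)"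
          by (simp only: sum.distrib sum_subtractf)
        finally have 2: "(\<Sum>k\<in>{1..n}. complex_of_real (\<theta> i k) * (\<kappa> * W k)) = \<dots>" .
        have 3: "(\<Sum>j\<in>{1..m}. complex_of_real (q i j) * W j)
            = (\<Sum>j\<in>{1..m}. complex_of_real (q i j) * X j) - (\<Sum>j\<in>{1..m}. complex_of_real (q i j) * v j 0)"
          by (simp add: W_def right_diff_distrib sum_subtractf)
        show "(\<Sum>k\<in>{1..n}. complex_of_real (\<theta> i k) * (\<kappa> * W k))
            + complex_of_real lam * (\<Sum>j\<in>{1..m}. complex_of_real (q i j) * W j) = \<rho> i"
          unfolding 2 3 lim_sol_vertex(2)[OF v i] \<rho>_def \<tau>_def by (simp add: right_diff_distrib)
      qed
      also have "\<dots> \<le> n * (norm \<kappa> * (n * (C0 * T)) + (Th * (Cg * T) + m * (C0 * T)))"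
      proof (intro mult_left_mono add_mono)
        show "(\<Sum>k\<in>{1..n}. norm (e k)) \<le> n * (C0 * T)"
          using sum_bounded_above[of "{1..n}" "\<lambda>k. norm (e k)" "C0 * T"] eb by simp
        have "(\<Sum>i\<in>{1..m}. norm (\<rho> i))
            \<le> (\<Sum>i\<in>{1..m}. norm (\<Sum>k\<in>{1..n}. complex_of_real (\<theta> i k) * (g k (b k) - g k 0)) + norm (\<tau> i))"
          unfolding \<rho>_def by (intro sum_mono norm_triangle_ineq4)
        also have "\<dots> = (\<Sum>i\<in>{1..m}. norm (\<Sum>k\<in>{1..n}. complex_of_real (\<theta> i k) * (g k (b k) - g k 0))) + (\<Sum>i\<in>{1..m}. norm (\<tau> i))"
          by (rule sum.distrib)
        also have "\<dots> \<le> Th * (Cg * T) + m * (C0 * T)"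
        proof (rule add_mono)
          show "(\<Sum>i\<in>{1..m}. norm (\<Sum>k\<in>{1..n}. complex_of_real (\<theta> i k) * (g k (b k) - g k 0))) \<le> Th * (Cg * T)"
            using gd by (rule sum_\<theta>_bound)
          show "(\<Sum>i\<in>{1..m}. norm (\<tau> i)) \<le> m * (C0 * T)"
            using sum_bounded_above[of "{1..m}" "\<lambda>i. norm (\<tau> i)" "C0 * T"] \<tau>b by simp
        qed
        finally show "(\<Sum>i\<in>{1..m}. norm (\<rho> i)) \<le> Th * (Cg * T) + m * (C0 * T)" .
      qed auto
      also have "\<dots> = C3 * T" by (simp add: C3_def algebra_simps)
      finally show ?thesis .
    qed
    have Ws: "(\<Sum>k\<in>{1..n}. norm (W k)) \<le> C4 * T"
      using Wb Im_\<kappa> by (simp add: C4_def field_simps)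
    \<comment> \<open>The end values are bounded by the datum only here: \<open>S\<close> recurs
      inside \<open>T\<close>, but multiplied by \<epsilon>.\<close>
    have S: "S \<le> C5 * N"
    proof -
      have "S \<le> (\<Sum>k\<in>{1..n}. norm (W k) + norm (v k 0))"
        unfolding S_def
      proof (intro sum_mono)
        show "norm (X k) \<le> norm (W k) + norm (v k 0)" for k
          using norm_triangle_ineq[of "W k" "v k 0"] by (simp add: W_def)
      qed
      also have "\<dots> = (\<Sum>k\<in>{1..n}. norm (W k)) + (\<Sum>k\<in>{1..n}. norm (v k 0))" by (rule sum.distrib)
      also have "\<dots> \<le> C4 * T + C1 * N" using Ws vb CN by linarith
      finally have 1: "S \<le> C4 * T + C1 * N" .
      have "sqrt \<epsilon> * N \<le> 1 * N" using \<epsilon> N by (intro mult_right_mono) auto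
      then have "C4 * (sqrt \<epsilon> * N) \<le> C4 * N" using C4 mult_left_mono by fastforce
      moreover have "C4 * (\<epsilon> * S) \<le> S / 2"
      proof -
        have "(C4 + 1) * \<epsilon> \<le> (C4 + 1) * (1 / (2 * (C4 + 1)))"
          using \<epsilon>\<delta> C4 by (intro mult_left_mono) (auto simp: \<delta>_def)
        also have "\<dots> = 1 / 2" using C4 by simp
        finally have "C4 * \<epsilon> \<le> 1 / 2" using \<epsilon> by (simp add: distrib_right)
        from mult_right_mono[OF this S0] show ?thesis by (simp add: mult.assoc)
      qed
      ultimately have "C4 * T \<le> C4 * N + S / 2" unfolding T_def distrib_left by linarith
      with 1 have "S \<le> 2 * (C4 * N) + 2 * (C1 * N)" by linarith
      then show ?thesis by (simp add: C5_def algebra_simps)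
    qed
    have TN: "T \<le> (1 + C5) * (sqrt \<epsilon> * N)"
    proof -
      have "\<epsilon> * S \<le> sqrt \<epsilon> * (C5 * N)" using \<epsilon>s S \<epsilon> S0 by (intro mult_mono) auto
      then show ?thesis by (simp add: T_def algebra_simps)
    qed
    have Wk: "norm (W k) \<le> C6 * (sqrt \<epsilon> * N)" if "k \<in> {1..n}" for k
    proof -
      have "norm (W k) \<le> (\<Sum>k\<in>{1..n}. norm (W k))" using that by (intro member_le_sum) auto
      also have "\<dots> \<le> C4 * T" by (rule Ws)
      also have "\<dots> \<le> C4 * ((1 + C5) * (sqrt \<epsilon> * N))" using TN C4 by (rule mult_left_mono)
      finally show ?thesis by (simp add: C6_def mult_ac)
    qed
    have edge: "integral {0..} (\<lambda>x. (norm (u k x - v k x))\<^sup>2) \<le> (Am * (C7 + C1)\<^sup>2 + C8\<^sup>2 / (2 * Re \<kappa>)) * (\<epsilon> * N\<^sup>2)"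
      if k: "k \<in> {1..n}" for k
    proof -
      define w where "w x = u k x - v k x" for x
      define w' where "w' x = u' k x - v' k x" for x
      have pw: "primitive c w w'" for c
        unfolding w_def w'_def using u v k by (intro primitive_diff) (auto simp: eps_sol_def lim_sol_def edge_sol_def)
      have cw: "continuous_on {0..} w" using pw by (rule primitive_all_continuous)
      have wi: "(\<lambda>x. (norm (w x))\<^sup>2) integrable_on {0..c}" for c
        using continuous_on_subset[OF cw, of "{0..c}"] by (intro integrable_continuous_real continuous_intros) auto
      have inner_pt: "norm (w x) \<le> (C7 + C1) * N" if x: "x \<in> {0..b k}" for x
      proof -
        have "x / \<epsilon> \<in> {0..a k}" using x \<epsilon> by (auto simp: b_def field_simps)
        then have "norm (u k (\<epsilon> * (x / \<epsilon>))) \<le> C0 * (N + S)" using sc k by blast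
        then have "norm (u k x) \<le> C0 * (N + S)" using \<epsilon> by simp
        also have "\<dots> \<le> C0 * ((1 + C5) * N)" using S C0 by (intro mult_left_mono) (auto simp: algebra_simps)
        finally have "norm (u k x) \<le> C7 * N" by (simp add: C7_def mult_ac)
        moreover have "norm (v k x) \<le> C1 * N"
        proof -
          have "x \<in> {0..a k}" using x b0[OF k] by auto
          then have "norm (v k x) \<le> C1 * Nf f" using vb k by blast
          then show ?thesis using CN by (rule order_trans)
        qed
        ultimately show ?thesis
          using norm_triangle_ineq4[of "u k x" "v k x"] by (simp add: w_def distrib_right)
      qed
      \<comment> \<open>On the small star the difference is merely bounded; the length of the
        interval, of order \<epsilon>, supplies the smallness of the square norm.\<close>
      have inner: "integral {0..b k} (\<lambda>x. (norm (w x))\<^sup>2) \<le> Am * (C7 + C1)\<^sup>2 * (\<epsilon> * N\<^sup>2)"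
      proof -
        have "integral {0..b k} (\<lambda>x. (norm (w x))\<^sup>2) \<le> integral {0..b k} (\<lambda>_. ((C7 + C1) * N)\<^sup>2)"
          using wi inner_pt by (intro integral_le power_mono) auto
        also have "\<dots> = b k * ((C7 + C1) * N)\<^sup>2" using b0[OF k] by simp
        also have "\<dots> \<le> (\<epsilon> * Am) * ((C7 + C1) * N)\<^sup>2" using b0[OF k] by (intro mult_right_mono) auto
        also have "\<dots> = Am * (C7 + C1)\<^sup>2 * (\<epsilon> * N\<^sup>2)" by (simp add: power_mult_distrib mult_ac)
        finally show ?thesis .
      qed
      have wb: "norm (w (b k)) \<le> C8 * (sqrt \<epsilon> * N)"
      proof -
        have "w (b k) = W k - (v k (b k) - v k 0)" by (simp add: w_def W_def X_def)
        then have "norm (w (b k)) \<le> norm (W k) + norm (v k (b k) - v k 0)" using norm_triangle_ineq4 by metis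
        also have "norm (v k (b k) - v k 0) \<le> C1 * (b k * Nf f)" using vb k b0[OF k] by auto
        also have "\<dots> \<le> C1 * ((sqrt \<epsilon> * Am) * N)"
        proof (intro mult_left_mono mult_mono)
          show "b k \<le> sqrt \<epsilon> * Am" by (rule order_trans[OF b0(3)[OF k] \<epsilon>Am])
        qed (use N C1 Nf0 \<epsilon> Am_pos in auto)
        finally show ?thesis using Wk[OF k] by (simp add: C8_def algebra_simps)
      qed
      have wb2: "(norm (w (b k)))\<^sup>2 / (2 * Re \<kappa>) \<le> C8\<^sup>2 / (2 * Re \<kappa>) * (\<epsilon> * N\<^sup>2)"
      proof -
        have "(norm (w (b k)))\<^sup>2 \<le> (C8 * (sqrt \<epsilon> * N))\<^sup>2" using wb by (intro power_mono) auto
        also have "\<dots> = C8\<^sup>2 * (\<epsilon> * N\<^sup>2)" using \<epsilon> by (simp add: power_mult_distrib)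
        finally show ?thesis using \<kappa> by (simp add: divide_right_mono)
      qed
      have outer: "integral {b k..c} (\<lambda>x. (norm (w x))\<^sup>2) \<le> C8\<^sup>2 / (2 * Re \<kappa>) * (\<epsilon> * N\<^sup>2)" if c: "b k \<le> c" for c
      proof -
        have "integral {b k..c} (\<lambda>x. (norm (w x))\<^sup>2) \<le> (norm (w (b k)))\<^sup>2 / (2 * Re \<kappa>)"
        proof (rule exponential_decay_L2[OF pw _ \<kappa>(1) b0(1)[OF k] c])
          fix x assume x: "b k \<le> x"
          \<comment> \<open>Both sides equal the tail transform of the same \<open>f\<close>, so the
            difference satisfies the homogeneous equation \<open>w' = - \<kappa> w\<close> and is
            governed by its value at \<open>b k\<close>.\<close>
          have "u' k x + \<kappa> * u k x = v' k x + \<kappa> * v k x"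
            using eps_sol_first_order[OF f u \<epsilon>(1) k, of x] lim_sol_first_order[OF f v k, of x] x b0[OF k] by (simp add: b_def)
          then show "w' x = - \<kappa> * w x" by (simp add: w_def w'_def algebra_simps)
        qed
        then show ?thesis using wb2 by linarith
      qed
      have "integral {0..} (\<lambda>x. (norm (w x))\<^sup>2) \<le> Am * (C7 + C1)\<^sup>2 * (\<epsilon> * N\<^sup>2) + C8\<^sup>2 / (2 * Re \<kappa>) * (\<epsilon> * N\<^sup>2)"
      proof (rule L2_on_half_line(2)[OF cw])
        fix c :: real assume c: "0 \<le> c"
        define c' where "c' = max c (b k)"
        have "integral {0..c} (\<lambda>x. (norm (w x))\<^sup>2) \<le> integral {0..c'} (\<lambda>x. (norm (w x))\<^sup>2)"
          using wi by (intro integral_subset_le) (auto simp: c'_def)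
        also have "\<dots> = integral {0..b k} (\<lambda>x. (norm (w x))\<^sup>2) + integral {b k..c'} (\<lambda>x. (norm (w x))\<^sup>2)"
          using wi b0[OF k] by (intro Henstock_Kurzweil_Integration.integral_combine[symmetric]) (auto simp: c'_def)
        also have "\<dots> \<le> Am * (C7 + C1)\<^sup>2 * (\<epsilon> * N\<^sup>2) + C8\<^sup>2 / (2 * Re \<kappa>) * (\<epsilon> * N\<^sup>2)"
          by (intro add_mono inner outer) (simp add: c'_def)
        finally show "integral {0..c} (\<lambda>x. (norm (w x))\<^sup>2) \<le> Am * (C7 + C1)\<^sup>2 * (\<epsilon> * N\<^sup>2) + C8\<^sup>2 / (2 * Re \<kappa>) * (\<epsilon> * N\<^sup>2)" .
      qed
      then show ?thesis by (simp add: w_def distrib_right)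
    qed
    have "(\<Sum>k\<in>{1..n}. integral {0..} (\<lambda>x. (norm (u k x - v k x))\<^sup>2))
        \<le> (\<Sum>k\<in>{1..n}. (Am * (C7 + C1)\<^sup>2 + C8\<^sup>2 / (2 * Re \<kappa>)) * (\<epsilon> * N\<^sup>2))"
      by (intro sum_mono edge)
    then show ?thesis by (simp add: C9_def N_def mult.assoc)
  qed
  show ?thesis
  proof (rule exI[of _ "C9 * cN\<^sup>2"], rule conjI, use C9 in simp, rule exI[of _ \<delta>], rule conjI[OF \<delta>], intro allI impI)
    fix \<epsilon> l f u u' v v'
    assume as: "0 < \<epsilon>" "\<epsilon> \<le> 1" "\<epsilon> \<le> \<delta>" "\<bar>l - 1 - \<epsilon> * lam\<bar> \<le> L * \<epsilon>\<^sup>2" "\<forall>k\<in>{1..n}. L2_on {0..} (f k)"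
      "eps_sol \<epsilon> l f u u'" "lim_sol f v v'"
    show "(\<Sum>k\<in>{1..n}. integral {0..} (\<lambda>x. (norm (u k x - v k x))\<^sup>2)) \<le> C9 * cN\<^sup>2 * (\<epsilon> * (Nf f)\<^sup>2)"
      using main[OF as] by (simp add: power_mult_distrib mult_ac)
  qed
qed

section \<open>Vertex conditions as square linear systems\<close>

definition \<alpha>K :: "nat \<Rightarrow> nat \<Rightarrow> complex" where
  "\<alpha>K r k = (if k = r then 1 else 0) - (if k = 1 then 1 else 0)"

definition \<beta>K :: "nat \<Rightarrow> nat \<Rightarrow> complex" where
  "\<beta>K r k = (if r = 1 then 1 else 0)"

definition \<alpha>H :: "nat \<Rightarrow> nat \<Rightarrow> complex" where
  "\<alpha>H r k = (if r \<le> m then (if k \<le> m then - complex_of_real (lam * q r k) else 0)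
    else (if k = r then 1 else 0) - (if k \<le> m then complex_of_real (\<theta> k r) else 0))"

definition \<beta>H :: "nat \<Rightarrow> nat \<Rightarrow> complex" where
  "\<beta>H r k = (if r \<le> m then complex_of_real (\<theta> r k) else 0)"

text \<open>In row 1 the coefficients of the values cancel, so it carries the sum of the derivatives
  alone; the other rows compare \<open>c r\<close> with \<open>c 1\<close>.\<close>

lemma Kirchhoff_rows:
  "(\<forall>r\<in>{1..n}. (\<Sum>k\<in>{1..n}. \<alpha>K r k * c k + \<beta>K r k * p k) = 0) \<longleftrightarrow>
   (\<forall>k\<in>{1..n}. c k = c 1) \<and> (\<Sum>k\<in>{1..n}. p k) = 0"
proof -
  have row: "(\<Sum>k\<in>{1..n}. \<alpha>K r k * c k + \<beta>K r k * p k) = c r - c 1 + (if r = 1 then (\<Sum>k\<in>{1..n}. p k) else 0)"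
    if "r \<in> {1..n}" for r
  proof -
    have "(\<Sum>k\<in>{1..n}. \<alpha>K r k * c k + \<beta>K r k * p k)
        = (\<Sum>k\<in>{1..n}. (if k = r then c r else 0) - (if k = 1 then c 1 else 0) + (if r = 1 then p k else 0))"
      by (intro sum.cong) (auto simp: \<alpha>K_def \<beta>K_def)
    then show ?thesis using that n by (auto simp: sum.distrib sum_subtractf)
  qed
  have 1: "1 \<in> {1..n}" using n by simp
  show ?thesis
  proof
    assume r: "\<forall>r\<in>{1..n}. (\<Sum>k\<in>{1..n}. \<alpha>K r k * c k + \<beta>K r k * p k) = 0"
    have P: "(\<Sum>k\<in>{1..n}. p k) = 0" using bspec[OF r 1] row[OF 1] by simp
    have "c k = c 1" if "k \<in> {1..n}" for k using bspec[OF r that] row[OF that] P by (simp split: if_splits)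
    with P show "(\<forall>k\<in>{1..n}. c k = c 1) \<and> (\<Sum>k\<in>{1..n}. p k) = 0" by blast
  next
    assume r: "(\<forall>k\<in>{1..n}. c k = c 1) \<and> (\<Sum>k\<in>{1..n}. p k) = 0"
    show "\<forall>r\<in>{1..n}. (\<Sum>k\<in>{1..n}. \<alpha>K r k * c k + \<beta>K r k * p k) = 0"
    proof
      fix k assume k: "k \<in> {1..n}"
      have "c k = c 1" "(\<Sum>k\<in>{1..n}. p k) = 0" using r k by blast+
      then show "(\<Sum>j\<in>{1..n}. \<alpha>K k j * c j + \<beta>K k j * p j) = 0" unfolding row[OF k] by simp
    qed
  qed
qed

text \<open>One row per edge: rows up to \<open>m\<close> are the flux conditions, the remaining
  rows the value conditions. The normalisation of \<open>\<theta>\<close> on the first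
  \<open>m\<close> edges isolates the term \<open>p i\<close>.\<close>

lemma limit_rows:
  "(\<forall>r\<in>{1..n}. (\<Sum>k\<in>{1..n}. \<alpha>H r k * c k + \<beta>H r k * p k) = 0) \<longleftrightarrow>
    (\<forall>j\<in>{m+1..n}. c j - (\<Sum>i\<in>{1..m}. complex_of_real (\<theta> i j) * c i) = 0) \<and>
    (\<forall>i\<in>{1..m}. p i + (\<Sum>j\<in>{m+1..n}. complex_of_real (\<theta> i j) * p j)
       - complex_of_real lam * (\<Sum>j\<in>{1..m}. complex_of_real (q i j) * c j) = 0)"
proof -
  have le: "(\<Sum>k\<in>{1..n}. if k \<le> m then h k else 0) = (\<Sum>k\<in>{1..m}. h k)" for h :: "nat \<Rightarrow> complex"
    using m by (intro sum.mono_neutral_cong_right) auto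
  have low: "(\<Sum>k\<in>{1..n}. \<alpha>H r k * c k + \<beta>H r k * p k) = p r + (\<Sum>j\<in>{m+1..n}. complex_of_real (\<theta> r j) * p j)
       - complex_of_real lam * (\<Sum>j\<in>{1..m}. complex_of_real (q r j) * c j)" if r: "r \<in> {1..m}" for r
  proof -
    have "(\<Sum>k\<in>{1..n}. \<alpha>H r k * c k + \<beta>H r k * p k)
        = (\<Sum>k\<in>{1..n}. (if k \<le> m then - (complex_of_real (lam * q r k) * c k) else 0) + complex_of_real (\<theta> r k) * p k)"
      using r by (intro sum.cong) (auto simp: \<alpha>H_def \<beta>H_def)
    also have "\<dots> = (\<Sum>k\<in>{1..m}. - (complex_of_real (lam * q r k) * c k)) + (\<Sum>k\<in>{1..n}. complex_of_real (\<theta> r k) * p k)"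
      unfolding sum.distrib le ..
    also have "(\<Sum>k\<in>{1..m}. - (complex_of_real (lam * q r k) * c k)) = - (complex_of_real lam * (\<Sum>j\<in>{1..m}. complex_of_real (q r j) * c j))"
      by (simp add: sum_distrib_left sum_negf mult.assoc)
    finally show ?thesis unfolding sum_\<theta>_left[OF r] by simp
  qed
  have high: "(\<Sum>k\<in>{1..n}. \<alpha>H r k * c k + \<beta>H r k * p k) = c r - (\<Sum>i\<in>{1..m}. complex_of_real (\<theta> i r) * c i)"
    if r: "r \<in> {m+1..n}" for r
  proof -
    have "(\<Sum>k\<in>{1..n}. \<alpha>H r k * c k + \<beta>H r k * p k)
        = (\<Sum>k\<in>{1..n}. (if k = r then c r else 0) - (if k \<le> m then complex_of_real (\<theta> k r) * c k else 0))"
      using r by (intro sum.cong) (auto simp: \<alpha>H_def \<beta>H_def)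
    also have "\<dots> = c r - (\<Sum>k\<in>{1..m}. complex_of_real (\<theta> k r) * c k)"
      unfolding sum_subtractf le using r by simp
    finally show ?thesis .
  qed
  have "{1..n} = {1..m} \<union> {m+1..n}" using m by auto
  then show ?thesis using low high by (simp only: ball_Un) (metis (no_types, lifting))
qed

text \<open>Lebesgue measurability is preserved by an invertible affine change of variable.
  Extension by zero makes that rule for functions on the whole line applicable, and the half-line is
  invariant under the dilation.\<close>

lemma scaled_potential_measurable:
  assumes k: "k \<in> {1..n}" and \<epsilon>: "0 < \<epsilon>"
  shows "(\<lambda>x. c * Q k (x / \<epsilon>)) \<in> borel_measurable (lebesgue_on {0..})"
proof -
  have "(\<lambda>x. if x \<in> {0..} then Q k x else 0) \<in> borel_measurable lebesgue"
    using Q_meas[OF k] by (subst borel_measurable_if) auto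
  then have "(\<lambda>x. if 0 + (1 / \<epsilon>) *\<^sub>R x \<in> {0..} then Q k (0 + (1 / \<epsilon>) *\<^sub>R x) else 0) \<in> borel_measurable lebesgue"
    using \<epsilon> by (intro borel_measurable_affine) auto
  then have "(\<lambda>x. if x \<in> {0..} then Q k (x / \<epsilon>) else 0) \<in> borel_measurable lebesgue"
    using \<epsilon> by (simp add: zero_le_divide_iff cong: if_cong)
  then have "(\<lambda>x. Q k (x / \<epsilon>)) \<in> borel_measurable (lebesgue_on {0..})" by (rule borel_measurable_if_D)
  then show ?thesis by measurable
qed

lemma eps_resolvent:
  assumes \<epsilon>: "0 < \<epsilon>"
  shows "star_resolvent {1..n} {1..n} (\<lambda>k x. l / \<epsilon>^2 * Q k (x / \<epsilon>)) (\<lambda>k. \<epsilon> * a k) \<alpha>K \<beta>K \<zeta> \<kappa> (\<bar>l / \<epsilon>^2\<bar> * B)"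
proof
  show "(\<lambda>x. l / \<epsilon>^2 * Q k (x / \<epsilon>)) \<in> borel_measurable (lebesgue_on {0..})" if "k \<in> {1..n}" for k
    using that \<epsilon> by (rule scaled_potential_measurable)
  show "\<bar>l / \<epsilon>^2 * Q k (x / \<epsilon>)\<bar> \<le> \<bar>l / \<epsilon>^2\<bar> * B" if "k \<in> {1..n}" "0 \<le> x" for k x
    unfolding abs_mult[of "l / \<epsilon>^2"] using Q_bdd[OF that(1), of "x / \<epsilon>"] that \<epsilon> by (intro mult_left_mono) auto
  show "l / \<epsilon>^2 * Q k (x / \<epsilon>) = 0" if "k \<in> {1..n}" "\<epsilon> * a k < x" for k x
  proof -
    have "a k < x / \<epsilon>" using that \<epsilon> by (simp add: field_simps)
    then show ?thesis using Q_supp[OF that(1)] by simp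
  qed
  show "0 \<le> \<epsilon> * a k" if "k \<in> {1..n}" for k using a[OF that] \<epsilon> by simp
  show "Im (\<Sum>k\<in>{1..n}. p k * cnj (c k)) = 0"
    if "\<And>r. r \<in> {1..n} \<Longrightarrow> (\<Sum>k\<in>{1..n}. \<alpha>K r k * c k + \<beta>K r k * p k) = 0" for c p
  proof -
    have "(\<forall>k\<in>{1..n}. c k = c 1) \<and> (\<Sum>k\<in>{1..n}. p k) = 0" using that by (subst Kirchhoff_rows[symmetric]) blast
    then have "\<forall>k\<in>{1..n}. c k = c 1" and p: "(\<Sum>k\<in>{1..n}. p k) = 0" by blast+
    note c = bspec[OF this(1)]
    have "(\<Sum>k\<in>{1..n}. p k * cnj (c k)) = (\<Sum>k\<in>{1..n}. p k * cnj (c 1))"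
    proof (intro sum.cong refl)
      fix k assume "k \<in> {1..n}"
      from c[OF this] show "p k * cnj (c k) = p k * cnj (c 1)" by (rule arg_cong)
    qed
    also have "\<dots> = 0" unfolding sum_distrib_right[symmetric] p by simp
    finally show ?thesis by simp
  qed
qed (use \<zeta> \<kappa> in auto)

text \<open>Symmetry of the limit conditions: by \<open>boundary_form\<close> and the flux
  conditions the boundary term is the real number \<open>lam\<close> times the quadratic form of the
  symmetric real matrix \<open>q\<close>.\<close>

lemma lim_resolvent: "star_resolvent {1..n} {1..n} (\<lambda>_ _. 0) (\<lambda>_. 0) \<alpha>H \<beta>H \<zeta> \<kappa> 0"
proof
  show "Im (\<Sum>k\<in>{1..n}. p k * cnj (c k)) = 0"
    if "\<And>r. r \<in> {1..n} \<Longrightarrow> (\<Sum>k\<in>{1..n}. \<alpha>H r k * c k + \<beta>H r k * p k) = 0" for c p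
  proof -
    have bc: "(\<forall>j\<in>{m+1..n}. c j - (\<Sum>i\<in>{1..m}. complex_of_real (\<theta> i j) * c i) = 0) \<and>
      (\<forall>i\<in>{1..m}. p i + (\<Sum>j\<in>{m+1..n}. complex_of_real (\<theta> i j) * p j)
       - complex_of_real lam * (\<Sum>j\<in>{1..m}. complex_of_real (q i j) * c j) = 0)"
      using that by (subst limit_rows[symmetric]) blast
    have c: "c j = (\<Sum>i\<in>{1..m}. complex_of_real (\<theta> i j) * c i)" if "j \<in> {1..n}" for j
    proof (cases "j \<le> m")
      case True then show ?thesis using sum_\<theta>_right[of j c] that by simp
    next
      case False then show ?thesis using bc that by simp
    qed
    have p: "(\<Sum>k\<in>{1..n}. complex_of_real (\<theta> i k) * p k) = complex_of_real lam * (\<Sum>j\<in>{1..m}. complex_of_real (q i j) * c j)"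
      if "i \<in> {1..m}" for i
      unfolding sum_\<theta>_left[OF that] using bc that by simp
    have "(\<Sum>k\<in>{1..n}. p k * cnj (c k)) = (\<Sum>i\<in>{1..m}. cnj (c i) * (\<Sum>k\<in>{1..n}. complex_of_real (\<theta> i k) * p k))"
      using c by (rule boundary_form)
    also have "\<dots> = (\<Sum>i\<in>{1..m}. complex_of_real lam * (cnj (c i) * (\<Sum>j\<in>{1..m}. complex_of_real (q i j) * c j)))"
      by (intro sum.cong refl) (simp only: p mult.left_commute)
    also have "\<dots> = complex_of_real lam * (\<Sum>i\<in>{1..m}. cnj (c i) * (\<Sum>j\<in>{1..m}. complex_of_real (q i j) * c j))"
      by (rule sum_distrib_left[symmetric])
    finally have "Im (\<Sum>k\<in>{1..n}. p k * cnj (c k))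
        = lam * Im (\<Sum>i\<in>{1..m}. cnj (c i) * (\<Sum>j\<in>{1..m}. complex_of_real (q i j) * c j))"
      by (simp only: times_complex.sel Re_complex_of_real Im_complex_of_real)
    then show ?thesis unfolding quadratic_form_real by simp
  qed
qed (use \<zeta> \<kappa> in auto)

lemma solves_Heps_iff:
  assumes \<epsilon>: "0 < \<epsilon>" and f: "L2_graph n f"
  shows "solves_Heps n Q lamf \<epsilon> \<zeta> f u \<longleftrightarrow> (\<exists>u'. eps_sol \<epsilon> (lamf \<epsilon>) f u u')"
proof -
  interpret R: star_resolvent "{1..n}" "{1..n}" "\<lambda>k x. lamf \<epsilon> / \<epsilon>^2 * Q k (x / \<epsilon>)" "\<lambda>k. \<epsilon> * a k" \<alpha>K \<beta>K \<zeta> \<kappa> "\<bar>lamf \<epsilon> / \<epsilon>^2\<bar> * B"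
    by (rule eps_resolvent[OF \<epsilon>])
  let ?c = "\<lambda>k x. complex_of_real (lamf \<epsilon> / \<epsilon>^2 * Q k (x / \<epsilon>))"
  have edge: "edge_sol (\<lambda>x. ?c k x - \<zeta>) (f k) (u k) (u' k) \<longleftrightarrow>
    (\<exists>u''. H2_on {0..} (u k) (u' k) u'' \<and> (AE x in lebesgue_on {0..}. - u'' x + ?c k x * u k x - \<zeta> * u k x = f k x))"
    if k: "k \<in> {1..n}" for k u'
  proof -
    have fk: "L2_on {0..} (f k)" using f k by (simp add: L2_graph_def)
    have V: "R.V k = (\<lambda>x. ?c k x - \<zeta>)" by (rule ext) (simp only: R.V_def)
    have "edge_sol (\<lambda>x. ?c k x - \<zeta>) (f k) (u k) (u' k) \<longleftrightarrow>
      (\<exists>u''. H2_on {0..} (u k) (u' k) u'' \<and> (AE x in lebesgue_on {0..}. u'' x = (?c k x - \<zeta>) * u k x - f k x))"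
      by (rule edge_sol_iff[OF R.V_measurable[OF k] R.V_bounded[OF k] fk, unfolded V])
    moreover have "y = (?c k x - \<zeta>) * u k x - f k x \<longleftrightarrow> - y + ?c k x * u k x - \<zeta> * u k x = f k x" for x y
      by (rule resolvent_equation_iff)
    ultimately show ?thesis by simp
  qed
  show ?thesis
  proof
    assume "solves_Heps n Q lamf \<epsilon> \<zeta> f u"
    then obtain u' u'' where s: "\<forall>k\<in>{1..n}. H2_on {0..} (u k) (u' k) (u'' k)"
      "\<forall>k\<in>{1..n}. u k 0 = u 1 0" "(\<Sum>k\<in>{1..n}. u' k 0) = 0"
      "\<forall>k\<in>{1..n}. AE x in lebesgue_on {0..}. - u'' k x + ?c k x * u k x - \<zeta> * u k x = f k x"
      unfolding solves_Heps_def by blast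
    have "\<forall>k\<in>{1..n}. edge_sol (\<lambda>x. ?c k x - \<zeta>) (f k) (u k) (u' k)" using s edge by blast
    with s show "\<exists>u'. eps_sol \<epsilon> (lamf \<epsilon>) f u u'" unfolding eps_sol_def by blast
  next
    assume "\<exists>u'. eps_sol \<epsilon> (lamf \<epsilon>) f u u'"
    then obtain u' where e: "\<forall>k\<in>{1..n}. edge_sol (\<lambda>x. ?c k x - \<zeta>) (f k) (u k) (u' k)"
      and s: "\<forall>k\<in>{1..n}. u k 0 = u 1 0" "(\<Sum>k\<in>{1..n}. u' k 0) = 0"
      unfolding eps_sol_def by blast
    have "\<forall>k\<in>{1..n}. \<exists>u''. H2_on {0..} (u k) (u' k) u'' \<and>
        (AE x in lebesgue_on {0..}. - u'' x + ?c k x * u k x - \<zeta> * u k x = f k x)"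
      using e edge by blast
    from bchoice[OF this] show "solves_Heps n Q lamf \<epsilon> \<zeta> f u" using s unfolding solves_Heps_def by blast
  qed
qed

lemma solves_H_iff:
  assumes f: "L2_graph n f"
  shows "solves_H n m a Q \<psi> lam \<zeta> f u \<longleftrightarrow> (\<exists>u'. lim_sol f u u')"
proof -
  interpret R: star_resolvent "{1..n}" "{1..n}" "\<lambda>_ _. 0" "\<lambda>_. 0" \<alpha>H \<beta>H \<zeta> \<kappa> 0 by (rule lim_resolvent)
  have edge: "edge_sol (\<lambda>x. complex_of_real 0 - \<zeta>) (f k) (u k) (u' k) \<longleftrightarrow>
    (\<exists>u''. H2_on {0..} (u k) (u' k) u'' \<and> (AE x in lebesgue_on {0..}. - u'' x - \<zeta> * u k x = f k x))"
    if k: "k \<in> {1..n}" for k u'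
  proof -
    have fk: "L2_on {0..} (f k)" using f k by (simp add: L2_graph_def)
    have V: "R.V k = (\<lambda>x. complex_of_real 0 - \<zeta>)" by (rule ext) (simp only: R.V_def)
    have "edge_sol (\<lambda>x. complex_of_real 0 - \<zeta>) (f k) (u k) (u' k) \<longleftrightarrow>
      (\<exists>u''. H2_on {0..} (u k) (u' k) u'' \<and> (AE x in lebesgue_on {0..}. u'' x = (complex_of_real 0 - \<zeta>) * u k x - f k x))"
      by (rule edge_sol_iff[OF R.V_measurable[OF k] R.V_bounded[OF k] fk, unfolded V])
    moreover have "y = (complex_of_real 0 - \<zeta>) * u k x - f k x \<longleftrightarrow> - y - \<zeta> * u k x = f k x" for x y
      using resolvent_equation_iff[of y 0 \<zeta> "u k x" "f k x"] by simp
    ultimately show ?thesis by simp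
  qed
  show ?thesis
  proof
    assume "solves_H n m a Q \<psi> lam \<zeta> f u"
    then obtain u' u'' where s: "\<forall>k\<in>{1..n}. H2_on {0..} (u k) (u' k) (u'' k)"
      "\<forall>j\<in>{m+1..n}. u j 0 - (\<Sum>i\<in>{1..m}. complex_of_real (\<theta> i j) * u i 0) = 0"
      "\<forall>i\<in>{1..m}. u' i 0 + (\<Sum>j\<in>{m+1..n}. complex_of_real (\<theta> i j) * u' j 0)
         - complex_of_real lam * (\<Sum>j\<in>{1..m}. complex_of_real (q i j) * u j 0) = 0"
      "\<forall>k\<in>{1..n}. AE x in lebesgue_on {0..}. - u'' k x - \<zeta> * u k x = f k x"
      unfolding solves_H_def Let_def \<theta>_def q_def by blast
    have "\<forall>k\<in>{1..n}. edge_sol (\<lambda>x. complex_of_real 0 - \<zeta>) (f k) (u k) (u' k)" using s edge by blast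
    with s show "\<exists>u'. lim_sol f u u'" unfolding lim_sol_def by blast
  next
    assume "\<exists>u'. lim_sol f u u'"
    then obtain u' where e: "\<forall>k\<in>{1..n}. edge_sol (\<lambda>x. complex_of_real 0 - \<zeta>) (f k) (u k) (u' k)"
      and s: "\<forall>j\<in>{m+1..n}. u j 0 - (\<Sum>i\<in>{1..m}. complex_of_real (\<theta> i j) * u i 0) = 0"
      "\<forall>i\<in>{1..m}. u' i 0 + (\<Sum>j\<in>{m+1..n}. complex_of_real (\<theta> i j) * u' j 0)
         - complex_of_real lam * (\<Sum>j\<in>{1..m}. complex_of_real (q i j) * u j 0) = 0"
      unfolding lim_sol_def by blast
    have "\<forall>k\<in>{1..n}. \<exists>u''. H2_on {0..} (u k) (u' k) u'' \<and>
        (AE x in lebesgue_on {0..}. - u'' x - \<zeta> * u k x = f k x)"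
      using e edge by blast
    from bchoice[OF this] show "solves_H n m a Q \<psi> lam \<zeta> f u"
      using s unfolding solves_H_def Let_def \<theta>_def q_def by blast
  qed
qed

lemma eps_sol_iff_solution:
  assumes "0 < \<epsilon>"
  shows "eps_sol \<epsilon> l f u u' \<longleftrightarrow> star_resolvent.solution {1..n} {1..n} (\<lambda>k x. l / \<epsilon>^2 * Q k (x / \<epsilon>)) \<alpha>K \<beta>K \<zeta> f u u'"
proof -
  interpret R: star_resolvent "{1..n}" "{1..n}" "\<lambda>k x. l / \<epsilon>^2 * Q k (x / \<epsilon>)" "\<lambda>k. \<epsilon> * a k" \<alpha>K \<beta>K \<zeta> \<kappa> "\<bar>l / \<epsilon>^2\<bar> * B"
    by (rule eps_resolvent[OF assms])
  have V: "R.V = (\<lambda>k x. complex_of_real (l / \<epsilon>^2 * Q k (x / \<epsilon>)) - \<zeta>)" by (intro ext) (simp only: R.V_def)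
  show ?thesis unfolding R.solution_def V eps_sol_def Kirchhoff_rows[of "\<lambda>k. u k 0" "\<lambda>k. u' k 0"] ..
qed

lemma lim_sol_iff_solution:
  "lim_sol f u u' \<longleftrightarrow> star_resolvent.solution {1..n} {1..n} (\<lambda>_ _. 0) \<alpha>H \<beta>H \<zeta> f u u'"
proof -
  interpret R: star_resolvent "{1..n}" "{1..n}" "\<lambda>_ _. 0" "\<lambda>_. 0" \<alpha>H \<beta>H \<zeta> \<kappa> 0 by (rule lim_resolvent)
  have V: "R.V = (\<lambda>k x. complex_of_real 0 - \<zeta>)" by (intro ext) (simp only: R.V_def)
  show ?thesis unfolding R.solution_def V lim_sol_def limit_rows[of "\<lambda>k. u k 0" "\<lambda>k. u' k 0"] ..
qed

lemma L2norm_graph_eq_Nf: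
  assumes "\<forall>k\<in>{1..n}. L2_on {0..} (f k)"
  shows "L2norm_graph n f = Nf f"
  unfolding L2norm_graph_def Nf_def using assms by (intro arg_cong[where f = sqrt] sum.cong refl L2_on_integral) auto

end

text \<open>The operators enter through their resolvent equations. Solvability and uniqueness for
  every square integrable datum make the resolvents well-defined maps, and this gives the last
  conjunct its meaning as a bound in operator norm.\<close>

theorem theorem1:
  fixes n m :: nat and a :: "nat \<Rightarrow> real" and Q :: "nat \<Rightarrow> real \<Rightarrow> real"
    and lamf :: "real \<Rightarrow> real" and lam :: real
    and \<psi> :: "nat \<Rightarrow> nat \<Rightarrow> real \<Rightarrow> real" and \<zeta> :: complex
  assumes n_pos: "n \<ge> 1"
    and a_pos: "\<forall>k\<in>{1..n}. a k > 0"
    and Q_meas: "\<forall>k\<in>{1..n}. Q k \<in> borel_measurable lebesgue"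
    and Q_bdd: "\<exists>B. \<forall>k\<in>{1..n}. \<forall>x\<ge>0. \<bar>Q k x\<bar> \<le> B"
    and Q_supp: "\<forall>k\<in>{1..n}. \<forall>x. x > a k \<longrightarrow> Q k x = 0"
    and lam_holo: "\<exists>g r. r > 0 \<and> g holomorphic_on ball 0 r \<and>
                      (\<forall>x::real. \<bar>x\<bar> < r \<longrightarrow> g (complex_of_real x) = complex_of_real (lamf x))"
    and lam_exp: "(\<lambda>e. lamf e - 1 - e * lam) \<in> O[at 0](\<lambda>e. e^2)"
    and m_le: "m \<le> n"
    and psi_sol: "\<forall>i\<in>{1..m}. solves_R n a Q (\<psi> i)"
    and psi_indep: "\<forall>c::nat \<Rightarrow> real. (\<forall>k\<in>{1..n}. \<forall>x\<in>{0..a k}. (\<Sum>i\<in>{1..m}. c i * \<psi> i k x) = 0)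
                      \<longrightarrow> (\<forall>i\<in>{1..m}. c i = 0)"
    and psi_span: "\<forall>\<phi>. solves_R n a Q \<phi> \<longrightarrow>
                      (\<exists>c::nat \<Rightarrow> real. \<forall>k\<in>{1..n}. \<forall>x\<in>{0..a k}. \<phi> k x = (\<Sum>i\<in>{1..m}. c i * \<psi> i k x))"
    and psi_delta: "\<forall>i\<in>{1..m}. \<forall>j\<in>{1..m}. \<psi> i j (a j) = (if i = j then 1 else 0)"
    and zeta_nonreal: "Im \<zeta> \<noteq> 0"
  shows "(\<forall>\<epsilon>\<in>{0<..1}. \<forall>f. L2_graph n f \<longrightarrow>
            (\<exists>u. L2_graph n u \<and> solves_Heps n Q lamf \<epsilon> \<zeta> f u) \<and>
            (\<forall>u1 u2. solves_Heps n Q lamf \<epsilon> \<zeta> f u1 \<and> solves_Heps n Q lamf \<epsilon> \<zeta> f u2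
                \<longrightarrow> (\<forall>k\<in>{1..n}. \<forall>x\<ge>0. u1 k x = u2 k x)))
       \<and> (\<forall>f. L2_graph n f \<longrightarrow>
            (\<exists>v. solves_H n m a Q \<psi> lam \<zeta> f v) \<and>
            (\<forall>v1 v2. solves_H n m a Q \<psi> lam \<zeta> f v1 \<and> solves_H n m a Q \<psi> lam \<zeta> f v2
                \<longrightarrow> (\<forall>k\<in>{1..n}. \<forall>x\<ge>0. v1 k x = v2 k x)))
       \<and> (\<exists>C. \<forall>\<epsilon>\<in>{0<..1}. \<forall>f u v. L2_graph n f \<and> solves_Heps n Q lamf \<epsilon> \<zeta> f u
               \<and> solves_H n m a Q \<psi> lam \<zeta> f v
               \<longrightarrow> L2norm_graph n (\<lambda>k x. u k x - v k x) \<le> C * sqrt \<epsilon> * L2norm_graph n f)"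
proof -
  obtain B where B: "\<forall>k\<in>{1..n}. \<forall>x\<ge>0. \<bar>Q k x\<bar> \<le> B" using Q_bdd by blast
  \<comment> \<open>The expansion controls \<open>lamf\<close> only on a punctured neighbourhood of
    0, of radius \<open>d\<close>; larger values of \<epsilon> need a separate argument.\<close>
  from landau_o.bigE[OF lam_exp] obtain L where L: "L > 0"
    and ev: "\<forall>\<^sub>F e in at 0. norm (lamf e - 1 - e * lam) \<le> L * norm (e\<^sup>2)" .
  from ev obtain d where d: "d > 0" and "\<forall>e\<in>UNIV. e \<noteq> 0 \<and> dist e 0 < d \<longrightarrow> norm (lamf e - 1 - e * lam) \<le> L * norm (e\<^sup>2)"
    unfolding eventually_at by blast
  then have lamf: "\<bar>lamf \<epsilon> - 1 - \<epsilon> * lam\<bar> \<le> L * \<epsilon>\<^sup>2" if "0 < \<epsilon>" "\<epsilon> < d" for \<epsilon>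
    using that by auto
  define \<kappa> where "\<kappa> = csqrt (- \<zeta>)"
  have \<kappa>2: "\<kappa>\<^sup>2 = - \<zeta>" by (simp add: \<kappa>_def)
  have "Re \<kappa> \<noteq> 0"
  proof
    assume "Re \<kappa> = 0"
    then have "Im (\<kappa>\<^sup>2) = 0" by (simp add: power2_eq_square)
    then show False using \<kappa>2 zeta_nonreal by simp
  qed
  then have \<kappa>: "0 < Re \<kappa>" using csqrt_principal[of "- \<zeta>"] by (auto simp: \<kappa>_def)
  interpret S: star_limit n m a Q B \<psi> \<zeta> lam L "1 / sqrt (2 * Re \<kappa>) + norm \<kappa>" \<kappa>
  proof
    show "Q k \<in> borel_measurable (lebesgue_on {0..})" if "k \<in> {1..n}" for k
      using Q_meas that by (intro measurable_restrict_space1) blast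
    show "\<exists>c::nat \<Rightarrow> real. \<forall>k\<in>{1..n}. \<forall>x\<in>{0..a k}. \<phi> k x = (\<Sum>i\<in>{1..m}. c i * \<psi> i k x)"
      if "solves_R n a Q \<phi>" for \<phi>
      using psi_span that by blast
  qed (use n_pos m_le a_pos B psi_sol psi_delta Q_supp zeta_nonreal \<kappa> \<kappa>2 L in auto)
  have L2: "\<forall>k\<in>{1..n}. L2_on {0..} (f k)" if "L2_graph n f" for f using that by (simp add: L2_graph_def)
  note L2k = bspec[OF L2]
  have part1: "(\<exists>u. L2_graph n u \<and> solves_Heps n Q lamf \<epsilon> \<zeta> f u) \<and>
      (\<forall>u1 u2. solves_Heps n Q lamf \<epsilon> \<zeta> f u1 \<and> solves_Heps n Q lamf \<epsilon> \<zeta> f u2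
        \<longrightarrow> (\<forall>k\<in>{1..n}. \<forall>x\<ge>0. u1 k x = u2 k x))"
    if \<epsilon>: "\<epsilon> \<in> {0<..1}" and f: "L2_graph n f" for \<epsilon> f
  proof -
    have \<epsilon>0: "0 < \<epsilon>" using \<epsilon> by simp
    note iff = S.solves_Heps_iff[OF \<epsilon>0 f, unfolded S.eps_sol_iff_solution[OF \<epsilon>0]]
    note R = S.eps_resolvent[OF \<epsilon>0, of "lamf \<epsilon>"]
    have "\<exists>u u'. star_resolvent.solution {1..n} {1..n} (\<lambda>k x. lamf \<epsilon> / \<epsilon>^2 * Q k (x / \<epsilon>)) S.\<alpha>K S.\<beta>K \<zeta> f u u'"
      by (rule star_resolvent.solution_exists[OF R]) (rule L2k[OF f])
    then obtain u u' where
      u: "star_resolvent.solution {1..n} {1..n} (\<lambda>k x. lamf \<epsilon> / \<epsilon>^2 * Q k (x / \<epsilon>)) S.\<alpha>K S.\<beta>K \<zeta> f u u'" by blast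
    have "S.eps_sol \<epsilon> (lamf \<epsilon>) f u u'" using u by (simp only: S.eps_sol_iff_solution[OF \<epsilon>0])
    then have "L2_graph n u" by (simp add: S.eps_sol_def edge_sol_def L2_graph_def)
    moreover have "solves_Heps n Q lamf \<epsilon> \<zeta> f u" unfolding iff using u by blast
    moreover have "u1 k x = u2 k x" if "solves_Heps n Q lamf \<epsilon> \<zeta> f u1" "solves_Heps n Q lamf \<epsilon> \<zeta> f u2"
        "k \<in> {1..n}" "0 \<le> x" for u1 u2 k x
      using that star_resolvent.solution_unique[OF R] unfolding iff by blast
    ultimately show ?thesis by blast
  qed
  have part2: "(\<exists>v. solves_H n m a Q \<psi> lam \<zeta> f v) \<and>
      (\<forall>v1 v2. solves_H n m a Q \<psi> lam \<zeta> f v1 \<and> solves_H n m a Q \<psi> lam \<zeta> f v2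
        \<longrightarrow> (\<forall>k\<in>{1..n}. \<forall>x\<ge>0. v1 k x = v2 k x))"
    if f: "L2_graph n f" for f
  proof -
    note iff = S.solves_H_iff[OF f, unfolded S.lim_sol_iff_solution]
    have "\<exists>v. solves_H n m a Q \<psi> lam \<zeta> f v"
      unfolding iff by (rule star_resolvent.solution_exists[OF S.lim_resolvent]) (rule L2k[OF f])
    moreover have "v1 k x = v2 k x" if "solves_H n m a Q \<psi> lam \<zeta> f v1" "solves_H n m a Q \<psi> lam \<zeta> f v2"
        "k \<in> {1..n}" "0 \<le> x" for v1 v2 k x
      using that star_resolvent.solution_unique[OF S.lim_resolvent] unfolding iff by blast
    ultimately show ?thesis by blast
  qed
  obtain C \<delta>0 where C: "0 \<le> C" and \<delta>0: "0 < \<delta>0"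
    and diff: "\<forall>\<epsilon> l f u u' v v'. 0 < \<epsilon> \<longrightarrow> \<epsilon> \<le> 1 \<longrightarrow> \<epsilon> \<le> \<delta>0 \<longrightarrow> \<bar>l - 1 - \<epsilon> * lam\<bar> \<le> L * \<epsilon>\<^sup>2 \<longrightarrow>
     (\<forall>k\<in>{1..n}. L2_on {0..} (f k)) \<longrightarrow> S.eps_sol \<epsilon> l f u u' \<longrightarrow> S.lim_sol f v v' \<longrightarrow>
     (\<Sum>k\<in>{1..n}. integral {0..} (\<lambda>x. (norm (u k x - v k x))\<^sup>2)) \<le> C * (\<epsilon> * (S.Nf f)\<^sup>2)"
    using S.resolvent_difference by blast
  \<comment> \<open>Half of \<open>d\<close> turns \<open>\<epsilon> \<le> \<delta>\<close> into the
    strict inequality \<open>\<epsilon> < d\<close>.\<close>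
  define \<delta> where "\<delta> = min \<delta>0 (d / 2)"
  have \<delta>: "0 < \<delta>" using \<delta>0 d by (simp add: \<delta>_def)
  \<comment> \<open>For \<epsilon> above \<delta> the square norm of the difference is at most twice
    the sum of the two squared resolvent bounds, that is 4 / (Im \<zeta>)^2 times the squared norm
    of \<open>f\<close>. Dividing by \<delta> converts this into a multiple of \<epsilon>.\<close>
  define E where "E = 4 / ((Im \<zeta>)\<^sup>2 * \<delta>)"
  have E: "0 \<le> E" using \<delta> by (simp add: E_def)
  have part3: "L2norm_graph n (\<lambda>k x. u k x - v k x) \<le> sqrt (C + E) * sqrt \<epsilon> * L2norm_graph n f"
    if \<epsilon>: "\<epsilon> \<in> {0<..1}" and f: "L2_graph n f" and u: "solves_Heps n Q lamf \<epsilon> \<zeta> f u"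
      and v: "solves_H n m a Q \<psi> lam \<zeta> f v" for \<epsilon> f u v
  proof -
    have \<epsilon>0: "0 < \<epsilon>" "\<epsilon> \<le> 1" using \<epsilon> by auto
    from u obtain u' where u': "S.eps_sol \<epsilon> (lamf \<epsilon>) f u u'" unfolding S.solves_Heps_iff[OF \<epsilon>0(1) f] ..
    from v obtain v' where v': "S.lim_sol f v v'" unfolding S.solves_H_iff[OF f] ..
    have uL: "L2_on {0..} (u k)" and vL: "L2_on {0..} (v k)" if "k \<in> {1..n}" for k
      using u' v' that by (auto simp: S.eps_sol_def S.lim_sol_def edge_sol_def)
    have wL: "\<forall>k\<in>{1..n}. L2_on {0..} (\<lambda>x. u k x - v k x)" using uL vL by (intro ballI L2_on_diff) auto
    have Nf2: "(S.Nf f)\<^sup>2 = (\<Sum>k\<in>{1..n}. integral {0..} (\<lambda>x. (norm (f k x))\<^sup>2))" by (rule S.Nf_square[OF L2[OF f]])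
    have N0: "0 \<le> S.Nf f" by (rule S.Nf_nonneg[OF L2[OF f]])
    have "(\<Sum>k\<in>{1..n}. integral {0..} (\<lambda>x. (norm (u k x - v k x))\<^sup>2)) \<le> (C + E) * (\<epsilon> * (S.Nf f)\<^sup>2)"
    proof (cases "\<epsilon> \<le> \<delta>")
      case True
      then have "\<epsilon> \<le> \<delta>0" "\<epsilon> < d" using d \<epsilon>0 by (auto simp: \<delta>_def)
      then have "(\<Sum>k\<in>{1..n}. integral {0..} (\<lambda>x. (norm (u k x - v k x))\<^sup>2)) \<le> C * (\<epsilon> * (S.Nf f)\<^sup>2)"
        using diff \<epsilon>0 lamf L2[OF f] u' v' by blast
      also have "\<dots> \<le> (C + E) * (\<epsilon> * (S.Nf f)\<^sup>2)" using E \<epsilon>0 by (intro mult_right_mono) auto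
      finally show ?thesis .
    next
      case False
      define su where "su = (\<Sum>k\<in>{1..n}. integral {0..} (\<lambda>x. (norm (u k x))\<^sup>2))"
      define sv where "sv = (\<Sum>k\<in>{1..n}. integral {0..} (\<lambda>x. (norm (v k x))\<^sup>2))"
      have su: "(Im \<zeta>)\<^sup>2 * su \<le> (S.Nf f)\<^sup>2"
        unfolding su_def Nf2 by (rule star_resolvent.solution_bound[OF S.eps_resolvent[OF \<epsilon>0(1)] u'[unfolded S.eps_sol_iff_solution[OF \<epsilon>0(1)]]])
          (rule L2k[OF f])
      have sv: "(Im \<zeta>)\<^sup>2 * sv \<le> (S.Nf f)\<^sup>2"
        unfolding sv_def Nf2 by (rule star_resolvent.solution_bound[OF S.lim_resolvent v'[unfolded S.lim_sol_iff_solution]])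
          (rule L2k[OF f])
      have "(\<Sum>k\<in>{1..n}. integral {0..} (\<lambda>x. (norm (u k x - v k x))\<^sup>2))
          \<le> (\<Sum>k\<in>{1..n}. 2 * integral {0..} (\<lambda>x. (norm (u k x))\<^sup>2) + 2 * integral {0..} (\<lambda>x. (norm (v k x))\<^sup>2))"
      proof (rule sum_mono)
        fix k assume k: "k \<in> {1..n}"
        have ui: "(\<lambda>x. 2 * (norm (u k x))\<^sup>2) integrable_on {0..}" and vi: "(\<lambda>x. 2 * (norm (v k x))\<^sup>2) integrable_on {0..}"
          using uL[OF k] vL[OF k] by (auto intro!: integrable_on_mult_right L2_on_square_integrable)
        have "integral {0..} (\<lambda>x. (norm (u k x - v k x))\<^sup>2) \<le> integral {0..} (\<lambda>x. 2 * (norm (u k x))\<^sup>2 + 2 * (norm (v k x))\<^sup>2)"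
        proof (rule integral_le)
          show "(\<lambda>x. (norm (u k x - v k x))\<^sup>2) integrable_on {0..}" using bspec[OF wL k] by (rule L2_on_square_integrable) simp
          show "(\<lambda>x. 2 * (norm (u k x))\<^sup>2 + 2 * (norm (v k x))\<^sup>2) integrable_on {0..}" using ui vi by (rule integrable_add)
          fix x
          have "(norm (u k x - v k x))\<^sup>2 \<le> (norm (u k x) + norm (v k x))\<^sup>2"
            by (intro power_mono norm_triangle_ineq4) auto
          also have "\<dots> \<le> 2 * (norm (u k x))\<^sup>2 + 2 * (norm (v k x))\<^sup>2"
            using zero_le_power2[of "norm (u k x) - norm (v k x)"] by (simp add: power2_eq_square algebra_simps)
          finally show "(norm (u k x - v k x))\<^sup>2 \<le> 2 * (norm (u k x))\<^sup>2 + 2 * (norm (v k x))\<^sup>2" .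
        qed
        also have "\<dots> = 2 * integral {0..} (\<lambda>x. (norm (u k x))\<^sup>2) + 2 * integral {0..} (\<lambda>x. (norm (v k x))\<^sup>2)"
          unfolding Henstock_Kurzweil_Integration.integral_add[OF ui vi] by simp
        finally show "integral {0..} (\<lambda>x. (norm (u k x - v k x))\<^sup>2)
          \<le> 2 * integral {0..} (\<lambda>x. (norm (u k x))\<^sup>2) + 2 * integral {0..} (\<lambda>x. (norm (v k x))\<^sup>2)" .
      qed
      also have "\<dots> = 2 * su + 2 * sv" by (simp add: su_def sv_def sum.distrib sum_distrib_left)
      also have "\<dots> \<le> 4 * (S.Nf f)\<^sup>2 / (Im \<zeta>)\<^sup>2"
        using su sv zeta_nonreal by (simp add: field_simps)
      also have "\<dots> = E * (\<delta> * (S.Nf f)\<^sup>2)" using \<delta> by (simp add: E_def)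
      also have "\<dots> \<le> (C + E) * (\<epsilon> * (S.Nf f)\<^sup>2)"
        using False C E \<delta> by (intro mult_mono mult_right_mono) auto
      finally show ?thesis .
    qed
    then have "L2norm_graph n (\<lambda>k x. u k x - v k x) \<le> sqrt ((C + E) * (\<epsilon> * (S.Nf f)\<^sup>2))"
      unfolding S.L2norm_graph_eq_Nf[OF wL] S.Nf_def by (rule real_sqrt_le_mono)
    also have "\<dots> = sqrt (C + E) * sqrt \<epsilon> * S.Nf f" using N0 by (simp add: real_sqrt_mult)
    finally show ?thesis unfolding S.L2norm_graph_eq_Nf[OF L2[OF f]] .
  qed
  have part3': "\<exists>C. \<forall>\<epsilon>\<in>{0<..1}. \<forall>f u v. L2_graph n f \<and> solves_Heps n Q lamf \<epsilon> \<zeta> f u \<and> solves_H n m a Q \<psi> lam \<zeta> f v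
      \<longrightarrow> L2norm_graph n (\<lambda>k x. u k x - v k x) \<le> C * sqrt \<epsilon> * L2norm_graph n f"
    by (rule exI[of _ "sqrt (C + E)"], intro ballI allI impI, elim conjE, rule part3)
  show ?thesis
    by (rule conjI, intro ballI allI impI, rule part1, assumption, assumption,
        rule conjI, intro allI impI, rule part2, assumption, rule part3')
qed

end
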